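(* Let $p\in(1,\infty)$, let $G$ be a countable (discrete) Powers group, and let $(G,A,\alpha)$ be a separable nondegenerately representable isometric $G$-$L^p$ operator algebra with $A$ unital. Then every trace on $F^p_{\mathrm r}(G,A,\alpha)$ is of the form $\sigma\circ E$ for some $G$-invariant trace $\sigma$ on $A$, and every normalized trace on $F^p_{\mathrm r}(G,A,\alpha)$ is of the form $\sigma\circ E$ for some $G$-invariant normalized trace $\sigma$ on $A$, where $E\colon F^p_{\mathrm r}(G,A,\alpha)\to A$ is the standard conditional expectation. In particular, if $A$ has a unique normalized trace, then so does $F^p_{\mathrm r}(G,A,\alpha)$.
   Context: **$L^p$ operator algebras.** For $p\in[1,\infty)$, an $L^p$ operator algebra is a Banach algebra $A$ isometrically isomorphic to a norm closed subalgebra of $B(L^p(X,\mu))$ for some measure space $(X,\mathcal B,\mu)$. A representation of $A$ on $L^p(X,\mu)$ is a continuous homomorphism $\pi\colon A\to B(L^p(X,\mu))$. It is contractive (isometric) if $\|\pi(a)\|\le\|a\|$ ($\|\pi(a)\|=\|a\|$) for all $a\in A$; it is $\sigma$-finite if $\mu$ is $\sigma$-finite; it is nondegenerate if $\mathrm{span}\{\pi(a)\xi : a\in A,\ \xi\in L^p(X,\mu)\}$ is dense in $L^p(X,\mu)$. **$G$-$L^p$ operator algebras.** $G$ is a countable discrete group with identity $e$ and counting measure $\nu$. An isometric $G$-$L^p$ operator algebra is a triple $(G,A,\alpha)$ where $A$ is an $L^p$ operator algebra and $\alpha\colon g\mapsto\alpha_g$ is a homomorphism from $G$ to the group of continuous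 automorphisms of $A$ with every $\alpha_g$ isometric. It is called separable if $A$ is separable, and nondegenerately representable if $A$ has a nondegenerate isometric representation on some $L^p(X,\mu)$. (It is known that if it is both, $A$ has a nondegenerate isometric representation on a $\sigma$-finite measure space.) **Reduced crossed product.** $C_c(G,A,\alpha)$ is the space of finitely supported functions $a\colon G\to A$ with product $(ab)(g)=\sum_{h\in G}a(h)\,\alpha_h(b(h^{-1}g))$. Given a contractive representation $\pi_0\colon A\to B(L^p(X,\mu))$, the associated regular covariant representation $(\upsilon,\pi)$ on $L^p(G\times X,\nu\times\mu)\cong \ell^p(G,L^p(X,\mu))$ is $(\upsilon_g\xi)(h)=\xi(g^{-1}h)$, $(\pi(a)\xi)(h)=\pi_0(\alpha_h^{-1}(a))(\xi(h))$; it yields the representation $(\upsilon\ltimes\pi)(a)\xi=\sum_{g\in G}\pi(a(g))\upsilon_g\xi$ of $C_c(G,A,\alpha)$. Then $F^p_{\mathrm r}(G,A,\alpha)$ is the completion of $C_c(G,A,\alpha)$ in the norm $\|f\|_{\mathrm r}=\sup\|(\upsilon\ltimes\pi)(f)\|$, the supremum being over all regular covariant representations associated to nondegenerate $\sigma$-finite contractive representations $\pi_0$ of $A$ (under the present hypotheses this seminorm is known to be a norm). **Conditional expectation.** For $g\in G$ let $u_g\in C_c(G,A,\alpha)$ be the function equal to $1_A$ at $g$ and $0$ elsewhere, so that elements of $C_c(G,A,\alpha)$ are finite sums $\sum_g a_gu_g$. $A$ is identified with a subalgebra of $F^p_{\mathrm r}(G,A,\alpha)$ through the isometric homomorphism $a\mapsto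 au_e$, and the unit of $F^p_{\mathrm r}(G,A,\alpha)$ is $1_A u_e$. The standard conditional expectation $E\colon F^p_{\mathrm r}(G,A,\alpha)\to A$ is the (unique) bounded linear map with $E(\sum_g a_gu_g)=a_e$ on $C_c(G,A,\alpha)$; it is known to exist with $\|E\|\le1$. **Powers group.** A group $G$ is a Powers group if for every nonempty finite $F\subset G\setminus\{1\}$ and every integer $k\ge1$ there exist a partition $G=C\amalg D$ and $h_1,\dots,h_k\in G$ such that $gC\cap C=\varnothing$ for all $g\in F$, and $h_jD\cap h_lD=\varnothing$ for all distinct $j,l\in\{1,\dots,k\}$. **Traces.** A trace on a unital Banach algebra $B$ is a bounded linear functional $\tau$ on $B$ with $\tau(ab)=\tau(ba)$ for all $a,b\in B$; it is normalized if moreover $\|\tau\|=1$ and $\tau(1)=1$. A (normalized) trace $\tau$ on $A$ is $G$-invariant if $\tau(\alpha_g(a))=\tau(a)$ for all $a\in A$ and $g\in G$. *)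

theory Defs
  imports "HOL-Analysis.Analysis" "HOL-Algebra.Coset"
begin

section \<open>Complex Banach algebras and traces\<close>

class complex_banach_algebra = real_normed_algebra + banach +
  fixes scaleC :: "complex \<Rightarrow> 'a \<Rightarrow> 'a"  (infixr \<open>*\<^sub>C\<close> 75)
  assumes scaleC_add_right: "c *\<^sub>C (x + y) = c *\<^sub>C x + c *\<^sub>C y"
    and scaleC_add_left: "(c + d) *\<^sub>C x = c *\<^sub>C x + d *\<^sub>C x"
    and scaleC_scaleC: "c *\<^sub>C d *\<^sub>C x = (c * d) *\<^sub>C x"
    and scaleR_scaleC: "r *\<^sub>R x = complex_of_real r *\<^sub>C x"
    and mult_scaleC_left: "(c *\<^sub>C x) * y = c *\<^sub>C (x * y)"
    and mult_scaleC_right: "x * (c *\<^sub>C y) = c *\<^sub>C (x * y)"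
    and norm_scaleC: "norm (c *\<^sub>C x) = cmod c * norm x"

text \<open>
  The unit is only required to be a neutral element for multiplication. In contrast to
  \<^class>\<open>real_normed_algebra_1\<close>, neither \<open>norm 1 = 1\<close> nor \<open>0 \<noteq> 1\<close> is assumed.
\<close>
class unital_complex_banach_algebra = complex_banach_algebra + monoid_mult

instantiation complex :: unital_complex_banach_algebra
begin

definition scaleC_complex :: "complex \<Rightarrow> complex \<Rightarrow> complex"
  where "scaleC_complex c x = c * x"

instance
  by standard
    (simp_all add: scaleC_complex_def algebra_simps scaleR_conv_of_real norm_mult)

end

definition bounded_clinear ::
    "('a::complex_banach_algebra \<Rightarrow> 'b::complex_banach_algebra) \<Rightarrow> bool"
  where "bounded_clinear T \<longleftrightarrow> bounded_linear T \<and> (\<forall>c x. T (c *\<^sub>C x) = c *\<^sub>C T x)"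

definition is_trace :: "('a::complex_banach_algebra \<Rightarrow> complex) \<Rightarrow> bool"
  where "is_trace \<tau> \<longleftrightarrow> bounded_clinear \<tau> \<and> (\<forall>a b. \<tau> (a * b) = \<tau> (b * a))"

definition is_normalized_trace :: "('a::unital_complex_banach_algebra \<Rightarrow> complex) \<Rightarrow> bool"
  where "is_normalized_trace \<tau> \<longleftrightarrow> is_trace \<tau> \<and> onorm \<tau> = 1 \<and> \<tau> 1 = 1"


section \<open>Representations on $L^p$ spaces\<close>

text \<open>
  Elements of $L^p(M)$ are represented by $p$-integrable functions, and equality in $L^p(M)$ is
  equality almost everywhere. An operator on $L^p(M)$ is accordingly a map on functions that
  respects almost everywhere equality.
\<close>

definition Lp_space :: "real \<Rightarrow> 'x measure \<Rightarrow> ('x \<Rightarrow> complex) set"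
  where "Lp_space p M =
    {\<xi> \<in> borel_measurable M. integrable M (\<lambda>x. cmod (\<xi> x) powr p)}"

definition Lp_norm :: "real \<Rightarrow> 'x measure \<Rightarrow> ('x \<Rightarrow> complex) \<Rightarrow> real"
  where "Lp_norm p M \<xi> = (\<integral>x. cmod (\<xi> x) powr p \<partial>M) powr (1 / p)"

definition Lp_operator ::
    "real \<Rightarrow> 'x measure \<Rightarrow> (('x \<Rightarrow> complex) \<Rightarrow> 'x \<Rightarrow> complex) \<Rightarrow> bool"
  where "Lp_operator p M T \<longleftrightarrow>
    (\<forall>\<xi>\<in>Lp_space p M. T \<xi> \<in> Lp_space p M) \<and>
    (\<forall>\<xi>\<in>Lp_space p M. \<forall>\<eta>\<in>Lp_space p M.
       (AE x in M. \<xi> x = \<eta> x) \<longrightarrow> (AE x in M. T \<xi> x = T \<eta> x)) \<and>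
    (\<forall>\<xi>\<in>Lp_space p M. \<forall>\<eta>\<in>Lp_space p M.
       AE x in M. T (\<lambda>y. \<xi> y + \<eta> y) x = T \<xi> x + T \<eta> x) \<and>
    (\<forall>c. \<forall>\<xi>\<in>Lp_space p M. AE x in M. T (\<lambda>y. c * \<xi> y) x = c * T \<xi> x) \<and>
    (\<exists>K. \<forall>\<xi>\<in>Lp_space p M. Lp_norm p M (T \<xi>) \<le> K * Lp_norm p M \<xi>)"

definition Lp_opnorm ::
    "real \<Rightarrow> 'x measure \<Rightarrow> (('x \<Rightarrow> complex) \<Rightarrow> 'x \<Rightarrow> complex) \<Rightarrow> real"
  where "Lp_opnorm p M T =
    (SUP \<xi>\<in>{\<xi> \<in> Lp_space p M. Lp_norm p M \<xi> \<le> 1}. Lp_norm p M (T \<xi>))"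

definition Lp_rep ::
    "real \<Rightarrow> 'x measure \<Rightarrow>
     ('a::complex_banach_algebra \<Rightarrow> ('x \<Rightarrow> complex) \<Rightarrow> 'x \<Rightarrow> complex) \<Rightarrow> bool"
  where "Lp_rep p M \<pi> \<longleftrightarrow>
    (\<forall>a. Lp_operator p M (\<pi> a)) \<and>
    (\<forall>a b. \<forall>\<xi>\<in>Lp_space p M. AE x in M. \<pi> (a + b) \<xi> x = \<pi> a \<xi> x + \<pi> b \<xi> x) \<and>
    (\<forall>c a. \<forall>\<xi>\<in>Lp_space p M. AE x in M. \<pi> (c *\<^sub>C a) \<xi> x = c * \<pi> a \<xi> x) \<and>
    (\<forall>a b. \<forall>\<xi>\<in>Lp_space p M. AE x in M. \<pi> (a * b) \<xi> x = \<pi> a (\<pi> b \<xi>) x) \<and>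
    (\<exists>K. \<forall>a. Lp_opnorm p M (\<pi> a) \<le> K * norm a)"

definition contractive_Lp_rep ::
    "real \<Rightarrow> 'x measure \<Rightarrow>
     ('a::complex_banach_algebra \<Rightarrow> ('x \<Rightarrow> complex) \<Rightarrow> 'x \<Rightarrow> complex) \<Rightarrow> bool"
  where "contractive_Lp_rep p M \<pi> \<longleftrightarrow>
    Lp_rep p M \<pi> \<and> (\<forall>a. Lp_opnorm p M (\<pi> a) \<le> norm a)"

definition isometric_Lp_rep ::
    "real \<Rightarrow> 'x measure \<Rightarrow>
     ('a::complex_banach_algebra \<Rightarrow> ('x \<Rightarrow> complex) \<Rightarrow> 'x \<Rightarrow> complex) \<Rightarrow> bool"
  where "isometric_Lp_rep p M \<pi> \<longleftrightarrow>
    Lp_rep p M \<pi> \<and> (\<forall>a. Lp_opnorm p M (\<pi> a) = norm a)"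

text \<open>The finite sums below run through the linear span of the vectors \<open>\<pi> a \<xi>\<close>.\<close>
definition nondegenerate_Lp_rep ::
    "real \<Rightarrow> 'x measure \<Rightarrow>
     ('a::complex_banach_algebra \<Rightarrow> ('x \<Rightarrow> complex) \<Rightarrow> 'x \<Rightarrow> complex) \<Rightarrow> bool"
  where "nondegenerate_Lp_rep p M \<pi> \<longleftrightarrow>
    (\<forall>\<eta>\<in>Lp_space p M. \<forall>\<epsilon>>0. \<exists>I c. finite I \<and> I \<subseteq> UNIV \<times> Lp_space p M \<and>
       Lp_norm p M (\<lambda>x. \<eta> x - (\<Sum>(a, \<xi>)\<in>I. c a \<xi> * \<pi> a \<xi> x)) < \<epsilon>)"

text \<open>
  In the following, the type \<open>'x\<close> is the universe of points from which measure spaces are formed: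
  a measure of type \<open>'x measure\<close> lives on its carrier \<open>space M\<close>, an arbitrary subset of \<open>'x\<close>.
  The algebra, regarded as a type, is the whole type \<open>'a\<close>. The range of an isometric
  representation is automatically norm closed because \<open>'a\<close> is complete.
\<close>
definition Lp_operator_algebra ::
    "'x itself \<Rightarrow> real \<Rightarrow> 'a::complex_banach_algebra itself \<Rightarrow> bool"
  where "Lp_operator_algebra X p A \<longleftrightarrow>
    (\<exists>(M :: 'x measure) (\<pi> :: 'a \<Rightarrow> ('x \<Rightarrow> complex) \<Rightarrow> 'x \<Rightarrow> complex). isometric_Lp_rep p M \<pi>)"

definition nondegenerately_representable ::
    "'x itself \<Rightarrow> real \<Rightarrow> 'a::complex_banach_algebra itself \<Rightarrow> bool"
  where "nondegenerately_representable X p A \<longleftrightarrow>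
    (\<exists>(M :: 'x measure) (\<pi> :: 'a \<Rightarrow> ('x \<Rightarrow> complex) \<Rightarrow> 'x \<Rightarrow> complex).
       isometric_Lp_rep p M \<pi> \<and> nondegenerate_Lp_rep p M \<pi>)"


section \<open>Group actions and reduced crossed products\<close>

definition Powers_group :: "('g, 'm) monoid_scheme \<Rightarrow> bool"
  where "Powers_group G \<longleftrightarrow> group G \<and>
    (\<forall>F (k::nat). finite F \<and> F \<noteq> {} \<and> F \<subseteq> carrier G - {\<one>\<^bsub>G\<^esub>} \<and> 1 \<le> k \<longrightarrow>
      (\<exists>C D h. C \<union> D = carrier G \<and> C \<inter> D = {} \<and> h ` {1..k} \<subseteq> carrier G \<and>
         (\<forall>g\<in>F. (g <#\<^bsub>G\<^esub> C) \<inter> C = {}) \<and>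
         (\<forall>j\<in>{1..k}. \<forall>l\<in>{1..k}. j \<noteq> l \<longrightarrow> (h j <#\<^bsub>G\<^esub> D) \<inter> (h l <#\<^bsub>G\<^esub> D) = {})))"

definition continuous_automorphism :: "('a::complex_banach_algebra \<Rightarrow> 'a) \<Rightarrow> bool"
  where "continuous_automorphism f \<longleftrightarrow>
    bij f \<and> bounded_clinear f \<and> (\<forall>a b. f (a * b) = f a * f b)"

definition isometric_G_Lp_operator_algebra ::
    "'x itself \<Rightarrow> real \<Rightarrow> ('g, 'm) monoid_scheme \<Rightarrow>
     ('g \<Rightarrow> 'a::complex_banach_algebra \<Rightarrow> 'a) \<Rightarrow> bool"
  where "isometric_G_Lp_operator_algebra X p G \<alpha> \<longleftrightarrow>
    Lp_operator_algebra X p TYPE('a) \<and>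
    (\<forall>g\<in>carrier G. continuous_automorphism (\<alpha> g) \<and> (\<forall>a. norm (\<alpha> g a) = norm a)) \<and>
    (\<forall>g\<in>carrier G. \<forall>h\<in>carrier G. \<alpha> (g \<otimes>\<^bsub>G\<^esub> h) = \<alpha> g \<circ> \<alpha> h)"

definition Cc :: "('g, 'm) monoid_scheme \<Rightarrow> ('g \<Rightarrow> 'a::zero) set"
  where "Cc G = {f. finite {g. f g \<noteq> 0} \<and> {g. f g \<noteq> 0} \<subseteq> carrier G}"

definition Cc_mult ::
    "('g, 'm) monoid_scheme \<Rightarrow> ('g \<Rightarrow> 'a::complex_banach_algebra \<Rightarrow> 'a) \<Rightarrow>
     ('g \<Rightarrow> 'a) \<Rightarrow> ('g \<Rightarrow> 'a) \<Rightarrow> 'g \<Rightarrow> 'a"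
  where "Cc_mult G \<alpha> a b g =
    (if g \<in> carrier G
     then \<Sum>h\<in>{h. a h \<noteq> 0}. a h * \<alpha> h (b (inv\<^bsub>G\<^esub> h \<otimes>\<^bsub>G\<^esub> g)) else 0)"

text \<open>
  The regular covariant representation \<open>(\<upsilon>, \<pi>)\<close> associated to \<open>\<pi>\<^sub>0\<close>, acting on the $L^p$ space of
  \<open>count_space (carrier G) \<Otimes>\<^sub>M M\<close>, and its integrated form.
\<close>
definition reg_translation ::
    "('g, 'm) monoid_scheme \<Rightarrow> 'g \<Rightarrow> ('g \<times> 'x \<Rightarrow> complex) \<Rightarrow> 'g \<times> 'x \<Rightarrow> complex"
  where "reg_translation G g \<xi> = (\<lambda>(h, x). \<xi> (inv\<^bsub>G\<^esub> g \<otimes>\<^bsub>G\<^esub> h, x))"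

definition reg_rep ::
    "('g \<Rightarrow> 'a \<Rightarrow> 'a) \<Rightarrow> ('a \<Rightarrow> ('x \<Rightarrow> complex) \<Rightarrow> 'x \<Rightarrow> complex) \<Rightarrow>
     'a \<Rightarrow> ('g \<times> 'x \<Rightarrow> complex) \<Rightarrow> 'g \<times> 'x \<Rightarrow> complex"
  where "reg_rep \<alpha> \<pi>\<^sub>0 a \<xi> = (\<lambda>(h, x). \<pi>\<^sub>0 (inv_into UNIV (\<alpha> h) a) (\<lambda>y. \<xi> (h, y)) x)"

definition integrated_form ::
    "('g, 'm) monoid_scheme \<Rightarrow> ('g \<Rightarrow> 'a::zero \<Rightarrow> 'a) \<Rightarrow>
     ('a \<Rightarrow> ('x \<Rightarrow> complex) \<Rightarrow> 'x \<Rightarrow> complex) \<Rightarrow>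
     ('g \<Rightarrow> 'a) \<Rightarrow> ('g \<times> 'x \<Rightarrow> complex) \<Rightarrow> 'g \<times> 'x \<Rightarrow> complex"
  where "integrated_form G \<alpha> \<pi>\<^sub>0 f \<xi> =
    (\<lambda>z. \<Sum>g\<in>{g. f g \<noteq> 0}. reg_rep \<alpha> \<pi>\<^sub>0 (f g) (reg_translation G g \<xi>) z)"

text \<open>
  The reduced norm is a supremum over representations on all measure spaces. No single HOL term can
  quantify over all types, so the supremum is taken over the measure spaces in the universe \<open>'x\<close>,
  which is left arbitrary. Once \<open>'x\<close> is large enough (the values form a set of real numbers, so some
  type suffices) this is the supremum over all measure spaces. The set of values is nonempty,
  because it contains the value for the null measure, and bounded above by \<open>\<Sum>\<^sub>g norm (f g)\<close>.
\<close>
definition reduced_norm ::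
    "'x itself \<Rightarrow> real \<Rightarrow> ('g, 'm) monoid_scheme \<Rightarrow>
     ('g \<Rightarrow> 'a::complex_banach_algebra \<Rightarrow> 'a) \<Rightarrow> ('g \<Rightarrow> 'a) \<Rightarrow> real"
  where "reduced_norm X p G \<alpha> f =
    Sup {Lp_opnorm p (count_space (carrier G) \<Otimes>\<^sub>M M) (integrated_form G \<alpha> \<pi>\<^sub>0 f)
         | (M :: 'x measure) \<pi>\<^sub>0.
           sigma_finite_measure M \<and> contractive_Lp_rep p M \<pi>\<^sub>0 \<and> nondegenerate_Lp_rep p M \<pi>\<^sub>0}"

text \<open>
  The Banach algebra \<open>'b\<close>, together with the canonical map \<open>\<iota>\<close> from \<open>Cc G\<close>, is the completion of
  \<open>Cc G\<close> in the reduced norm. This determines \<open>('b, \<iota>)\<close> up to a unique isometric isomorphism. The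
  completion depends on the term \<open>\<alpha>\<close>, so it cannot be defined as a type constructor.
\<close>
definition is_reduced_crossed_product ::
    "'x itself \<Rightarrow> real \<Rightarrow> ('g, 'm) monoid_scheme \<Rightarrow>
     ('g \<Rightarrow> 'a::complex_banach_algebra \<Rightarrow> 'a) \<Rightarrow>
     (('g \<Rightarrow> 'a) \<Rightarrow> 'b::complex_banach_algebra) \<Rightarrow> bool"
  where "is_reduced_crossed_product X p G \<alpha> \<iota> \<longleftrightarrow>
    (\<forall>a\<in>Cc G. \<forall>b\<in>Cc G. \<iota> (\<lambda>g. a g + b g) = \<iota> a + \<iota> b) \<and>
    (\<forall>c. \<forall>a\<in>Cc G. \<iota> (\<lambda>g. c *\<^sub>C a g) = c *\<^sub>C \<iota> a) \<and>
    (\<forall>a\<in>Cc G. \<forall>b\<in>Cc G. \<iota> (Cc_mult G \<alpha> a b) = \<iota> a * \<iota> b) \<and>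
    (\<forall>a\<in>Cc G. norm (\<iota> a) = reduced_norm X p G \<alpha> a) \<and>
    closure (\<iota> ` Cc G) = UNIV"

definition standard_cond_exp ::
    "('g, 'm) monoid_scheme \<Rightarrow>
     (('g \<Rightarrow> 'a::complex_banach_algebra) \<Rightarrow> 'b::complex_banach_algebra) \<Rightarrow> 'b \<Rightarrow> 'a"
  where "standard_cond_exp G \<iota> =
    (THE E. bounded_clinear E \<and> (\<forall>a\<in>Cc G. E (\<iota> a) = a \<one>\<^bsub>G\<^esub>))"

definition G_invariant ::
    "('g, 'm) monoid_scheme \<Rightarrow> ('g \<Rightarrow> 'a \<Rightarrow> 'a) \<Rightarrow> ('a \<Rightarrow> complex) \<Rightarrow> bool"
  where "G_invariant G \<alpha> \<sigma> \<longleftrightarrow> (\<forall>g\<in>carrier G. \<forall>a. \<sigma> (\<alpha> g a) = \<sigma> a)"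

end

theory Submission
  imports Defs
begin

text \<open>
  A trace on the reduced crossed product is determined by its values on the elements $a u_g$, whose
  linear span is dense. If these values vanish for all $g \neq e$, then the trace is $\sigma \circ E$,
  where \<open>\<sigma>\<close> is its restriction to $A$, and \<open>\<sigma>\<close> is invariant because conjugation by $u_g$ implements
  $\alpha_g$ on $A$. Conversely, composing an invariant trace with $E$ gives a trace, which settles
  uniqueness.

  The values on $a u_g$ vanish by averaging (\<open>trace_vanishes_off_one\<close>). The Powers property for the
  set $\{g\}$ and a number $k$ yields $h_1, \dots, h_k$. A trace takes the same value on $a u_g$ and
  on the average of its conjugates by the $u_{h_j}$, so it is enough that the averages tend to zero
  in norm as $k$ grows. Every regular representation acts on the group coordinate by
  translations and on the other coordinate by contractions. So the norm of a finitely supported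
  function $f$ is bounded by the norm on $\ell^p(G)$ of convolution by $g \mapsto \|f(g)\|$
  (\<open>reduced_norm_le\<close>). For the average this leaves a sum of $k$ translations of $\ell^p(G)$ divided
  by $k$. The partition of $G$ splits such a sum into one part with disjoint ranges, of
  norm at most $k^{1/p}$, and one part with disjoint domains, of norm at most $k^{1 - 1/p}$
  (\<open>Powers_translates_bound\<close>). Both are $o(k)$ exactly because $1 < p < \infty$.

  The existence of $E$ rests on the inequality $\|f(e)\| \le \|f\|_{\mathrm r}$. Compressing a regular
  representation to the slice over $e$ gives this for $\|\pi_0(f(e))\|$ in place of $\|f(e)\|$
  (\<open>norm_rep_coeff_le_reduced_norm\<close>). The reduced norm only admits \<open>\<sigma>\<close>-finite measure spaces, so it
  remains to find $\pi_0$ on a \<open>\<sigma>\<close>-finite space that nearly attains the norm of a given element.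
  Since $A$ is separable, a given isometric representation can be restricted to the $L^p$ space of
  a countably generated \<open>\<sigma>\<close>-algebra on a subset of its measure space
  (\<open>admissible_rep_approximates\<close>).
\<close>

section \<open>Convexity of powers and $L^p$ norms\<close>

lemma convex_on_powr_nonneg:
  fixes p :: real
  assumes "1 \<le> p"
  shows "convex_on {0..} (\<lambda>x. x powr p)"
proof (rule convex_onI)
  fix t x y :: real
  assume t: "0 < t" "t < 1" and xy: "x \<in> {0..}" "y \<in> {0..}"
  have small: "s powr p \<le> s" if "0 < s" "s < 1" for s :: real
    using powr_mono'[of 1 p s] that assms by simp
  consider "x = 0" | "y = 0" | "0 < x" "0 < y" using xy by force
  then show "((1 - t) *\<^sub>R x + t *\<^sub>R y) powr p \<le> (1 - t) * x powr p + t * y powr p"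
  proof cases
    case 1
    then show ?thesis
      using small[of t] t xy by (simp add: powr_mult mult_right_mono)
  next
    case 2
    then show ?thesis
      using small[of "1 - t"] t xy by (simp add: powr_mult mult_right_mono)
  next
    case 3
    then show ?thesis
      using convex_onD[OF powr_convex[OF assms], of t x y] t by simp
  qed
qed simp

lemma sum_powr_le:
  fixes y :: "'j \<Rightarrow> real"
  assumes "1 \<le> p" "finite J" and y: "\<And>j. j \<in> J \<Longrightarrow> 0 \<le> y j"
  shows "(\<Sum>j\<in>J. y j) powr p \<le> real (card J) powr (p - 1) * (\<Sum>j\<in>J. y j powr p)"
proof (cases "J = {}")
  case False
  define k where "k = real (card J)"
  have k: "0 < k" using False assms(2) by (simp add: k_def card_gt_0_iff)
  have "(\<Sum>j\<in>J. (1 / k) *\<^sub>R y j) powr p \<le> (\<Sum>j\<in>J. (1 / k) * y j powr p)"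
    by (rule convex_on_sum[OF assms(2) False convex_on_powr_nonneg[OF assms(1)]])
      (use k y in \<open>simp_all add: k_def\<close>)
  also have "(\<Sum>j\<in>J. (1 / k) *\<^sub>R y j) = (\<Sum>j\<in>J. y j) / k"
    by (simp add: sum_divide_distrib)
  also have "((\<Sum>j\<in>J. y j) / k) powr p = (\<Sum>j\<in>J. y j) powr p / k powr p"
    by (rule powr_divide)
  also have "(\<Sum>j\<in>J. (1 / k) * y j powr p) = (\<Sum>j\<in>J. y j powr p) / k"
    by (simp add: sum_divide_distrib)
  finally have "(\<Sum>j\<in>J. y j) powr p \<le> k powr p * ((\<Sum>j\<in>J. y j powr p) / k)"
    using k by (simp add: field_simps)
  also have "\<dots> = k powr (p - 1) * (\<Sum>j\<in>J. y j powr p)"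
    using k by (simp add: powr_diff)
  finally show ?thesis by (simp add: k_def)
qed (use assms in simp)

lemma add_powr_le:
  fixes a b :: real
  assumes "1 \<le> p" "0 \<le> a" "0 \<le> b"
  shows "(a + b) powr p \<le> 2 powr (p - 1) * (a powr p + b powr p)"
  using sum_powr_le[of p "{False, True}" "\<lambda>c. if c then a else b"] assms by (simp add: ac_simps)

lemma Lp_norm_nonneg [simp]: "0 \<le> Lp_norm p M \<xi>"
  by (simp add: Lp_norm_def)

lemma Lp_space_iff:
  "\<xi> \<in> Lp_space p M \<longleftrightarrow>
     \<xi> \<in> borel_measurable M \<and> (\<integral>\<^sup>+x. ennreal (cmod (\<xi> x) powr p) \<partial>M) < \<infinity>"
  unfolding Lp_space_def by (auto simp: integrable_iff_bounded)

lemma Lp_space_measurable: "\<xi> \<in> Lp_space p M \<Longrightarrow> \<xi> \<in> borel_measurable M"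
  by (simp add: Lp_space_def)

lemma Lp_space_integrable: "\<xi> \<in> Lp_space p M \<Longrightarrow> integrable M (\<lambda>x. cmod (\<xi> x) powr p)"
  by (simp add: Lp_space_def)

lemma Lp_norm_powr:
  assumes "0 < p"
  shows "Lp_norm p M \<xi> powr p = (\<integral>x. cmod (\<xi> x) powr p \<partial>M)"
  using assms by (simp add: Lp_norm_def powr_powr)

lemma nn_integral_eq_Lp_norm:
  assumes "0 < p" "\<xi> \<in> Lp_space p M"
  shows "(\<integral>\<^sup>+x. ennreal (cmod (\<xi> x) powr p) \<partial>M) = ennreal (Lp_norm p M \<xi> powr p)"
  unfolding Lp_norm_powr[OF assms(1)]
  by (rule nn_integral_eq_integral[OF Lp_space_integrable[OF assms(2)]]) simp

lemma Lp_norm_leI: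
  assumes "0 < p" "0 \<le> K"
    and "(\<integral>\<^sup>+x. ennreal (cmod (\<xi> x) powr p) \<partial>M) \<le> ennreal (K powr p)"
  shows "Lp_norm p M \<xi> \<le> K"
proof (cases "integrable M (\<lambda>x. cmod (\<xi> x) powr p)")
  case True
  then have "ennreal (\<integral>x. cmod (\<xi> x) powr p \<partial>M) \<le> ennreal (K powr p)"
    using assms(3) by (simp add: nn_integral_eq_integral)
  then have "(\<integral>x. cmod (\<xi> x) powr p \<partial>M) \<le> K powr p"
    by (simp add: ennreal_le_iff)
  then have "Lp_norm p M \<xi> \<le> (K powr p) powr (1 / p)"
    unfolding Lp_norm_def using assms(1) by (intro powr_mono2) auto
  then show ?thesis using assms by (simp add: powr_powr)
next
  case False
  then show ?thesis using assms by (simp add: Lp_norm_def not_integrable_integral_eq)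
qed

lemma zero_in_Lp_space [simp]: "(\<lambda>x. 0) \<in> Lp_space p M"
  by (simp add: Lp_space_def)

lemma Lp_norm_zero [simp]: "Lp_norm p M (\<lambda>x. 0) = 0"
  by (simp add: Lp_norm_def)

lemma Lp_norm_cong_AE:
  assumes "\<xi> \<in> borel_measurable M" "\<eta> \<in> borel_measurable M" "AE x in M. \<xi> x = \<eta> x"
  shows "Lp_norm p M \<xi> = Lp_norm p M \<eta>"
proof -
  have "(\<integral>x. cmod (\<xi> x) powr p \<partial>M) = (\<integral>x. cmod (\<eta> x) powr p \<partial>M)"
    using assms by (intro integral_cong_AE) auto
  then show ?thesis by (simp add: Lp_norm_def)
qed

lemma Lp_space_cong_AE:
  assumes "\<xi> \<in> Lp_space p M" "\<eta> \<in> borel_measurable M" "AE x in M. \<xi> x = \<eta> x"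
  shows "\<eta> \<in> Lp_space p M"
proof -
  have "(\<integral>\<^sup>+x. ennreal (cmod (\<xi> x) powr p) \<partial>M) = (\<integral>\<^sup>+x. ennreal (cmod (\<eta> x) powr p) \<partial>M)"
    using assms(3) by (intro nn_integral_cong_AE) auto
  then show ?thesis using assms by (simp add: Lp_space_iff)
qed

lemma Lp_scale:
  assumes "\<xi> \<in> Lp_space p M"
  shows "(\<lambda>x. c * \<xi> x) \<in> Lp_space p M"
  using assms by (auto simp: Lp_space_def norm_mult powr_mult)

lemma Lp_norm_scale:
  assumes "0 < p"
  shows "Lp_norm p M (\<lambda>x. c * \<xi> x) = cmod c * Lp_norm p M \<xi>"
  using assms
  by (simp add: Lp_norm_def norm_mult powr_mult powr_powr)

lemma Lp_add:
  assumes "1 \<le> p" "\<xi> \<in> Lp_space p M" "\<eta> \<in> Lp_space p M"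
  shows "(\<lambda>x. \<xi> x + \<eta> x) \<in> Lp_space p M"
proof -
  have [measurable]: "\<xi> \<in> borel_measurable M" "\<eta> \<in> borel_measurable M"
    using assms by (auto simp: Lp_space_def)
  have "integrable M (\<lambda>x. cmod (\<xi> x + \<eta> x) powr p)"
  proof (rule Bochner_Integration.integrable_bound)
    show "integrable M (\<lambda>x. 2 powr (p - 1) * (cmod (\<xi> x) powr p + cmod (\<eta> x) powr p))"
      using assms by (auto simp: Lp_space_def)
    show "AE x in M. norm (cmod (\<xi> x + \<eta> x) powr p) \<le>
        norm (2 powr (p - 1) * (cmod (\<xi> x) powr p + cmod (\<eta> x) powr p))"
    proof (rule AE_I2)
      fix x
      have "cmod (\<xi> x + \<eta> x) powr p \<le> (cmod (\<xi> x) + cmod (\<eta> x)) powr p"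
        using assms(1) by (intro powr_mono2 norm_triangle_ineq) auto
      also have "\<dots> \<le> 2 powr (p - 1) * (cmod (\<xi> x) powr p + cmod (\<eta> x) powr p)"
        using assms(1) by (intro add_powr_le) auto
      finally show "norm (cmod (\<xi> x + \<eta> x) powr p) \<le>
        norm (2 powr (p - 1) * (cmod (\<xi> x) powr p + cmod (\<eta> x) powr p))" by simp
    qed
  qed simp
  then show ?thesis by (simp add: Lp_space_def)
qed

lemma Lp_sum:
  assumes "1 \<le> p" "finite I" "\<And>i. i \<in> I \<Longrightarrow> \<xi> i \<in> Lp_space p M"
  shows "(\<lambda>x. \<Sum>i\<in>I. \<xi> i x) \<in> Lp_space p M"
  using assms(2,3) by (induction I) (auto intro!: Lp_add[OF assms(1)])

lemma Lp_diff:
  assumes "1 \<le> p" "\<xi> \<in> Lp_space p M" "\<eta> \<in> Lp_space p M"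
  shows "(\<lambda>x. \<xi> x - \<eta> x) \<in> Lp_space p M"
  using Lp_add[OF assms(1,2) Lp_scale[OF assms(3), of "- 1"]] by simp

lemma AE_zero_if_Lp_norm_zero:
  assumes "0 < p" "\<xi> \<in> Lp_space p M" "Lp_norm p M \<xi> = 0"
  shows "AE x in M. \<xi> x = 0"
proof -
  have "(\<integral>x. cmod (\<xi> x) powr p \<partial>M) = 0"
    using Lp_norm_powr[OF assms(1), of M \<xi>] assms by simp
  then have "AE x in M. cmod (\<xi> x) powr p = 0"
    using assms(2) by (subst (asm) integral_nonneg_eq_0_iff_AE) (auto simp: Lp_space_def)
  then show ?thesis by simp
qed

text \<open>
  Minkowski's inequality is convexity of the power function: after normalization, the sum is a
  convex combination of two functions of norm one.
\<close>
lemma Lp_norm_triangle: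
  assumes p: "1 \<le> p" and \<xi>: "\<xi> \<in> Lp_space p M" and \<eta>: "\<eta> \<in> Lp_space p M"
  shows "Lp_norm p M (\<lambda>x. \<xi> x + \<eta> x) \<le> Lp_norm p M \<xi> + Lp_norm p M \<eta>"
proof -
  have p0: "0 < p" using p by simp
  note [measurable] = Lp_space_measurable[OF \<xi>] Lp_space_measurable[OF \<eta>]
  define a b where "a = Lp_norm p M \<xi>" and "b = Lp_norm p M \<eta>"
  consider "a = 0" | "b = 0" | "0 < a" "0 < b"
    unfolding a_def b_def by (metis Lp_norm_nonneg less_eq_real_def)
  then show ?thesis
  proof cases
    case 1
    then have "AE x in M. \<xi> x + \<eta> x = \<eta> x"
      using AE_zero_if_Lp_norm_zero[OF p0 \<xi>] by (auto simp: a_def)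
    then have "Lp_norm p M (\<lambda>x. \<xi> x + \<eta> x) = Lp_norm p M \<eta>"
      by (intro Lp_norm_cong_AE) auto
    then show ?thesis using 1 by (simp add: a_def)
  next
    case 2
    then have "AE x in M. \<xi> x + \<eta> x = \<xi> x"
      using AE_zero_if_Lp_norm_zero[OF p0 \<eta>] by (auto simp: b_def)
    then have "Lp_norm p M (\<lambda>x. \<xi> x + \<eta> x) = Lp_norm p M \<xi>"
      by (intro Lp_norm_cong_AE) auto
    then show ?thesis using 2 by (simp add: b_def)
  next
    case 3
    define t where "t = b / (a + b)"
    have t: "0 < t" "t < 1" "1 - t = a / (a + b)"
      using 3 by (auto simp: t_def field_simps)
    have pw: "cmod (\<xi> x + \<eta> x) powr p \<le>
      (a + b) powr p * ((1 - t) * (cmod (\<xi> x) powr p / a powr p)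
        + t * (cmod (\<eta> x) powr p / b powr p))" for x
    proof -
      have "cmod (\<xi> x + \<eta> x) powr p \<le> (cmod (\<xi> x) + cmod (\<eta> x)) powr p"
        using p by (intro powr_mono2 norm_triangle_ineq) auto
      also have "cmod (\<xi> x) + cmod (\<eta> x) =
          (a + b) * ((1 - t) *\<^sub>R (cmod (\<xi> x) / a) + t *\<^sub>R (cmod (\<eta> x) / b))"
        using 3 unfolding t(3) by (simp add: t_def distrib_left)
      also have "\<dots> powr p = (a + b) powr p *
          ((1 - t) *\<^sub>R (cmod (\<xi> x) / a) + t *\<^sub>R (cmod (\<eta> x) / b)) powr p"
        by (rule powr_mult)
      also have "\<dots> \<le> (a + b) powr p *
          ((1 - t) * (cmod (\<xi> x) / a) powr p + t * (cmod (\<eta> x) / b) powr p)"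
        using 3 t by (intro mult_left_mono convex_onD[OF convex_on_powr_nonneg[OF p]]) auto
      finally show ?thesis using 3 by (simp add: powr_divide)
    qed
    have int: "integrable M (\<lambda>x. cmod (\<xi> x) powr p)" "integrable M (\<lambda>x. cmod (\<eta> x) powr p)"
      using \<xi> \<eta> by (auto simp: Lp_space_def)
    have "(\<integral>x. cmod (\<xi> x + \<eta> x) powr p \<partial>M) \<le>
      (\<integral>x. (a + b) powr p * ((1 - t) * (cmod (\<xi> x) powr p / a powr p)
        + t * (cmod (\<eta> x) powr p / b powr p)) \<partial>M)"
      using int Lp_space_integrable[OF Lp_add[OF p \<xi> \<eta>]] pw
      by (intro integral_mono) auto
    also have "\<dots> = (a + b) powr p * ((1 - t) * (a powr p / a powr p) + t * (b powr p / b powr p))"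
      using int by (simp add: a_def b_def Lp_norm_powr[OF p0])
    also have "\<dots> = (a + b) powr p" using 3 by simp
    finally have "Lp_norm p M (\<lambda>x. \<xi> x + \<eta> x) \<le> ((a + b) powr p) powr (1 / p)"
      unfolding Lp_norm_def using p by (intro powr_mono2) auto
    then show ?thesis using p 3 by (simp add: powr_powr a_def b_def)
  qed
qed

lemma Lp_norm_sum:
  assumes "1 \<le> p" "finite I" "\<And>i. i \<in> I \<Longrightarrow> \<xi> i \<in> Lp_space p M"
  shows "Lp_norm p M (\<lambda>x. \<Sum>i\<in>I. \<xi> i x) \<le> (\<Sum>i\<in>I. Lp_norm p M (\<xi> i))"
  using assms(2,3)
proof (induction I)
  case (insert i I)
  then have "Lp_norm p M (\<lambda>x. \<xi> i x + (\<Sum>i\<in>I. \<xi> i x)) \<le>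
      Lp_norm p M (\<xi> i) + Lp_norm p M (\<lambda>x. \<Sum>i\<in>I. \<xi> i x)"
    by (intro Lp_norm_triangle Lp_sum assms(1)) auto
  with insert show ?case by fastforce
qed simp

lemma Lp_norm_minus_commute: "Lp_norm p M (\<lambda>x. \<xi> x - \<eta> x) = Lp_norm p M (\<lambda>x. \<eta> x - \<xi> x)"
  by (simp add: Lp_norm_def norm_minus_commute)

lemma Lp_dominated_convergence:
  assumes p: "1 \<le> p"
    and u: "\<And>n. u n \<in> borel_measurable M" and \<xi>: "\<xi> \<in> Lp_space p M"
    and lim: "\<And>x. x \<in> space M \<Longrightarrow> (\<lambda>n. u n x) \<longlonglongrightarrow> \<xi> x"
    and le: "\<And>n x. x \<in> space M \<Longrightarrow> cmod (u n x) \<le> 2 * cmod (\<xi> x)"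
  shows "(\<lambda>n. Lp_norm p M (\<lambda>x. u n x - \<xi> x)) \<longlonglongrightarrow> 0"
    and "\<And>n. u n \<in> Lp_space p M"
proof -
  note [measurable] = u Lp_space_measurable[OF \<xi>]
  have "(\<lambda>n. \<integral>x. cmod (u n x - \<xi> x) powr p \<partial>M) \<longlonglongrightarrow> (\<integral>x. 0 \<partial>M)"
  proof (rule integral_dominated_convergence)
    show "integrable M (\<lambda>x. (3 * cmod (\<xi> x)) powr p)"
      using Lp_space_integrable[OF \<xi>] by (simp add: powr_mult)
    show "AE x in M. (\<lambda>n. cmod (u n x - \<xi> x) powr p) \<longlonglongrightarrow> 0"
    proof (rule AE_I2)
      fix x assume "x \<in> space M"
      then have "(\<lambda>n. cmod (u n x - \<xi> x)) \<longlonglongrightarrow> 0"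
        using lim by (metis LIM_zero tendsto_norm_zero)
      then show "(\<lambda>n. cmod (u n x - \<xi> x) powr p) \<longlonglongrightarrow> 0"
        using p by (intro tendsto_zero_powrI[of _ _ _ p]) auto
    qed
    show "AE x in M. norm (cmod (u n x - \<xi> x) powr p) \<le> (3 * cmod (\<xi> x)) powr p" for n
    proof (rule AE_I2)
      fix x assume "x \<in> space M"
      then have "cmod (u n x - \<xi> x) \<le> 3 * cmod (\<xi> x)"
        using le[of x n] norm_triangle_ineq4[of "u n x" "\<xi> x"] by simp
      then show "norm (cmod (u n x - \<xi> x) powr p) \<le> (3 * cmod (\<xi> x)) powr p"
        using p by (simp add: powr_mono2)
    qed
  qed simp_all
  then show "(\<lambda>n. Lp_norm p M (\<lambda>x. u n x - \<xi> x)) \<longlonglongrightarrow> 0"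
    unfolding Lp_norm_def using p by (intro tendsto_zero_powrI[of _ _ _ "1 / p"]) auto
  show "u n \<in> Lp_space p M" for n
  proof -
    have "integrable M (\<lambda>x. cmod (u n x) powr p)"
    proof (rule Bochner_Integration.integrable_bound)
      show "integrable M (\<lambda>x. (2 * cmod (\<xi> x)) powr p)"
        using Lp_space_integrable[OF \<xi>] by (simp add: powr_mult)
      show "AE x in M. norm (cmod (u n x) powr p) \<le> norm ((2 * cmod (\<xi> x)) powr p)"
        using le p by (intro AE_I2) (simp add: powr_mono2)
    qed simp
    then show ?thesis by (simp add: Lp_space_def)
  qed
qed

lemma Lp_convergence_AE_subseq:
  assumes p: "1 \<le> p" and u: "\<And>n. u n \<in> Lp_space p M" and \<xi>: "\<xi> \<in> Lp_space p M"
    and lim: "(\<lambda>n. Lp_norm p M (\<lambda>x. u n x - \<xi> x)) \<longlonglongrightarrow> 0"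
  obtains r :: "nat \<Rightarrow> nat" where "strict_mono r" "AE x in M. (\<lambda>n. u (r n) x) \<longlonglongrightarrow> \<xi> x"
proof -
  have "(\<lambda>n. Lp_norm p M (\<lambda>x. u n x - \<xi> x) powr p) \<longlonglongrightarrow> 0"
    using lim p by (intro tendsto_zero_powrI[of _ _ _ p]) auto
  then have "(\<lambda>n. \<integral>x. norm (cmod (u n x - \<xi> x) powr p) \<partial>M) \<longlonglongrightarrow> 0"
    using p by (simp add: Lp_norm_powr)
  from tendsto_L1_AE_subseq[OF _ this] Lp_space_integrable[OF Lp_diff[OF p u \<xi>]]
  obtain r :: "nat \<Rightarrow> nat" where r: "strict_mono r"
    "AE x in M. (\<lambda>n. cmod (u (r n) x - \<xi> x) powr p) \<longlonglongrightarrow> 0"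
    by blast
  have "AE x in M. (\<lambda>n. u (r n) x) \<longlonglongrightarrow> \<xi> x"
    using r(2)
  proof eventually_elim
    case (elim x)
    then have "(\<lambda>n. (cmod (u (r n) x - \<xi> x) powr p) powr (1 / p)) \<longlonglongrightarrow> 0"
      using p by - (rule tendsto_zero_powrI[OF _ tendsto_const], auto)
    then have "(\<lambda>n. cmod (u (r n) x - \<xi> x)) \<longlonglongrightarrow> 0"
      using p by (simp add: powr_powr)
    then show ?case by (rule LIM_zero_cancel[OF tendsto_norm_zero_cancel])
  qed
  with r(1) that show thesis by blast
qed

section \<open>Operators on $L^p$ spaces\<close>

lemma
  assumes "Lp_operator p M T"
  shows Lp_operator_closed: "\<xi> \<in> Lp_space p M \<Longrightarrow> T \<xi> \<in> Lp_space p M"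
    and Lp_operator_cong: "\<xi> \<in> Lp_space p M \<Longrightarrow> \<eta> \<in> Lp_space p M \<Longrightarrow>
      AE x in M. \<xi> x = \<eta> x \<Longrightarrow> AE x in M. T \<xi> x = T \<eta> x"
    and Lp_operator_add: "\<xi> \<in> Lp_space p M \<Longrightarrow> \<eta> \<in> Lp_space p M \<Longrightarrow>
      AE x in M. T (\<lambda>y. \<xi> y + \<eta> y) x = T \<xi> x + T \<eta> x"
    and Lp_operator_scale: "\<xi> \<in> Lp_space p M \<Longrightarrow> AE x in M. T (\<lambda>y. c * \<xi> y) x = c * T \<xi> x"
  using assms unfolding Lp_operator_def by blast+

lemma Lp_operator_diff:
  assumes T: "Lp_operator p M T" and \<xi>: "\<xi> \<in> Lp_space p M" and \<eta>: "\<eta> \<in> Lp_space p M"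
  shows "AE x in M. T (\<lambda>y. \<xi> y - \<eta> y) x = T \<xi> x - T \<eta> x"
  using Lp_operator_add[OF T \<xi> Lp_scale[OF \<eta>, of "- 1"]] Lp_operator_scale[OF T \<eta>, of "- 1"]
  by eventually_elim simp

lemma Lp_operator_zero:
  assumes T: "Lp_operator p M T"
  shows "AE x in M. T (\<lambda>y. 0) x = 0"
  using Lp_operator_scale[OF T zero_in_Lp_space, of 0] by simp

lemma Lp_opnorm_leI:
  assumes "\<And>\<xi>. \<xi> \<in> Lp_space p M \<Longrightarrow> Lp_norm p M \<xi> \<le> 1 \<Longrightarrow> Lp_norm p M (T \<xi>) \<le> K"
  shows "Lp_opnorm p M T \<le> K"
  unfolding Lp_opnorm_def
proof (rule cSUP_least)
  show "{\<xi> \<in> Lp_space p M. Lp_norm p M \<xi> \<le> 1} \<noteq> {}"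
    using zero_in_Lp_space Lp_norm_zero zero_le_one by fastforce
qed (use assms in auto)

lemma Lp_opnorm_upper:
  assumes bound: "\<And>\<xi>. \<xi> \<in> Lp_space p M \<Longrightarrow> Lp_norm p M (T \<xi>) \<le> K * Lp_norm p M \<xi>"
    and \<xi>: "\<xi> \<in> Lp_space p M" "Lp_norm p M \<xi> \<le> 1"
  shows "Lp_norm p M (T \<xi>) \<le> Lp_opnorm p M T"
  unfolding Lp_opnorm_def
proof (rule cSUP_upper)
  have "Lp_norm p M (T \<xi>) \<le> \<bar>K\<bar>" if "\<xi> \<in> Lp_space p M" "Lp_norm p M \<xi> \<le> 1" for \<xi>
  proof -
    have "Lp_norm p M (T \<xi>) \<le> \<bar>K\<bar> * Lp_norm p M \<xi>"
      using bound[OF that(1)] by (rule order_trans) (simp add: mult_right_mono)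
    also have "\<dots> \<le> \<bar>K\<bar>" using that(2) by (simp add: mult_left_le)
    finally show ?thesis .
  qed
  then show "bdd_above ((\<lambda>\<xi>. Lp_norm p M (T \<xi>)) ` {\<xi> \<in> Lp_space p M. Lp_norm p M \<xi> \<le> 1})"
    by (intro bdd_aboveI[of _ "\<bar>K\<bar>"]) auto
qed (use \<xi> in auto)

lemma Lp_opnorm_bound:
  assumes p: "1 \<le> p" and T: "Lp_operator p M T" and \<xi>: "\<xi> \<in> Lp_space p M"
  shows "Lp_norm p M (T \<xi>) \<le> Lp_opnorm p M T * Lp_norm p M \<xi>"
proof -
  obtain K where K: "\<And>\<xi>. \<xi> \<in> Lp_space p M \<Longrightarrow> Lp_norm p M (T \<xi>) \<le> K * Lp_norm p M \<xi>"
    using T unfolding Lp_operator_def by blast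
  show ?thesis
  proof (cases "Lp_norm p M \<xi> = 0")
    case True
    then show ?thesis using K[OF \<xi>] by simp
  next
    case False
    define c where "c = Lp_norm p M \<xi>"
    have c: "0 < c" using False Lp_norm_nonneg[of p M \<xi>] unfolding c_def by linarith
    let ?\<xi> = "\<lambda>y. complex_of_real (1 / c) * \<xi> y"
    have in_Lp: "?\<xi> \<in> Lp_space p M" by (rule Lp_scale[OF \<xi>])
    have "Lp_norm p M ?\<xi> = cmod (complex_of_real (1 / c)) * c"
      using p by (subst Lp_norm_scale) (auto simp: c_def)
    then have "Lp_norm p M ?\<xi> \<le> 1" using c by (simp add: norm_divide)
    then have "Lp_norm p M (T ?\<xi>) \<le> Lp_opnorm p M T"
      using Lp_opnorm_upper[of p M T K, OF K] in_Lp by simp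
    moreover have "Lp_norm p M (T ?\<xi>) = Lp_norm p M (\<lambda>x. complex_of_real (1 / c) * T \<xi> x)"
    proof (rule Lp_norm_cong_AE)
      show "AE x in M. T ?\<xi> x = complex_of_real (1 / c) * T \<xi> x"
        using Lp_operator_scale[OF T \<xi>] .
    qed (rule Lp_space_measurable[OF Lp_operator_closed[OF T in_Lp]]
        Lp_space_measurable[OF Lp_scale[OF Lp_operator_closed[OF T \<xi>]]])+
    moreover have "\<dots> = Lp_norm p M (T \<xi>) / c"
      using p c by (subst Lp_norm_scale) (auto simp: norm_divide)
    ultimately show ?thesis using c by (simp add: c_def field_simps)
  qed
qed

lemma
  assumes "Lp_rep p M \<pi>"
  shows Lp_rep_operator: "Lp_operator p M (\<pi> a)"
    and Lp_rep_add: "\<xi> \<in> Lp_space p M \<Longrightarrow> AE x in M. \<pi> (a + b) \<xi> x = \<pi> a \<xi> x + \<pi> b \<xi> x"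
    and Lp_rep_scale: "\<xi> \<in> Lp_space p M \<Longrightarrow> AE x in M. \<pi> (c *\<^sub>C a) \<xi> x = c * \<pi> a \<xi> x"
    and Lp_rep_mult: "\<xi> \<in> Lp_space p M \<Longrightarrow> AE x in M. \<pi> (a * b) \<xi> x = \<pi> a (\<pi> b \<xi>) x"
  using assms unfolding Lp_rep_def by blast+

lemma contractive_Lp_rep_norm:
  assumes "1 \<le> p" "contractive_Lp_rep p M \<pi>" "\<xi> \<in> Lp_space p M"
  shows "Lp_norm p M (\<pi> a \<xi>) \<le> norm a * Lp_norm p M \<xi>"
proof -
  have "Lp_norm p M (\<pi> a \<xi>) \<le> Lp_opnorm p M (\<pi> a) * Lp_norm p M \<xi>"
    using assms by (intro Lp_opnorm_bound) (auto simp: contractive_Lp_rep_def Lp_rep_def)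
  also have "\<dots> \<le> norm a * Lp_norm p M \<xi>"
    using assms by (intro mult_right_mono) (auto simp: contractive_Lp_rep_def)
  finally show ?thesis .
qed


section \<open>Convolution estimates on the group\<close>

lemma (in group) nn_integral_translate:
  assumes "s \<in> carrier G"
  shows "(\<integral>\<^sup>+t. f (inv s \<otimes> t) \<partial>count_space (carrier G)) = (\<integral>\<^sup>+t. f t \<partial>count_space (carrier G))"
proof (rule nn_integral_bij_count_space)
  show "bij_betw (\<lambda>t. inv s \<otimes> t) (carrier G) (carrier G)"
    by (rule bij_betw_byWitness[of _ "\<lambda>t. s \<otimes> t"]) (use assms in \<open>auto simp: m_assoc[symmetric]\<close>)
qed

text \<open>
  A crude bound, which grows with the number of translates. It is what makes the supremum in the
  reduced norm finite, and it is sharp for a single translate.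
\<close>
lemma (in group) nn_integral_average_le:
  fixes w :: "'j \<Rightarrow> real" and x :: "'a \<Rightarrow> real"
  assumes p: "1 \<le> p" and J: "finite J" and w: "\<And>j. j \<in> J \<Longrightarrow> 0 \<le> w j"
    and s: "\<And>j. j \<in> J \<Longrightarrow> s j \<in> carrier G" and x: "\<And>t. 0 \<le> x t"
  shows "(\<integral>\<^sup>+t. ennreal ((\<Sum>j\<in>J. w j * x (inv (s j) \<otimes> t)) powr p) \<partial>count_space (carrier G))
    \<le> ennreal (real (card J) powr (p - 1) * (\<Sum>j\<in>J. w j powr p)) *
       (\<integral>\<^sup>+t. ennreal (x t powr p) \<partial>count_space (carrier G))"
proof -
  let ?\<nu> = "count_space (carrier G)" and ?k = "real (card J) powr (p - 1)"
  have "(\<integral>\<^sup>+t. ennreal ((\<Sum>j\<in>J. w j * x (inv (s j) \<otimes> t)) powr p) \<partial>?\<nu>)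
      \<le> (\<integral>\<^sup>+t. (\<Sum>j\<in>J. ennreal (?k * w j powr p) * ennreal (x (inv (s j) \<otimes> t) powr p)) \<partial>?\<nu>)"
  proof (rule nn_integral_mono)
    fix t
    have "(\<Sum>j\<in>J. w j * x (inv (s j) \<otimes> t)) powr p \<le>
        ?k * (\<Sum>j\<in>J. (w j * x (inv (s j) \<otimes> t)) powr p)"
      using w x by (intro sum_powr_le p J) auto
    also have "\<dots> = (\<Sum>j\<in>J. ?k * w j powr p * x (inv (s j) \<otimes> t) powr p)"
      by (simp add: sum_distrib_left powr_mult mult.assoc)
    finally have "ennreal ((\<Sum>j\<in>J. w j * x (inv (s j) \<otimes> t)) powr p) \<le> ennreal \<dots>"
      by (rule ennreal_leI)
    also have "\<dots> = (\<Sum>j\<in>J. ennreal (?k * w j powr p) * ennreal (x (inv (s j) \<otimes> t) powr p))"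
      by (subst sum_ennreal[symmetric]) (auto simp: ennreal_mult)
    finally show "ennreal ((\<Sum>j\<in>J. w j * x (inv (s j) \<otimes> t)) powr p) \<le> \<dots>" .
  qed
  also have "\<dots> = (\<Sum>j\<in>J. ennreal (?k * w j powr p) * (\<integral>\<^sup>+t. ennreal (x (inv (s j) \<otimes> t) powr p) \<partial>?\<nu>))"
    by (simp add: nn_integral_sum nn_integral_cmult)
  also have "\<dots> = (\<Sum>j\<in>J. ennreal (?k * w j powr p) * (\<integral>\<^sup>+t. ennreal (x t powr p) \<partial>?\<nu>))"
    by (intro sum.cong refl)
      (simp add: nn_integral_translate[OF s, where f="\<lambda>t. ennreal (x t powr p)"])
  also have "\<dots> = (\<Sum>j\<in>J. ennreal (?k * w j powr p)) * (\<integral>\<^sup>+t. ennreal (x t powr p) \<partial>?\<nu>)"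
    by (rule sum_distrib_right[symmetric])
  also have "(\<Sum>j\<in>J. ennreal (?k * w j powr p)) = ennreal (?k * (\<Sum>j\<in>J. w j powr p))"
    by (subst sum_ennreal) (auto simp: sum_distrib_left)
  finally show ?thesis .
qed

text \<open>
  This is where the Powers property enters. Put \<open>D\<^sub>j = h\<^sub>j D\<close> and \<open>s\<^sub>j = h\<^sub>j g h\<^sub>j\<^sup>-\<^sup>1\<close>. Since \<open>g\<close> moves
  \<open>C\<close> off itself, every \<open>t\<close> satisfies \<open>t \<in> D\<^sub>j\<close> or \<open>s\<^sub>j\<^sup>-\<^sup>1 t \<in> D\<^sub>j\<close>. The summands of the first kind
  have disjoint supports, those of the second kind only see the disjoint pieces of \<open>x\<close> on the sets
  \<open>D\<^sub>j\<close>. Either way the sum of \<open>k\<close> translates of \<open>x\<close> has much smaller norm than \<open>k\<close> times the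
  norm of \<open>x\<close> once \<open>1 < p\<close>.
\<close>
lemma (in group) Powers_translates_bound:
  fixes x :: "'a \<Rightarrow> real" and h :: "nat \<Rightarrow> 'a"
  assumes p: "1 \<le> p" and g: "g \<in> carrier G"
    and CD: "C \<union> D = carrier G" and h: "h ` {1..k} \<subseteq> carrier G"
    and gC: "(g <# C) \<inter> C = {}"
    and disj: "\<And>j l. j \<in> {1..k} \<Longrightarrow> l \<in> {1..k} \<Longrightarrow> j \<noteq> l \<Longrightarrow> (h j <# D) \<inter> (h l <# D) = {}"
    and x: "\<And>t. 0 \<le> x t"
  defines "s \<equiv> \<lambda>j. h j \<otimes> g \<otimes> inv (h j)"
  shows "(\<integral>\<^sup>+t. ennreal ((\<Sum>j=1..k. x (inv (s j) \<otimes> t)) powr p) \<partial>count_space (carrier G))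
    \<le> ennreal (2 powr (p - 1) * (real k + real k powr (p - 1))) *
       (\<integral>\<^sup>+t. ennreal (x t powr p) \<partial>count_space (carrier G))"
proof -
  let ?\<nu> = "count_space (carrier G)"
  let ?J = "{1..k}"
  define I where "I = (\<integral>\<^sup>+t. ennreal (x t powr p) \<partial>?\<nu>)"
  define D' where "D' j = h j <# D" for j
  define \<theta> :: "nat \<Rightarrow> 'a \<Rightarrow> real" where "\<theta> j t = indicator (D' j) t" for j t
  define c where "c = 2 powr (p - 1)"
  define d where "d = real k powr (p - 1)"
  have c0: "0 \<le> c" "0 \<le> d" by (auto simp: c_def d_def)
  have hj: "h j \<in> carrier G" if "j \<in> ?J" for j using h that by auto
  have sj: "s j \<in> carrier G" if "j \<in> ?J" for j using hj[OF that] g by (simp add: s_def)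
  have CDsub: "C \<subseteq> carrier G" "D \<subseteq> carrier G" using CD by auto
  \<comment> \<open>Otherwise the points \<open>h\<^sub>j\<^sup>-\<^sup>1 t\<close> and \<open>g\<^sup>-\<^sup>1 h\<^sub>j\<^sup>-\<^sup>1 t\<close> both lie in \<open>C\<close>, and \<open>g\<close> moves the second
    to the first.\<close>
  have cover: "t \<in> D' j \<or> inv (s j) \<otimes> t \<in> D' j" if j: "j \<in> ?J" and t: "t \<in> carrier G" for j t
  proof (rule ccontr)
    assume neg: "\<not> (t \<in> D' j \<or> inv (s j) \<otimes> t \<in> D' j)"
    have in_coset: "u \<in> D' j" if "u \<in> carrier G" "inv (h j) \<otimes> u \<in> D" for u
      using that hj[OF j] by (auto simp: D'_def l_coset_def m_assoc[symmetric] intro!: bexI[of _ "inv (h j) \<otimes> u"])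
    have "inv (h j) \<otimes> t \<in> C"
      using neg in_coset[OF t] CD hj[OF j] t by blast
    moreover have "inv (h j) \<otimes> (inv (s j) \<otimes> t) \<in> C"
      using neg in_coset[of "inv (s j) \<otimes> t"] CD hj[OF j] sj[OF j] t by blast
    moreover have "inv (h j) \<otimes> t = g \<otimes> (inv (h j) \<otimes> (inv (s j) \<otimes> t))"
      using hj[OF j] g t by (simp add: s_def inv_mult_group m_assoc[symmetric])
    ultimately have "inv (h j) \<otimes> t \<in> (g <# C) \<inter> C" by (auto simp: l_coset_def)
    then show False using gC by simp
  qed
  have sum_\<theta>: "(\<Sum>j\<in>?J. \<theta> j t) \<le> 1" for t
  proof (cases "\<exists>i\<in>?J. t \<in> D' i")
    case True
    then obtain i where i: "i \<in> ?J" "t \<in> D' i" by blast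
    have "\<theta> j t = 0" if "j \<in> ?J" "j \<noteq> i" for j
      using disj[OF that(1) i(1) that(2)] i(2) by (auto simp: \<theta>_def D'_def indicator_def)
    then have "(\<Sum>j\<in>?J. \<theta> j t) = \<theta> i t"
      using i(1) by (subst sum.remove[of _ i]) auto
    then show ?thesis by (simp add: \<theta>_def indicator_def)
  next
    case False
    then have "(\<Sum>j\<in>?J. \<theta> j t) = 0" by (intro sum.neutral) (auto simp: \<theta>_def)
    then show ?thesis by simp
  qed
  have \<theta>01: "0 \<le> \<theta> j t" "\<theta> j t \<le> 1" for j t by (auto simp: \<theta>_def indicator_def)
  have \<theta>powr: "(\<theta> j t * y) powr p = \<theta> j t * y powr p" for j t y
    by (auto simp: \<theta>_def indicator_def)
  have disjoint_sum: "(\<Sum>j\<in>?J. \<theta> j t * y j) powr p = (\<Sum>j\<in>?J. \<theta> j t * y j powr p)" for t y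
  proof (cases "\<exists>i\<in>?J. t \<in> D' i")
    case True
    then obtain i where i: "i \<in> ?J" "t \<in> D' i" by blast
    have z: "\<theta> j t = 0" if "j \<in> ?J" "j \<noteq> i" for j
      using disj[OF that(1) i(1) that(2)] i(2) by (auto simp: \<theta>_def D'_def indicator_def)
    have "(\<Sum>j\<in>?J. \<theta> j t * y j) = \<theta> i t * y i" "(\<Sum>j\<in>?J. \<theta> j t * y j powr p) = \<theta> i t * y i powr p"
      using i(1) z by (subst sum.remove[of _ i], auto)+
    then show ?thesis by (simp add: \<theta>powr)
  next
    case False
    then have "\<And>j. j \<in> ?J \<Longrightarrow> \<theta> j t = 0" by (auto simp: \<theta>_def)
    then show ?thesis by simp
  qed
  have pointwise: "(\<Sum>j\<in>?J. x (inv (s j) \<otimes> t)) powr p \<le>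
      (\<Sum>j\<in>?J. c * x (inv (s j) \<otimes> t) powr p) +
      (\<Sum>j\<in>?J. c * d * (\<theta> j (inv (s j) \<otimes> t) * x (inv (s j) \<otimes> t) powr p))"
    if t: "t \<in> carrier G" for t
  proof -
    let ?y = "\<lambda>j. x (inv (s j) \<otimes> t)"
    have "(\<Sum>j\<in>?J. ?y j) \<le> (\<Sum>j\<in>?J. \<theta> j t * ?y j + \<theta> j (inv (s j) \<otimes> t) * ?y j)"
      by (intro sum_mono) (use cover[OF _ t] x in \<open>auto simp: \<theta>_def indicator_def\<close>)
    also have "\<dots> = (\<Sum>j\<in>?J. \<theta> j t * ?y j) + (\<Sum>j\<in>?J. \<theta> j (inv (s j) \<otimes> t) * ?y j)"
      by (rule sum.distrib)
    finally have "(\<Sum>j\<in>?J. ?y j) powr p \<le> \<dots> powr p"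
      using p x by (intro powr_mono2) (auto intro: sum_nonneg)
    also have "\<dots> \<le> c * ((\<Sum>j\<in>?J. \<theta> j t * ?y j) powr p + (\<Sum>j\<in>?J. \<theta> j (inv (s j) \<otimes> t) * ?y j) powr p)"
      unfolding c_def using x \<theta>01 by (intro add_powr_le p sum_nonneg mult_nonneg_nonneg) auto
    also have "\<dots> \<le> c * ((\<Sum>j\<in>?J. ?y j powr p) + d * (\<Sum>j\<in>?J. (\<theta> j (inv (s j) \<otimes> t) * ?y j) powr p))"
    proof (intro mult_left_mono add_mono c0)
      show "(\<Sum>j\<in>?J. \<theta> j t * ?y j) powr p \<le> (\<Sum>j\<in>?J. ?y j powr p)"
        unfolding disjoint_sum using \<theta>01 by (intro sum_mono) (simp add: mult_left_le_one_le)
      show "(\<Sum>j\<in>?J. \<theta> j (inv (s j) \<otimes> t) * ?y j) powr p \<le> d * (\<Sum>j\<in>?J. (\<theta> j (inv (s j) \<otimes> t) * ?y j) powr p)"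
        using sum_powr_le[OF p, of ?J "\<lambda>j. \<theta> j (inv (s j) \<otimes> t) * ?y j"] x \<theta>01 by (simp add: d_def)
    qed
    finally show ?thesis
      by (simp add: sum_distrib_left distrib_left \<theta>powr mult.assoc)
  qed
  have "(\<integral>\<^sup>+t. ennreal ((\<Sum>j\<in>?J. x (inv (s j) \<otimes> t)) powr p) \<partial>?\<nu>) \<le>
     (\<integral>\<^sup>+t. (\<Sum>j\<in>?J. ennreal c * ennreal (x (inv (s j) \<otimes> t) powr p)) +
       (\<Sum>j\<in>?J. ennreal (c * d) * ennreal (\<theta> j (inv (s j) \<otimes> t) * x (inv (s j) \<otimes> t) powr p)) \<partial>?\<nu>)"
  proof (rule nn_integral_mono)
    fix t assume "t \<in> space ?\<nu>"
    then have "ennreal ((\<Sum>j\<in>?J. x (inv (s j) \<otimes> t)) powr p) \<le>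
      ennreal ((\<Sum>j\<in>?J. c * x (inv (s j) \<otimes> t) powr p) +
      (\<Sum>j\<in>?J. c * d * (\<theta> j (inv (s j) \<otimes> t) * x (inv (s j) \<otimes> t) powr p)))"
      by (intro ennreal_leI pointwise) simp
    also have "\<dots> = (\<Sum>j\<in>?J. ennreal (c * x (inv (s j) \<otimes> t) powr p)) +
      (\<Sum>j\<in>?J. ennreal (c * d * (\<theta> j (inv (s j) \<otimes> t) * x (inv (s j) \<otimes> t) powr p)))"
      using c0 \<theta>01 by (subst ennreal_plus) (auto intro!: sum_nonneg simp: sum_ennreal)
    also have "\<dots> = (\<Sum>j\<in>?J. ennreal c * ennreal (x (inv (s j) \<otimes> t) powr p)) +
       (\<Sum>j\<in>?J. ennreal (c * d) * ennreal (\<theta> j (inv (s j) \<otimes> t) * x (inv (s j) \<otimes> t) powr p))"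
      using c0 \<theta>01 by (simp add: ennreal_mult'[symmetric])
    finally show "ennreal ((\<Sum>j\<in>?J. x (inv (s j) \<otimes> t)) powr p) \<le> \<dots>" .
  qed
  also have "\<dots> = (\<Sum>j\<in>?J. ennreal c * (\<integral>\<^sup>+t. ennreal (x (inv (s j) \<otimes> t) powr p) \<partial>?\<nu>)) +
       (\<Sum>j\<in>?J. ennreal (c * d) * (\<integral>\<^sup>+t. ennreal (\<theta> j (inv (s j) \<otimes> t) * x (inv (s j) \<otimes> t) powr p) \<partial>?\<nu>))"
    by (simp add: nn_integral_add nn_integral_sum nn_integral_cmult)
  also have "\<dots> = (\<Sum>j\<in>?J. ennreal c * I) +
       (\<Sum>j\<in>?J. ennreal (c * d) * (\<integral>\<^sup>+t. ennreal (\<theta> j t * x t powr p) \<partial>?\<nu>))"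
    unfolding I_def
    by (intro arg_cong2[where f="(+)"] sum.cong refl)
      (simp_all add: nn_integral_translate[OF sj, where f="\<lambda>t. ennreal (x t powr p)"]
        nn_integral_translate[OF sj, where f="\<lambda>t. ennreal (\<theta> j t * x t powr p)" for j])
  also have "(\<Sum>j\<in>?J. ennreal (c * d) * (\<integral>\<^sup>+t. ennreal (\<theta> j t * x t powr p) \<partial>?\<nu>)) =
      ennreal (c * d) * (\<integral>\<^sup>+t. (\<Sum>j\<in>?J. ennreal (\<theta> j t * x t powr p)) \<partial>?\<nu>)"
    by (simp add: nn_integral_sum sum_distrib_left)
  also have "(\<integral>\<^sup>+t. (\<Sum>j\<in>?J. ennreal (\<theta> j t * x t powr p)) \<partial>?\<nu>) \<le> I"
    unfolding I_def
  proof (rule nn_integral_mono)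
    fix t
    have "(\<Sum>j\<in>?J. ennreal (\<theta> j t * x t powr p)) = ennreal ((\<Sum>j\<in>?J. \<theta> j t) * x t powr p)"
      using \<theta>01 by (subst sum_ennreal) (auto simp: sum_distrib_right)
    also have "\<dots> \<le> ennreal (x t powr p)"
      using sum_\<theta>[of t] \<theta>01 by (intro ennreal_leI mult_left_le_one_le sum_nonneg) auto
    finally show "(\<Sum>j\<in>?J. ennreal (\<theta> j t * x t powr p)) \<le> ennreal (x t powr p)" .
  qed
  also have "(\<Sum>j\<in>?J. ennreal c * I) + ennreal (c * d) * I = ennreal (c * (real k + d)) * I"
    using c0 by (simp add: distrib_left ennreal_mult ennreal_of_nat_eq_real_of_nat distrib_right ac_simps)
  finally show ?thesis by (simp add: I_def c_def d_def mult_left_mono add_left_mono)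
qed


section \<open>The reduced norm\<close>

lemma nn_integral_slices:
  assumes "sigma_finite_measure M" "F \<in> borel_measurable (count_space A \<Otimes>\<^sub>M M)"
  shows "(\<integral>\<^sup>+z. ennreal (cmod (F z) powr p) \<partial>(count_space A \<Otimes>\<^sub>M M)) =
    (\<integral>\<^sup>+h. (\<integral>\<^sup>+x. ennreal (cmod (F (h, x)) powr p) \<partial>M) \<partial>count_space A)"
  using assms(2)
  by (subst sigma_finite_measure.nn_integral_fst[OF assms(1), symmetric]) simp_all

text \<open>
  For counting measure the integral over the slices dominates each single slice, so every slice of
  an $L^p$ function is an $L^p$ function, without exceptional points of the group.
\<close>
lemma slice_in_Lp_space:
  assumes M: "sigma_finite_measure M" and h: "h \<in> A"
    and \<xi>: "\<xi> \<in> Lp_space p (count_space A \<Otimes>\<^sub>M M)"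
  shows "(\<lambda>x. \<xi> (h, x)) \<in> Lp_space p M"
proof -
  note [measurable] = Lp_space_measurable[OF \<xi>]
  let ?s = "\<lambda>h. \<integral>\<^sup>+x. ennreal (cmod (\<xi> (h, x)) powr p) \<partial>M"
  have "?s h = (\<integral>\<^sup>+h'. ?s h * indicator {h} h' \<partial>count_space A)"
    using h by (simp add: nn_integral_cmult)
  also have "\<dots> \<le> (\<integral>\<^sup>+h'. ?s h' \<partial>count_space A)"
    by (intro nn_integral_mono) (auto simp: indicator_def)
  also have "\<dots> < \<infinity>"
    using \<xi> nn_integral_slices[OF M, of \<xi> A p] by (simp add: Lp_space_iff)
  finally show ?thesis
    using h by (simp add: Lp_space_iff)
qed

locale isometric_group_action = group G for G (structure) +
  fixes \<alpha> :: "'g \<Rightarrow> 'a::complex_banach_algebra \<Rightarrow> 'a" and p :: real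
  assumes p: "1 < p"
    and countable_carrier: "countable (carrier G)"
    and automorphism: "g \<in> carrier G \<Longrightarrow> continuous_automorphism (\<alpha> g)"
    and norm_action [simp]: "g \<in> carrier G \<Longrightarrow> norm (\<alpha> g a) = norm a"
    and action_mult: "g \<in> carrier G \<Longrightarrow> h \<in> carrier G \<Longrightarrow> \<alpha> (g \<otimes> h) = \<alpha> g \<circ> \<alpha> h"
begin

lemma p_ge_1: "1 \<le> p" and p_pos: "0 < p"
  using p by auto

lemma bij_action: "g \<in> carrier G \<Longrightarrow> bij (\<alpha> g)"
  using automorphism unfolding continuous_automorphism_def by blast

lemma action_one [simp]: "\<alpha> \<one> a = a"
proof -
  have "\<alpha> \<one> (\<alpha> \<one> a) = \<alpha> \<one> a"
    using action_mult[of \<one> \<one>] by (metis comp_apply one_closed r_one)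
  then show ?thesis using bij_action[OF one_closed] by (metis bij_pointE)
qed

lemma action_inv: "g \<in> carrier G \<Longrightarrow> \<alpha> (inv g) (\<alpha> g a) = a"
  using action_mult[of "inv g" g] by (metis action_one comp_apply inv_closed l_inv)

lemma action_inv': "g \<in> carrier G \<Longrightarrow> \<alpha> g (\<alpha> (inv g) a) = a"
  using action_inv[of "inv g"] by simp

lemma inv_into_action: "g \<in> carrier G \<Longrightarrow> inv_into UNIV (\<alpha> g) = \<alpha> (inv g)"
  by (intro inv_unique_comp) (auto simp: fun_eq_iff action_inv action_inv')

lemma action_hom: "g \<in> carrier G \<Longrightarrow> \<alpha> g (a * b) = \<alpha> g a * \<alpha> g b"
  using automorphism unfolding continuous_automorphism_def by blast

lemma bounded_clinear_action: "g \<in> carrier G \<Longrightarrow> bounded_clinear (\<alpha> g)"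
  using automorphism unfolding continuous_automorphism_def by blast

lemma action_zero [simp]: "g \<in> carrier G \<Longrightarrow> \<alpha> g 0 = 0"
  using bounded_clinear_action linear_simps(3) unfolding bounded_clinear_def by blast

lemma integrated_form_slice:
  assumes "h \<in> carrier G"
  shows "integrated_form G \<alpha> \<pi> f \<xi> (h, x) =
    (\<Sum>g\<in>{g. f g \<noteq> 0}. \<pi> (\<alpha> (inv h) (f g)) (\<lambda>y. \<xi> (inv g \<otimes> h, y)) x)"
  using assms by (simp add: integrated_form_def reg_rep_def reg_translation_def inv_into_action)

lemma integrated_form_slice_in_Lp:
  assumes M: "sigma_finite_measure M" and \<pi>: "Lp_rep p M \<pi>" and f: "f \<in> Cc G"
    and \<xi>: "\<xi> \<in> Lp_space p (count_space (carrier G) \<Otimes>\<^sub>M M)" and h: "h \<in> carrier G"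
  shows "(\<lambda>x. integrated_form G \<alpha> \<pi> f \<xi> (h, x)) \<in> Lp_space p M"
  unfolding integrated_form_slice[OF h]
proof (rule Lp_sum[OF p_ge_1])
  fix g assume "g \<in> {g. f g \<noteq> 0}"
  then have "inv g \<otimes> h \<in> carrier G" using f h by (auto simp: Cc_def)
  then show "\<pi> (\<alpha> (inv h) (f g)) (\<lambda>y. \<xi> (inv g \<otimes> h, y)) \<in> Lp_space p M"
    by (intro Lp_operator_closed[OF Lp_rep_operator[OF \<pi>]] slice_in_Lp_space[OF M _ \<xi>])
qed (use f in \<open>simp add: Cc_def\<close>)

lemma integrated_form_measurable:
  assumes "sigma_finite_measure M" "Lp_rep p M \<pi>" "f \<in> Cc G"
    and "\<xi> \<in> Lp_space p (count_space (carrier G) \<Otimes>\<^sub>M M)"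
  shows "integrated_form G \<alpha> \<pi> f \<xi> \<in> borel_measurable (count_space (carrier G) \<Otimes>\<^sub>M M)"
  using integrated_form_slice_in_Lp[OF assms]
  by (intro measurable_pair_measure_countable1 countable_carrier) (auto intro: Lp_space_measurable)

text \<open>
  The scalar function \<open>x\<close> stands for the slice norms of a vector in $L^p(G \times X)$. An element
  \<open>f\<close> acts on slice norms at most like convolution by the scalar function \<open>norm \<circ> f\<close>, so an
  estimate for that convolution on $\ell^p(G)$ bounds \<open>f\<close> in every regular representation at once.
\<close>
definition convolution_bound :: "('g \<Rightarrow> 'a) \<Rightarrow> real \<Rightarrow> bool"
  where "convolution_bound f K \<longleftrightarrow> 0 \<le> K \<and> (\<forall>x. (\<forall>t. 0 \<le> x t) \<longrightarrow>
    (\<integral>\<^sup>+t. ennreal ((\<Sum>g\<in>{g. f g \<noteq> 0}. norm (f g) * x (inv g \<otimes> t)) powr p) \<partial>count_space (carrier G))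
    \<le> ennreal (K powr p) * (\<integral>\<^sup>+t. ennreal (x t powr p) \<partial>count_space (carrier G)))"

text \<open>
  The slice over \<open>h\<close> of the image of \<open>\<xi>\<close> is the sum of the vectors obtained by applying
  $\pi(\alpha_h^{-1}(f(g)))$ to the slice of \<open>\<xi>\<close> over $g^{-1} h$. Since \<open>\<pi>\<close> is contractive and the
  action isometric, Minkowski's inequality compares its norm with the scalar convolution.
\<close>
lemma integrated_form_nn_integral_bound:
  assumes M: "sigma_finite_measure M" and \<pi>: "contractive_Lp_rep p M \<pi>" and f: "f \<in> Cc G"
    and \<xi>: "\<xi> \<in> Lp_space p (count_space (carrier G) \<Otimes>\<^sub>M M)"
    and K: "convolution_bound f K"
  shows "(\<integral>\<^sup>+z. ennreal (cmod (integrated_form G \<alpha> \<pi> f \<xi> z) powr p) \<partial>(count_space (carrier G) \<Otimes>\<^sub>M M)) \<le>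
    ennreal ((K * Lp_norm p (count_space (carrier G) \<Otimes>\<^sub>M M) \<xi>) powr p)"
proof -
  let ?\<nu> = "count_space (carrier G)"
  let ?F = "integrated_form G \<alpha> \<pi> f \<xi>" and ?S = "{g. f g \<noteq> 0}"
  have rep: "Lp_rep p M \<pi>" using \<pi> by (simp add: contractive_Lp_rep_def)
  note slice = slice_in_Lp_space[OF M _ \<xi>]
  define x where "x h = Lp_norm p M (\<lambda>y. \<xi> (h, y))" for h
  have K0: "0 \<le> K" using K by (simp add: convolution_bound_def)
  have S: "finite ?S" "?S \<subseteq> carrier G" using f by (auto simp: Cc_def)
  have slice_le: "(\<integral>\<^sup>+y. ennreal (cmod (?F (h, y)) powr p) \<partial>M) \<le>
      ennreal ((\<Sum>g\<in>?S. norm (f g) * x (inv g \<otimes> h)) powr p)" if h: "h \<in> carrier G" for h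
  proof -
    have in_Lp: "\<pi> (\<alpha> (inv h) (f g)) (\<lambda>y. \<xi> (inv g \<otimes> h, y)) \<in> Lp_space p M" if "g \<in> ?S" for g
      using S that h
      by (intro Lp_operator_closed[OF Lp_rep_operator[OF rep]] slice) auto
    have "Lp_norm p M (\<lambda>y. ?F (h, y)) \<le>
        (\<Sum>g\<in>?S. Lp_norm p M (\<pi> (\<alpha> (inv h) (f g)) (\<lambda>y. \<xi> (inv g \<otimes> h, y))))"
      unfolding integrated_form_slice[OF h] using in_Lp by (intro Lp_norm_sum p_ge_1 S)
    also have "\<dots> \<le> (\<Sum>g\<in>?S. norm (f g) * x (inv g \<otimes> h))"
    proof (rule sum_mono)
      fix g assume "g \<in> ?S"
      then have "inv g \<otimes> h \<in> carrier G" using S h by auto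
      then show "Lp_norm p M (\<pi> (\<alpha> (inv h) (f g)) (\<lambda>y. \<xi> (inv g \<otimes> h, y))) \<le>
          norm (f g) * x (inv g \<otimes> h)"
        using contractive_Lp_rep_norm[OF p_ge_1 \<pi> slice, of "inv g \<otimes> h" "\<alpha> (inv h) (f g)"] h
        by (simp add: x_def)
    qed
    finally show ?thesis
      unfolding nn_integral_eq_Lp_norm[OF p_pos integrated_form_slice_in_Lp[OF M rep f \<xi> h]]
      using p by (intro ennreal_leI powr_mono2) auto
  qed
  have "(\<integral>\<^sup>+z. ennreal (cmod (?F z) powr p) \<partial>(?\<nu> \<Otimes>\<^sub>M M)) =
      (\<integral>\<^sup>+h. (\<integral>\<^sup>+y. ennreal (cmod (?F (h, y)) powr p) \<partial>M) \<partial>?\<nu>)"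
    by (rule nn_integral_slices[OF M integrated_form_measurable[OF M rep f \<xi>]])
  also have "\<dots> \<le> (\<integral>\<^sup>+h. ennreal ((\<Sum>g\<in>?S. norm (f g) * x (inv g \<otimes> h)) powr p) \<partial>?\<nu>)"
    by (intro nn_integral_mono slice_le) simp
  also have "\<dots> \<le> ennreal (K powr p) * (\<integral>\<^sup>+h. ennreal (x h powr p) \<partial>?\<nu>)"
    using K[unfolded convolution_bound_def, THEN conjunct2, rule_format, of x]
    by (simp add: x_def)
  also have "(\<integral>\<^sup>+h. ennreal (x h powr p) \<partial>?\<nu>) =
      (\<integral>\<^sup>+h. (\<integral>\<^sup>+y. ennreal (cmod (\<xi> (h, y)) powr p) \<partial>M) \<partial>?\<nu>)"
    by (intro nn_integral_cong) (simp add: x_def nn_integral_eq_Lp_norm[OF p_pos slice])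
  also have "\<dots> = ennreal (Lp_norm p (?\<nu> \<Otimes>\<^sub>M M) \<xi> powr p)"
    by (simp add: nn_integral_slices[OF M Lp_space_measurable[OF \<xi>], symmetric]
        nn_integral_eq_Lp_norm[OF p_pos \<xi>])
  also have "ennreal (K powr p) * \<dots> = ennreal ((K * Lp_norm p (?\<nu> \<Otimes>\<^sub>M M) \<xi>) powr p)"
    using K0 by (simp add: powr_mult ennreal_mult)
  finally show ?thesis .
qed

lemma integrated_form_bound:
  assumes "sigma_finite_measure M" "contractive_Lp_rep p M \<pi>" "f \<in> Cc G"
    and "\<xi> \<in> Lp_space p (count_space (carrier G) \<Otimes>\<^sub>M M)" and "convolution_bound f K"
  shows "Lp_norm p (count_space (carrier G) \<Otimes>\<^sub>M M) (integrated_form G \<alpha> \<pi> f \<xi>) \<le>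
    K * Lp_norm p (count_space (carrier G) \<Otimes>\<^sub>M M) \<xi>"
  using integrated_form_nn_integral_bound[OF assms] assms(5)
  by (intro Lp_norm_leI p_pos) (auto simp: convolution_bound_def)

lemma integrated_form_in_Lp:
  assumes "sigma_finite_measure M" "contractive_Lp_rep p M \<pi>" "f \<in> Cc G"
    and "\<xi> \<in> Lp_space p (count_space (carrier G) \<Otimes>\<^sub>M M)" and "convolution_bound f K"
  shows "integrated_form G \<alpha> \<pi> f \<xi> \<in> Lp_space p (count_space (carrier G) \<Otimes>\<^sub>M M)"
  using integrated_form_nn_integral_bound[OF assms] assms integrated_form_measurable[of M \<pi> f \<xi>]
  by (simp add: Lp_space_iff contractive_Lp_rep_def le_less_trans)

lemma Lp_opnorm_integrated_form_le:
  assumes "sigma_finite_measure M" "contractive_Lp_rep p M \<pi>" "f \<in> Cc G" "convolution_bound f K"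
  shows "Lp_opnorm p (count_space (carrier G) \<Otimes>\<^sub>M M) (integrated_form G \<alpha> \<pi> f) \<le> K"
proof (rule Lp_opnorm_leI)
  fix \<xi> assume \<xi>: "\<xi> \<in> Lp_space p (count_space (carrier G) \<Otimes>\<^sub>M M)"
    "Lp_norm p (count_space (carrier G) \<Otimes>\<^sub>M M) \<xi> \<le> 1"
  have "0 \<le> K" using assms(4) by (simp add: convolution_bound_def)
  then have "K * Lp_norm p (count_space (carrier G) \<Otimes>\<^sub>M M) \<xi> \<le> K"
    using \<xi>(2) by (simp add: mult_left_le)
  then show "Lp_norm p (count_space (carrier G) \<Otimes>\<^sub>M M) (integrated_form G \<alpha> \<pi> f \<xi>) \<le> K"
    using integrated_form_bound[OF assms(1-3) \<xi>(1) assms(4)] by linarith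
qed

lemma convolution_bound_exists:
  assumes "f \<in> Cc G"
  obtains K where "convolution_bound f K"
proof
  let ?S = "{g. f g \<noteq> 0}"
  let ?c = "real (card ?S) powr (p - 1) * (\<Sum>g\<in>?S. norm (f g) powr p)"
  have c: "0 \<le> ?c" by (intro mult_nonneg_nonneg sum_nonneg) auto
  show "convolution_bound f (?c powr (1 / p))"
    unfolding convolution_bound_def
  proof (intro conjI allI impI)
    fix x :: "'g \<Rightarrow> real" assume "\<forall>t. 0 \<le> x t"
    then show "(\<integral>\<^sup>+t. ennreal ((\<Sum>g\<in>?S. norm (f g) * x (inv g \<otimes> t)) powr p) \<partial>count_space (carrier G))
      \<le> ennreal ((?c powr (1 / p)) powr p) * (\<integral>\<^sup>+t. ennreal (x t powr p) \<partial>count_space (carrier G))"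
      using nn_integral_average_le[OF p_ge_1, of ?S "\<lambda>g. norm (f g)" "\<lambda>g. g" x] assms p_pos c
      by (simp add: powr_powr Cc_def subset_iff)
  qed simp
qed

lemma convolution_bound_single:
  assumes "g \<in> carrier G" "\<And>h. h \<noteq> g \<Longrightarrow> f h = 0"
  shows "convolution_bound f (norm (f g))"
  unfolding convolution_bound_def
proof (intro conjI allI impI)
  fix x :: "'g \<Rightarrow> real" assume x: "\<forall>t. 0 \<le> x t"
  have "(\<Sum>h\<in>{h. f h \<noteq> 0}. norm (f h) * x (inv h \<otimes> t)) = (\<Sum>h\<in>{g}. norm (f h) * x (inv h \<otimes> t))" for t
    using assms(2) by (intro sum.mono_neutral_left) auto
  then show "(\<integral>\<^sup>+t. ennreal ((\<Sum>h\<in>{h. f h \<noteq> 0}. norm (f h) * x (inv h \<otimes> t)) powr p) \<partial>count_space (carrier G))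
      \<le> ennreal (norm (f g) powr p) * (\<integral>\<^sup>+t. ennreal (x t powr p) \<partial>count_space (carrier G))"
    using nn_integral_average_le[OF p_ge_1, of "{g}" "\<lambda>h. norm (f h)" "\<lambda>h. h" x] assms(1) x
    by simp
qed simp

end

text \<open>The representations over which the reduced norm is a supremum.\<close>
definition admissible_rep ::
    "real \<Rightarrow> 'x measure \<Rightarrow>
     ('a::complex_banach_algebra \<Rightarrow> ('x \<Rightarrow> complex) \<Rightarrow> 'x \<Rightarrow> complex) \<Rightarrow> bool"
  where "admissible_rep p M \<pi> \<longleftrightarrow>
    sigma_finite_measure M \<and> contractive_Lp_rep p M \<pi> \<and> nondegenerate_Lp_rep p M \<pi>"

context isometric_group_action begin

lemma reduced_norm_le:
  assumes f: "f \<in> Cc G" and K: "convolution_bound f K"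
    and ex: "admissible_rep p (M\<^sub>0 :: 'x measure) (\<pi>\<^sub>0 :: 'a \<Rightarrow> _)"
  shows "reduced_norm TYPE('x) p G \<alpha> f \<le> K"
  unfolding reduced_norm_def
proof (rule cSup_least)
  fix v assume "v \<in> {Lp_opnorm p (count_space (carrier G) \<Otimes>\<^sub>M M) (integrated_form G \<alpha> \<pi> f)
         | (M :: 'x measure) \<pi>.
           sigma_finite_measure M \<and> contractive_Lp_rep p M \<pi> \<and> nondegenerate_Lp_rep p M \<pi>}"
  then show "v \<le> K" using Lp_opnorm_integrated_form_le[OF _ _ f K] by blast
qed (use ex in \<open>auto simp: admissible_rep_def\<close>)

lemma Lp_opnorm_le_reduced_norm:
  assumes f: "f \<in> Cc G" and ex: "admissible_rep p (M :: 'x measure) \<pi>"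
  shows "Lp_opnorm p (count_space (carrier G) \<Otimes>\<^sub>M M) (integrated_form G \<alpha> \<pi> f) \<le>
    reduced_norm TYPE('x) p G \<alpha> f"
  unfolding reduced_norm_def
proof (rule cSup_upper)
  obtain K where K: "convolution_bound f K" using convolution_bound_exists[OF f] .
  show "bdd_above {Lp_opnorm p (count_space (carrier G) \<Otimes>\<^sub>M M) (integrated_form G \<alpha> \<pi> f)
         | (M :: 'x measure) \<pi>.
           sigma_finite_measure M \<and> contractive_Lp_rep p M \<pi> \<and> nondegenerate_Lp_rep p M \<pi>}"
    using Lp_opnorm_integrated_form_le[OF _ _ f K] by (intro bdd_aboveI[of _ K]) blast
qed (use ex in \<open>auto simp: admissible_rep_def\<close>)

text \<open>
  A vector concentrated on the slice over \<open>\<one>\<close> is mapped by \<open>f\<close> to a vector whose slice over \<open>\<one>\<close>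
  only involves \<open>f \<one>\<close>. So the coefficient at \<open>\<one>\<close> is a compression of \<open>f\<close>.
\<close>
lemma norm_rep_coeff_le_reduced_norm:
  assumes f: "f \<in> Cc G" and ex: "admissible_rep p (M :: 'x measure) \<pi>"
  shows "Lp_opnorm p M (\<pi> (f \<one>)) \<le> reduced_norm TYPE('x) p G \<alpha> f"
proof (rule Lp_opnorm_leI)
  fix \<xi> assume \<xi>: "\<xi> \<in> Lp_space p M" "Lp_norm p M \<xi> \<le> 1"
  let ?\<nu> = "count_space (carrier G)" and ?S = "{g. f g \<noteq> 0}"
  have M: "sigma_finite_measure M" and con: "contractive_Lp_rep p M \<pi>"
    using ex by (auto simp: admissible_rep_def)
  have rep: "Lp_rep p M \<pi>" using con by (simp add: contractive_Lp_rep_def)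
  note op = Lp_rep_operator[OF rep]
  have S: "finite ?S" "?S \<subseteq> carrier G" using f by (auto simp: Cc_def)
  note [measurable] = Lp_space_measurable[OF \<xi>(1)]
  define \<xi>' where "\<xi>' = (\<lambda>(h, x). if h = \<one> then \<xi> x else 0)"
  have meas: "\<xi>' \<in> borel_measurable (?\<nu> \<Otimes>\<^sub>M M)"
    by (intro measurable_pair_measure_countable1 countable_carrier) (auto simp: \<xi>'_def)
  have "(\<integral>\<^sup>+z. ennreal (cmod (\<xi>' z) powr p) \<partial>(?\<nu> \<Otimes>\<^sub>M M)) =
      (\<integral>\<^sup>+h. ennreal (Lp_norm p M \<xi> powr p) * indicator {\<one>} h \<partial>?\<nu>)"
    unfolding nn_integral_slices[OF M meas]
    by (intro nn_integral_cong)
      (auto simp: \<xi>'_def indicator_def nn_integral_eq_Lp_norm[OF p_pos \<xi>(1)])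
  also have "\<dots> = ennreal (Lp_norm p M \<xi> powr p)" by (simp add: nn_integral_cmult)
  finally have int: "(\<integral>\<^sup>+z. ennreal (cmod (\<xi>' z) powr p) \<partial>(?\<nu> \<Otimes>\<^sub>M M)) = \<dots>" .
  then have \<xi>': "\<xi>' \<in> Lp_space p (?\<nu> \<Otimes>\<^sub>M M)" using meas by (simp add: Lp_space_iff)
  have "Lp_norm p (?\<nu> \<Otimes>\<^sub>M M) \<xi>' \<le> Lp_norm p M \<xi>"
    by (intro Lp_norm_leI p_pos) (use int in auto)
  then have norm_\<xi>': "Lp_norm p (?\<nu> \<Otimes>\<^sub>M M) \<xi>' \<le> 1" using \<xi>(2) by simp
  let ?F = "integrated_form G \<alpha> \<pi> f \<xi>'"
  obtain K where K: "convolution_bound f K" using convolution_bound_exists[OF f] .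
  have F_le: "Lp_norm p (?\<nu> \<Otimes>\<^sub>M M) ?F \<le> reduced_norm TYPE('x) p G \<alpha> f"
    using Lp_opnorm_upper[OF integrated_form_bound[OF M con f _ K] \<xi>' norm_\<xi>']
      Lp_opnorm_le_reduced_norm[OF f ex] by linarith
  have F_meas: "?F \<in> borel_measurable (?\<nu> \<Otimes>\<^sub>M M)"
    by (rule integrated_form_measurable[OF M rep f \<xi>'])
  have F_Lp: "?F \<in> Lp_space p (?\<nu> \<Otimes>\<^sub>M M)"
    by (rule integrated_form_in_Lp[OF M con f \<xi>' K])
  have slice_one: "AE x in M. ?F (\<one>, x) = \<pi> (f \<one>) \<xi> x"
  proof -
    have "AE x in M. \<forall>g\<in>?S. \<pi> (f g) (\<lambda>y. \<xi>' (inv g, y)) x = (if g = \<one> then \<pi> (f \<one>) \<xi> x else 0)"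
    proof (rule AE_finite_allI[OF S(1)])
      fix g assume "g \<in> ?S"
      then have g: "g \<in> carrier G" using S by blast
      show "AE x in M. \<pi> (f g) (\<lambda>y. \<xi>' (inv g, y)) x = (if g = \<one> then \<pi> (f \<one>) \<xi> x else 0)"
        using Lp_operator_zero[OF op, of "f g"] g by (cases "g = \<one>") (auto simp: \<xi>'_def)
    qed
    moreover have "AE x in M. \<pi> 0 \<xi> x = 0"
      using Lp_rep_scale[OF rep \<xi>(1), of 0 0] Lp_rep_add[OF rep \<xi>(1), of 0 0] by auto
    ultimately show ?thesis
    proof eventually_elim
      case (elim x)
      have "?F (\<one>, x) = (\<Sum>g\<in>?S. \<pi> (f g) (\<lambda>y. \<xi>' (inv g, y)) x)"
        using S(2) by (subst integrated_form_slice) (auto intro!: sum.cong)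
      also have "\<dots> = (\<Sum>g\<in>?S. if g = \<one> then \<pi> (f \<one>) \<xi> x else 0)"
        using elim(1) by (intro sum.cong) auto
      also have "\<dots> = \<pi> (f \<one>) \<xi> x"
        using elim(2) S(1) by (auto simp: sum.delta)
      finally show ?case .
    qed
  qed
  have "Lp_norm p M (\<pi> (f \<one>) \<xi>) = Lp_norm p M (\<lambda>x. ?F (\<one>, x))"
    using slice_one
    by (intro Lp_norm_cong_AE Lp_space_measurable[OF Lp_operator_closed[OF op \<xi>(1)]]
        Lp_space_measurable[OF integrated_form_slice_in_Lp[OF M rep f \<xi>' one_closed]]) auto
  also have "\<dots> \<le> Lp_norm p (?\<nu> \<Otimes>\<^sub>M M) ?F"
  proof (intro Lp_norm_leI p_pos Lp_norm_nonneg)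
    let ?s = "\<lambda>h. \<integral>\<^sup>+x. ennreal (cmod (?F (h, x)) powr p) \<partial>M"
    have "?s \<one> = (\<integral>\<^sup>+h. ?s \<one> * indicator {\<one>} h \<partial>?\<nu>)" by (simp add: nn_integral_cmult)
    also have "\<dots> \<le> (\<integral>\<^sup>+h. ?s h \<partial>?\<nu>)" by (intro nn_integral_mono) (auto simp: indicator_def)
    also have "\<dots> = ennreal (Lp_norm p (?\<nu> \<Otimes>\<^sub>M M) ?F powr p)"
      unfolding nn_integral_slices[OF M F_meas, symmetric]
      by (rule nn_integral_eq_Lp_norm[OF p_pos F_Lp])
    finally show "?s \<one> \<le> \<dots>" .
  qed
  finally show "Lp_norm p M (\<pi> (f \<one>) \<xi>) \<le> reduced_norm TYPE('x) p G \<alpha> f"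
    using F_le by linarith
qed

end


section \<open>Cutting down to a $\sigma$-finite measure space\<close>

lemma countable_closed_superset:
  fixes \<Phi> :: "'s \<Rightarrow> 's set" and m :: "'s \<Rightarrow> 's \<Rightarrow> 's"
  assumes "countable S\<^sub>0" "\<And>A. countable (\<Phi> A)"
  obtains S where "countable S" "S\<^sub>0 \<subseteq> S" "\<And>A. A \<in> S \<Longrightarrow> \<Phi> A \<subseteq> S"
    "\<And>A B. A \<in> S \<Longrightarrow> B \<in> S \<Longrightarrow> m A B \<in> S"
proof -
  define step where "step T = T \<union> (\<Union>A\<in>T. \<Phi> A) \<union> (\<lambda>(A, B). m A B) ` (T \<times> T)" for T
  define T where "T n = (step ^^ n) S\<^sub>0" for n
  have Suc: "T (Suc n) = step (T n)" for n by (simp add: T_def)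
  have countable: "countable (T n)" for n
    by (induction n) (use assms in \<open>auto simp: T_def step_def\<close>)
  have mono: "T n \<subseteq> T k" if "n \<le> k" for n k
    by (rule lift_Suc_mono_le[OF _ that]) (auto simp: Suc step_def)
  show thesis
  proof
    show "countable (\<Union>n. T n)" using countable by blast
    have "T 0 \<subseteq> (\<Union>n. T n)" by blast
    then show "S\<^sub>0 \<subseteq> (\<Union>n. T n)" by (simp add: T_def)
    show "\<Phi> A \<subseteq> (\<Union>n. T n)" if A: "A \<in> (\<Union>n. T n)" for A
    proof -
      obtain n where "A \<in> T n" using A by blast
      then have "\<Phi> A \<subseteq> T (Suc n)" by (auto simp: Suc step_def)
      then show ?thesis by blast
    qed
    show "m A B \<in> (\<Union>n. T n)" if A: "A \<in> (\<Union>n. T n)" and B: "B \<in> (\<Union>n. T n)" for A B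
    proof -
      obtain n k where "A \<in> T n" "B \<in> T k" using A B by blast
      then have "A \<in> T (max n k)" "B \<in> T (max n k)"
        using mono[of n "max n k"] mono[of k "max n k"] by auto
      then have "m A B \<in> T (Suc (max n k))" by (auto simp: Suc step_def)
      then show ?thesis by blast
    qed
  qed
qed

text \<open>
  Chebyshev's inequality, in the qualitative form in which it makes level sets finite.
\<close>
lemma emeasure_finite_if_Lp_ge:
  assumes f: "f \<in> Lp_space p M" and A: "A \<in> sets M" and c: "0 < c" and p: "0 < p"
    and ge: "\<And>x. x \<in> A \<Longrightarrow> c \<le> cmod (f x)"
  shows "emeasure M A < \<infinity>"
proof -
  have "ennreal (c powr p) * emeasure M A = (\<integral>\<^sup>+x. ennreal (c powr p) * indicator A x \<partial>M)"
    using A by (simp add: nn_integral_cmult_indicator)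
  also have "\<dots> \<le> (\<integral>\<^sup>+x. ennreal (cmod (f x) powr p) \<partial>M)"
    using ge c p by (intro nn_integral_mono) (auto simp: indicator_def intro!: ennreal_leI powr_mono2)
  also have "\<dots> < \<infinity>" using f by (simp add: Lp_space_iff)
  finally show ?thesis
    using c by (auto simp: ennreal_mult_less_top)
qed

lemma indicator_in_Lp_space:
  assumes "A \<in> sets M" "emeasure M A < \<infinity>" "0 < p"
  shows "indicator A \<in> Lp_space p M"
proof -
  have "ennreal (cmod (indicator A x) powr p) = indicator A x" for x
    using assms(3) by (auto simp: indicator_def)
  then show ?thesis using assms by (simp add: Lp_space_iff)
qed

text \<open>
  Preimages of a base of the topology recover the measurability of \<open>f\<close>. They are cut down to where
  \<open>f\<close> is bounded away from zero, so that they have finite measure when \<open>f\<close> is in $L^p$.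
\<close>
definition level_sets :: "'x measure \<Rightarrow> complex set set \<Rightarrow> ('x \<Rightarrow> complex) \<Rightarrow> 'x set set"
  where "level_sets M \<B> f =
    (\<lambda>(B, n). {x \<in> space M. f x \<in> B \<and> 1 / real (Suc n) < cmod (f x)}) ` (\<B> \<times> UNIV)"

lemma level_sets_fmeasurable:
  assumes f: "f \<in> Lp_space p M" and \<B>: "topological_basis \<B>" and p: "0 < p"
  shows "level_sets M \<B> f \<subseteq> fmeasurable M"
proof -
  note [measurable] = Lp_space_measurable[OF f]
  have "{x \<in> space M. f x \<in> B \<and> 1 / real (Suc n) < cmod (f x)} \<in> fmeasurable M" if "B \<in> \<B>" for B n
  proof (rule fmeasurableI)
    have "open B" using topological_basis_open[OF \<B> that] .
    then have [measurable]: "B \<in> sets borel" by simp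
    show "{x \<in> space M. f x \<in> B \<and> 1 / real (Suc n) < cmod (f x)} \<in> sets M" by measurable
    then show "emeasure M {x \<in> space M. f x \<in> B \<and> 1 / real (Suc n) < cmod (f x)} < \<infinity>"
      by (rule emeasure_finite_if_Lp_ge[OF f _ _ p, of _ "1 / real (Suc n)"]) auto
  qed
  then show ?thesis by (auto simp: level_sets_def)
qed

text \<open>
  A countable family \<open>\<S>\<close> of sets of finite measure spans a \<open>\<sigma>\<close>-finite measure space \<open>N\<close>: its
  points are those of the union \<open>Y\<close>, its \<open>\<sigma>\<close>-algebra is generated by \<open>\<S>\<close>. Extension by zero embeds
  $L^p(N)$ isometrically into $L^p(M)$.
\<close>
locale countable_set_system =
  fixes M :: "'x measure" and \<S> :: "'x set set"
  assumes countable_\<S>: "countable \<S>" and \<S>_fmeasurable: "\<S> \<subseteq> fmeasurable M"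
    and Int_stable_\<S>: "Int_stable \<S>" and \<S>_nonempty: "\<S> \<noteq> {}"
begin

definition Y :: "'x set" where "Y = \<Union>\<S>"

definition N :: "'x measure" where "N = measure_of Y \<S> (emeasure M)"

lemma \<S>_sets: "S \<in> \<S> \<Longrightarrow> S \<in> sets M" and \<S>_Pow: "\<S> \<subseteq> Pow Y"
  using \<S>_fmeasurable by (auto simp: Y_def)

lemma Y_sets [measurable]: "Y \<in> sets M"
  unfolding Y_def using countable_\<S> \<S>_sets by (intro sets.countable_Union) auto

lemma Y_subset: "Y \<subseteq> space M"
  using Y_sets by (rule sets.sets_into_space)

lemma space_N [simp]: "space N = Y"
  by (simp add: N_def space_measure_of \<S>_Pow)

lemma sets_N: "sets N = sigma_sets Y \<S>"
  by (simp add: N_def sets_measure_of \<S>_Pow)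

lemma sets_N_restrict: "sets N \<subseteq> sets (restrict_space M Y)"
proof -
  have "\<S> \<subseteq> sets (restrict_space M Y)"
  proof
    fix S assume "S \<in> \<S>"
    then have "S \<in> sets M" "S \<subseteq> Y" using \<S>_sets by (auto simp: Y_def)
    then show "S \<in> sets (restrict_space M Y)"
      by (simp add: sets_restrict_space_iff)
  qed
  then have "sigma_sets (space (restrict_space M Y)) \<S> \<subseteq> sets (restrict_space M Y)"
    by (rule sets.sigma_sets_subset)
  then show ?thesis
    using Y_subset by (simp add: sets_N space_restrict_space Int_absorb1 Int_absorb2)
qed

lemma sets_N_D: "A \<in> sets N \<Longrightarrow> A \<in> sets M" "A \<in> sets N \<Longrightarrow> A \<subseteq> Y"
  using sets_N_restrict by (auto simp: sets_restrict_space_iff subset_iff)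

lemma emeasure_N: "A \<in> sets N \<Longrightarrow> emeasure N A = emeasure M A"
proof (rule emeasure_measure_of[OF N_def])
  show "countably_additive (sets N) (emeasure M)"
    by (rule countably_additiveI) (auto intro!: suminf_emeasure sets_N_D)
qed (use \<S>_Pow in \<open>auto simp: positive_def\<close>)

lemma sigma_finite_N: "sigma_finite_measure N"
proof
  have "S \<in> sets N" "emeasure N S \<noteq> \<infinity>" if "S \<in> \<S>" for S
  proof -
    show "S \<in> sets N" using that by (simp add: sets_N)
    then show "emeasure N S \<noteq> \<infinity>"
      using that \<S>_fmeasurable by (auto simp: emeasure_N fmeasurable_def)
  qed
  then show "\<exists>A. countable A \<and> A \<subseteq> sets N \<and> \<Union>A = space N \<and> (\<forall>a\<in>A. emeasure N a \<noteq> \<infinity>)"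
    using countable_\<S> by (intro exI[of _ \<S>]) (auto simp: Y_def)
qed

lemma nn_integral_N:
  assumes "g \<in> borel_measurable N"
  shows "(\<integral>\<^sup>+x. g x \<partial>N) = (\<integral>\<^sup>+x. g x * indicator Y x \<partial>M)"
proof -
  have "(\<integral>\<^sup>+x. g x \<partial>N) = (\<integral>\<^sup>+x. g x \<partial>restrict_space M Y)"
  proof (rule nn_integral_subalgebra[OF assms sets_N_restrict])
    show "space N = space (restrict_space M Y)"
      using Y_subset by (simp add: space_restrict_space Int_absorb2)
    show "emeasure N A = emeasure (restrict_space M Y) A" if "A \<in> sets N" for A
      using that sets_N_D[OF that] Y_subset
      by (simp add: emeasure_N emeasure_restrict_space Int_absorb2)
  qed
  also have "\<dots> = (\<integral>\<^sup>+x. g x * indicator Y x \<partial>M)"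
    using Y_subset by (intro nn_integral_restrict_space) (simp add: Int_absorb2)
  finally show ?thesis .
qed

definition ext :: "('x \<Rightarrow> complex) \<Rightarrow> 'x \<Rightarrow> complex"
  where "ext \<xi> x = (if x \<in> Y then \<xi> x else 0)"

lemma ext_measurable:
  assumes "\<xi> \<in> borel_measurable N"
  shows "ext \<xi> \<in> borel_measurable M"
proof -
  have "\<xi> \<in> borel_measurable (restrict_space M Y)"
    using assms sets_N_restrict Y_subset
    by (auto simp: measurable_def space_restrict_space Int_absorb2)
  then have "(\<lambda>x. if x \<in> Y then \<xi> x else 0) \<in> borel_measurable M"
    using Y_subset by (subst (asm) measurable_restrict_space_iff) (auto simp: Int_absorb2)
  then show ?thesis by (simp add: ext_def[abs_def])
qed

lemma nn_integral_ext:
  assumes [measurable]: "\<xi> \<in> borel_measurable N"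
  shows "(\<integral>\<^sup>+x. ennreal (cmod (ext \<xi> x) powr p) \<partial>M) = (\<integral>\<^sup>+x. ennreal (cmod (\<xi> x) powr p) \<partial>N)"
  by (subst nn_integral_N) (auto intro!: nn_integral_cong simp: ext_def)

lemma ext_in_Lp_iff:
  assumes "\<xi> \<in> borel_measurable N"
  shows "ext \<xi> \<in> Lp_space p M \<longleftrightarrow> \<xi> \<in> Lp_space p N"
  using assms by (simp add: Lp_space_iff nn_integral_ext ext_measurable)

lemma ext_in_Lp: "\<xi> \<in> Lp_space p N \<Longrightarrow> ext \<xi> \<in> Lp_space p M"
  using ext_in_Lp_iff Lp_space_measurable by blast

lemma Lp_norm_ext:
  assumes "\<xi> \<in> borel_measurable N"
  shows "Lp_norm p M (ext \<xi>) = Lp_norm p N \<xi>"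
proof -
  note [measurable] = assms ext_measurable[OF assms]
  show ?thesis unfolding Lp_norm_def
    by (simp add: integral_eq_nn_integral nn_integral_ext)
qed

lemma AE_ext_iff:
  assumes [measurable]: "\<xi> \<in> borel_measurable N" "\<eta> \<in> borel_measurable N"
  shows "(AE x in M. ext \<xi> x = ext \<eta> x) \<longleftrightarrow> (AE x in N. \<xi> x = \<eta> x)"
proof -
  note [measurable] = ext_measurable[OF assms(1)] ext_measurable[OF assms(2)]
  let ?A = "{x \<in> space N. \<xi> x \<noteq> \<eta> x}"
  have A: "?A \<in> sets N" by measurable
  have eq: "{x \<in> space M. ext \<xi> x \<noteq> ext \<eta> x} = ?A"
    using Y_subset by (auto simp: ext_def)
  have "(AE x in M. ext \<xi> x = ext \<eta> x) \<longleftrightarrow> emeasure M ?A = 0"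
    by (rule AE_iff_measurable) (use sets_N_D(1)[OF A] eq in auto)
  also have "\<dots> \<longleftrightarrow> emeasure N ?A = 0" using emeasure_N[OF A] by simp
  also have "\<dots> \<longleftrightarrow> (AE x in N. \<xi> x = \<eta> x)"
    by (rule AE_iff_measurable[symmetric]) (use A in auto)
  finally show ?thesis .
qed

lemma ext_add: "ext (\<lambda>x. \<xi> x + \<eta> x) = (\<lambda>x. ext \<xi> x + ext \<eta> x)"
  and ext_diff: "ext (\<lambda>x. \<xi> x - \<eta> x) = (\<lambda>x. ext \<xi> x - ext \<eta> x)"
  and ext_scale: "ext (\<lambda>x. c * \<xi> x) = (\<lambda>x. c * ext \<xi> x)"
  by (auto simp: ext_def)

lemma ext_indicator: "A \<subseteq> Y \<Longrightarrow> ext (indicator A) = indicator A"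
  by (auto simp: ext_def indicator_def fun_eq_iff)

text \<open>
  The indicators of the sets in \<open>\<S>\<close> span a dense subspace of $L^p(N)$. The sets with the right
  behaviour inside a fixed member of \<open>\<S>\<close> form a Dynkin system; \<open>\<sigma>\<close>-finiteness, simple functions
  and dominated convergence do the rest.
\<close>
lemma Lp_dense_induct [consumes 2, case_names indicator add scale limit]:
  assumes p: "1 \<le> p" and \<xi>: "\<xi> \<in> Lp_space p N"
    and ind: "\<And>S. S \<in> \<S> \<Longrightarrow> P (indicator S)"
    and add: "\<And>\<xi> \<eta>. \<xi> \<in> Lp_space p N \<Longrightarrow> \<eta> \<in> Lp_space p N \<Longrightarrow> P \<xi> \<Longrightarrow> P \<eta> \<Longrightarrow> P (\<lambda>x. \<xi> x + \<eta> x)"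
    and scale: "\<And>c \<xi>. \<xi> \<in> Lp_space p N \<Longrightarrow> P \<xi> \<Longrightarrow> P (\<lambda>x. c * \<xi> x)"
    and lim: "\<And>u \<xi>. (\<And>n. u n \<in> Lp_space p N) \<Longrightarrow> (\<And>n. P (u n)) \<Longrightarrow> \<xi> \<in> Lp_space p N \<Longrightarrow>
      (\<lambda>n. Lp_norm p N (\<lambda>x. u n x - \<xi> x)) \<longlonglongrightarrow> 0 \<Longrightarrow> P \<xi>"
  shows "P \<xi>"
proof -
  have p0: "0 < p" using p by simp
  have \<S>_N: "S \<in> sets N" "emeasure N S < \<infinity>" if "S \<in> \<S>" for S
  proof -
    show "S \<in> sets N" using that by (simp add: sets_N)
    then show "emeasure N S < \<infinity>"
      using that \<S>_fmeasurable by (auto simp: emeasure_N fmeasurable_def)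
  qed
  have sub_finite: "emeasure N (E \<inter> F) < \<infinity>" if "E \<in> sets N" "F \<in> sets N" "emeasure N F < \<infinity>" for E F
    using emeasure_mono[of "E \<inter> F" F N] that by (auto simp: less_top[symmetric] top_unique)
  have Lp_ind: "indicator A \<in> Lp_space p N" if "A \<in> sets N" "emeasure N A < \<infinity>" for A
    using indicator_in_Lp_space[OF that p0] .
  have diff: "P (\<lambda>x. \<xi> x - \<eta> x)"
    if "\<xi> \<in> Lp_space p N" "\<eta> \<in> Lp_space p N" "P \<xi>" "P \<eta>" for \<xi> \<eta>
    using add[OF that(1) Lp_scale[OF that(2), of "-1"] that(3) scale[OF that(2,4)]] by simp
  have zero: "P (\<lambda>x. 0)" if "S \<in> \<S>" for S
    using scale[OF Lp_ind[OF \<S>_N[OF that]] ind[OF that], of 0] by simp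
  have sum: "P (\<lambda>x. \<Sum>i\<in>I. \<xi> i x)"
    if "finite I" "\<And>i. i \<in> I \<Longrightarrow> \<xi> i \<in> Lp_space p N" "\<And>i. i \<in> I \<Longrightarrow> P (\<xi> i)" "P (\<lambda>x. 0)"
    for I :: "'i set" and \<xi>
    using that by (induction I) (auto intro!: add Lp_sum[OF p])
  have limit_ind: "P (indicator A)"
    if A: "A \<in> sets N" "emeasure N A < \<infinity>" and T: "\<And>n. T n \<in> sets N" "\<And>n. T n \<subseteq> A"
      and P: "\<And>n. P (indicator (T n))" and ev: "\<And>x. x \<in> A \<Longrightarrow> \<forall>\<^sub>F n in sequentially. x \<in> T n"
    for A and T :: "nat \<Rightarrow> 'x set"
  proof (rule lim[where u = "\<lambda>n. indicator (T n)"])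
    show Lp: "indicator A \<in> Lp_space p N" by (rule Lp_ind[OF A])
    have cv: "(\<lambda>n. indicator (T n) x :: complex) \<longlonglongrightarrow> indicator A x" for x
    proof (cases "x \<in> A")
      case True
      then show ?thesis
        by (intro tendsto_eventually eventually_mono[OF ev[OF True]]) auto
    next
      case False
      then have "indicator (T n) x = (0 :: complex)" for n using T(2)[of n] by (auto simp: indicator_def)
      then show ?thesis using False by simp
    qed
    have le: "cmod (indicator (T n) x) \<le> 2 * cmod (indicator A x)" for n x
      using T(2)[of n] by (auto simp: indicator_def)
    have meas: "indicator (T n) \<in> borel_measurable N" for n
      using T(1)[of n] by simp
    note dom = Lp_dominated_convergence[OF p meas Lp cv le]
    show "indicator (T n) \<in> Lp_space p N" for n by (rule dom(2))
    show "(\<lambda>n. Lp_norm p N (\<lambda>x. indicator (T n) x - indicator A x)) \<longlonglongrightarrow> 0" by (rule dom(1))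
  qed (rule P)
  \<comment> \<open>Intersecting with \<open>S\<close> keeps all sets of finite measure, also after taking complements.\<close>
  have step1: "P (indicator (E \<inter> S))" if S: "S \<in> \<S>" and E: "E \<in> sigma_sets Y \<S>" for E S
    using Int_stable_\<S> \<S>_Pow E
  proof (induction rule: sigma_sets_induct_disjoint)
    case (basic E)
    then show ?case using Int_stable_\<S> S by (intro ind) (auto simp: Int_stable_def)
  next
    case empty
    then show ?case using zero[OF S] by (simp add: indicator_def)
  next
    case (compl E)
    have "(indicator ((Y - E) \<inter> S) :: 'x \<Rightarrow> complex) = (\<lambda>x. indicator S x - indicator (E \<inter> S) x)"
      using S \<S>_Pow by (auto simp: indicator_def fun_eq_iff)
    moreover have "E \<inter> S \<in> sets N" using compl \<S>_N[OF S] by (auto simp: sets_N[symmetric])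
    ultimately show ?case
      using diff[OF Lp_ind Lp_ind ind[OF S] compl(2)] \<S>_N[OF S] sub_finite[of E S] compl(1)
      by (simp add: sets_N)
  next
    case (union E)
    have E_N: "E i \<in> sets N" for i using union(2) by (auto simp: sets_N)
    have ES: "E i \<inter> S \<in> sets N" "emeasure N (E i \<inter> S) < \<infinity>" for i
      using E_N \<S>_N[OF S] sub_finite by auto
    show ?case
    proof (rule limit_ind[of _ "\<lambda>n. (\<Union>i<n. E i) \<inter> S"])
      show U: "\<Union> (range E) \<inter> S \<in> sets N" using E_N \<S>_N[OF S] by auto
      show "emeasure N (\<Union> (range E) \<inter> S) < \<infinity>" using E_N \<S>_N[OF S] by (intro sub_finite) auto
      show "(\<Union>i<n. E i) \<inter> S \<in> sets N" for n using E_N \<S>_N[OF S] by auto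
      show "P (indicator ((\<Union>i<n. E i) \<inter> S))" for n
      proof -
        have "(indicator ((\<Union>i<n. E i) \<inter> S) :: 'x \<Rightarrow> complex) = (\<lambda>x. \<Sum>i<n. indicator (E i \<inter> S) x)"
        proof
          fix x
          have "indicator ((\<Union>i<n. E i \<inter> S)) x = (\<Sum>i<n. indicator (E i \<inter> S) x :: complex)"
            using union(1)
            by (intro indicator_UN_disjoint) (auto simp: disjoint_family_on_def)
          then show "indicator ((\<Union>i<n. E i) \<inter> S) x = (\<Sum>i<n. indicator (E i \<inter> S) x :: complex)"
            by (simp add: UN_simps)
        qed
        then show ?thesis
          using sum[of "{..<n}" "\<lambda>i. indicator (E i \<inter> S)"] Lp_ind[OF ES] union(3) zero[OF S] by simp
      qed
      show "\<forall>\<^sub>F n in sequentially. x \<in> (\<Union>i<n. E i) \<inter> S" if "x \<in> \<Union> (range E) \<inter> S" for x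
      proof -
        obtain i where "x \<in> E i" "x \<in> S" using \<open>x \<in> _\<close> by blast
        then show ?thesis
          by (intro eventually_mono[OF eventually_gt_at_top[of i]]) auto
      qed
    qed auto
  qed
  have step2: "P (indicator E)" if E: "E \<in> sets N" "emeasure N E < \<infinity>" for E
  proof -
    define S where "S = from_nat_into \<S>"
    have S: "S n \<in> \<S>" for n using \<S>_nonempty by (simp add: S_def from_nat_into)
    have range_S: "range S = \<S>" unfolding S_def using \<S>_nonempty countable_\<S> by (rule range_from_nat_into)
    have fin: "P (indicator (E' \<inter> (\<Union>i<n. S i)))" if "E' \<in> sets N" for n E'
      using that
    proof (induction n arbitrary: E')
      case 0
      then show ?case using zero[OF S] by (simp add: indicator_def)
    next
      case (Suc n)
      let ?U = "\<Union>i<n. S i"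
      have U: "?U \<in> sets N" using \<S>_N[OF S] by auto
      have fU: "emeasure N (E' \<inter> ?U) < \<infinity>" if "E' \<in> sets N" for E'
      proof (rule sub_finite[OF that U])
        have "emeasure N ?U \<le> (\<Sum>i<n. emeasure N (S i))"
          using \<S>_N[OF S] by (intro emeasure_subadditive_finite) auto
        also have "\<dots> < \<infinity>" using \<S>_N[OF S] by (auto simp: less_top)
        finally show "emeasure N ?U < \<infinity>" .
      qed
      have ES: "E' \<inter> S n \<in> sets N" using Suc(2) \<S>_N[OF S] by auto
      have "(indicator (E' \<inter> (\<Union>i<Suc n. S i)) :: 'x \<Rightarrow> complex) =
        (\<lambda>x. (indicator (E' \<inter> ?U) x + indicator (E' \<inter> S n) x) - indicator ((E' \<inter> S n) \<inter> ?U) x)"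
        by (auto simp: indicator_def fun_eq_iff lessThan_Suc)
      moreover have "P (indicator (E' \<inter> S n))"
        using step1[OF S] Suc(2) by (simp add: sets_N)
      ultimately show ?case
        using Suc.IH[OF Suc(2)] Suc.IH[OF ES] fU[OF Suc(2)] fU[OF ES] ES U Suc(2)
          sub_finite[OF Suc(2) \<S>_N[OF S]]
        by (auto intro!: diff add Lp_add[OF p] Lp_ind)
    qed
    show ?thesis
    proof (rule limit_ind[OF E, of "\<lambda>n. E \<inter> (\<Union>i<n. S i)"])
      show "\<forall>\<^sub>F n in sequentially. x \<in> E \<inter> (\<Union>i<n. S i)" if "x \<in> E" for x
      proof -
        have "x \<in> \<Union>(range S)"
          using that sets_N_D(2)[OF E(1)] range_S by (auto simp: Y_def)
        then obtain i where "x \<in> S i" by blast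
        then show ?thesis
          using that by (intro eventually_mono[OF eventually_gt_at_top[of i]]) auto
      qed
    qed (use E fin \<S>_N[OF S] in auto)
  qed
  \<comment> \<open>Simple functions agree with their canonical form on the space only; the constant sequence
    passes from one to the other.\<close>
  have eq_on_space: "P \<eta>" if "\<zeta> \<in> Lp_space p N" "P \<zeta>" "\<And>x. x \<in> space N \<Longrightarrow> \<zeta> x = \<eta> x" for \<zeta> \<eta>
  proof -
    have "\<eta> \<in> borel_measurable N"
      using Lp_space_measurable[OF that(1)] that(3) by (subst measurable_cong[of _ _ \<zeta>]) auto
    then have \<eta>: "\<eta> \<in> Lp_space p N"
      using that(3) by (intro Lp_space_cong_AE[OF that(1)] AE_I2) auto
    have "Lp_norm p N (\<lambda>x. \<zeta> x - \<eta> x) = Lp_norm p N (\<lambda>x. 0)"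
      using Lp_space_measurable[OF that(1)] Lp_space_measurable[OF \<eta>] that(3)
      by (intro Lp_norm_cong_AE) auto
    then show "P \<eta>" using lim[of "\<lambda>_. \<zeta>" \<eta>] that \<eta> by simp
  qed
  have step3: "P f" if f: "simple_function N f" "f \<in> Lp_space p N" for f
  proof -
    obtain S where S: "S \<in> \<S>" using \<S>_nonempty by blast
    let ?V = "f ` space N - {0}"
    define B where "B v = f -` {v} \<inter> space N" for v
    have V: "finite ?V" using simple_functionD(1)[OF f(1)] by simp
    have B: "B v \<in> sets N" for v unfolding B_def using simple_functionD(2)[OF f(1)] .
    have Bfin: "emeasure N (B v) < \<infinity>" if "v \<noteq> 0" for v
      by (rule emeasure_finite_if_Lp_ge[OF f(2) B _ p0, of "cmod v"]) (use that in \<open>auto simp: B_def\<close>)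
    let ?g = "\<lambda>x. \<Sum>v\<in>?V. v * indicator (B v) x"
    have in_Lp: "(\<lambda>x. v * indicator (B v) x) \<in> Lp_space p N" if "v \<in> ?V" for v
      using that by (intro Lp_scale Lp_ind B Bfin) auto
    show "P f"
    proof (rule eq_on_space[of ?g])
      show "?g \<in> Lp_space p N" by (intro Lp_sum p V in_Lp)
      show "P ?g"
      proof (rule sum[OF V in_Lp])
        fix v assume "v \<in> ?V"
        then show "P (\<lambda>x. v * indicator (B v) x)"
          by (intro scale Lp_ind step2 B Bfin) auto
      qed (use zero[OF S] in auto)
      show "?g x = f x" if "x \<in> space N" for x
      proof -
        have "?g x = (\<Sum>v\<in>?V. if v = f x then v else 0)"
          using that by (intro sum.cong) (auto simp: B_def indicator_def)
        also have "\<dots> = f x" using V that by (auto simp: sum.delta)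
        finally show ?thesis .
      qed
    qed
  qed
  show "P \<xi>"
  proof -
    obtain F where F: "\<And>i. simple_function N (F i)"
      "\<And>x. x \<in> space N \<Longrightarrow> (\<lambda>i. F i x) \<longlonglongrightarrow> \<xi> x"
      "\<And>i x. x \<in> space N \<Longrightarrow> dist (F i x) 0 \<le> 2 * dist (\<xi> x) 0"
      using borel_measurable_implies_sequence_metric[OF Lp_space_measurable[OF \<xi>], of 0] by blast
    have dom: "(\<lambda>n. Lp_norm p N (\<lambda>x. F n x - \<xi> x)) \<longlonglongrightarrow> 0" "\<And>n. F n \<in> Lp_space p N"
      using Lp_dominated_convergence[OF p borel_measurable_simple_function[OF F(1)] \<xi> F(2)] F(3)
      by auto
    show ?thesis using lim[OF dom(2) step3[OF F(1) dom(2)] \<xi> dom(1)] .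
  qed
qed


text \<open>
  A function on \<open>M\<close> descends if its class comes from $L^p(N)$. The functions that descend form a
  closed subspace, because a norm convergent sequence has a subsequence that converges almost
  everywhere.
\<close>
definition descends :: "real \<Rightarrow> ('x \<Rightarrow> complex) \<Rightarrow> bool"
  where "descends p f \<longleftrightarrow> (\<exists>\<eta>\<in>Lp_space p N. AE x in M. ext \<eta> x = f x)"

lemma descends_cong:
  assumes "descends p f" "AE x in M. f x = g x"
  shows "descends p g"
proof -
  obtain \<eta> where \<eta>: "\<eta> \<in> Lp_space p N" "AE x in M. ext \<eta> x = f x"
    using assms(1) by (auto simp: descends_def)
  from \<eta>(2) assms(2) have "AE x in M. ext \<eta> x = g x" by eventually_elim simp
  then show ?thesis using \<eta>(1) by (auto simp: descends_def)
qed

lemma descends_add: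
  assumes "1 \<le> p" "descends p f" "descends p g"
  shows "descends p (\<lambda>x. f x + g x)"
proof -
  obtain \<eta> \<zeta> where \<eta>: "\<eta> \<in> Lp_space p N" "AE x in M. ext \<eta> x = f x"
    and \<zeta>: "\<zeta> \<in> Lp_space p N" "AE x in M. ext \<zeta> x = g x"
    using assms(2,3) by (auto simp: descends_def)
  from \<eta>(2) \<zeta>(2) have "AE x in M. ext (\<lambda>x. \<eta> x + \<zeta> x) x = f x + g x"
    by eventually_elim (simp add: ext_add)
  then show ?thesis using Lp_add[OF assms(1) \<eta>(1) \<zeta>(1)] unfolding descends_def by blast
qed

lemma descends_scale:
  assumes "descends p f"
  shows "descends p (\<lambda>x. c * f x)"
proof -
  obtain \<eta> where \<eta>: "\<eta> \<in> Lp_space p N" "AE x in M. ext \<eta> x = f x"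
    using assms by (auto simp: descends_def)
  from \<eta>(2) have "AE x in M. ext (\<lambda>x. c * \<eta> x) x = c * f x"
    by eventually_elim (simp add: ext_scale)
  then show ?thesis using Lp_scale[OF \<eta>(1)] unfolding descends_def by blast
qed

lemma descends_limit:
  assumes p: "1 \<le> p" and f: "f \<in> Lp_space p M"
    and u: "\<And>n. u n \<in> Lp_space p M" "\<And>n. descends p (u n)"
    and lim: "(\<lambda>n. Lp_norm p M (\<lambda>x. u n x - f x)) \<longlonglongrightarrow> 0"
  shows "descends p f"
proof -
  obtain \<eta> where \<eta>: "\<And>n. \<eta> n \<in> Lp_space p N" "\<And>n. AE x in M. ext (\<eta> n) x = u n x"
    using u(2) unfolding descends_def by metis
  obtain r :: "nat \<Rightarrow> nat" where r: "AE x in M. (\<lambda>n. u (r n) x) \<longlonglongrightarrow> f x"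
    using Lp_convergence_AE_subseq[OF p u(1) f lim] by blast
  define \<zeta> where "\<zeta> x = lim (\<lambda>n. \<eta> (r n) x)" for x
  have [measurable]: "\<eta> n \<in> borel_measurable N" for n
    by (rule Lp_space_measurable[OF \<eta>(1)])
  have \<zeta>: "\<zeta> \<in> borel_measurable N"
    unfolding \<zeta>_def by measurable
  have "AE x in M. \<forall>n. ext (\<eta> n) x = u n x"
    using \<eta>(2) by (simp add: AE_all_countable)
  with r have ae: "AE x in M. ext \<zeta> x = f x"
  proof eventually_elim
    case (elim x)
    then have l: "(\<lambda>n. ext (\<eta> (r n)) x) \<longlonglongrightarrow> f x" by simp
    show ?case
    proof (cases "x \<in> Y")
      case True
      then show ?thesis using l by (simp add: ext_def \<zeta>_def limI)
    next
      case False
      then show ?thesis using l LIMSEQ_unique[OF l, of 0] by (simp add: ext_def)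
    qed
  qed
  have "ext \<zeta> \<in> Lp_space p M"
  proof (rule Lp_space_cong_AE[OF f ext_measurable[OF \<zeta>]])
    show "AE x in M. f x = ext \<zeta> x" using ae by eventually_elim simp
  qed
  then have "\<zeta> \<in> Lp_space p N" using ext_in_Lp_iff[OF \<zeta>] by simp
  with ae show ?thesis by (auto simp: descends_def)
qed

text \<open>
  The support of \<open>f\<close> is the union of its level sets, so it lies in \<open>Y\<close> and belongs to the generated
  \<open>\<sigma>\<close>-algebra. The preimage of a basic open set consists of level sets and, if the open set
  contains zero, of the complement of the support in \<open>Y\<close>.
\<close>
lemma level_sets_descend:
  assumes \<B>: "countable \<B>" "topological_basis \<B>" and sub: "level_sets M \<B> f \<subseteq> \<S>"
    and f: "f \<in> Lp_space p M"
  shows "f \<in> Lp_space p N" "descends p f" "AE x in M. ext f x = f x"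
proof -
  have level: "{x \<in> space M. f x \<in> B \<and> 1 / real (Suc n) < cmod (f x)} \<in> \<S>" if "B \<in> \<B>" for B n
    using sub that by (auto simp: level_sets_def)
  define L where "L B = (\<Union>n. {x \<in> space M. f x \<in> B \<and> 1 / real (Suc n) < cmod (f x)})" for B
  have L_eq: "L B = {x \<in> space M. f x \<in> B \<and> f x \<noteq> 0}" for B
  proof -
    have "\<exists>n. 1 / real (Suc n) < cmod z" if "z \<noteq> 0" for z :: complex
      using that nat_approx_posE[of "cmod z"] by auto
    then show ?thesis by (fastforce simp: L_def)
  qed
  have L_N: "L B \<in> sets N" if "B \<in> \<B>" for B
    unfolding L_def sets_N using level[OF that]
    by (intro sigma_sets.Union) (auto intro: sigma_sets.Basic)
  have L_Y: "L B \<subseteq> Y" if "B \<in> \<B>" for B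
    using sets_N_D(2)[OF L_N[OF that]] .
  have support: "{x \<in> space M. f x \<noteq> 0} = (\<Union>B\<in>\<B>. L B)"
  proof -
    have "\<exists>B\<in>\<B>. z \<in> B" for z :: complex
      using topological_basisE[OF \<B>(2) open_UNIV, of z] by auto
    then show ?thesis by (auto simp: L_eq)
  qed
  have support_N: "{x \<in> space M. f x \<noteq> 0} \<in> sets N"
    unfolding support using L_N \<B>(1) by (intro sets.countable_UN') auto
  have off: "f x = 0" if "x \<in> space M" "x \<notin> Y" for x
    using that support L_Y by blast
  have meas: "f \<in> borel_measurable N"
    unfolding borel_eq_countable_basis[OF \<B>]
  proof (rule measurable_measure_of)
    fix B assume B: "B \<in> \<B>"
    have "f -` B \<inter> space N = L B \<union> (if 0 \<in> B then space N - {x \<in> space M. f x \<noteq> 0} else {})"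
      using L_Y[OF B] Y_subset by (auto simp: L_eq)
    then show "f -` B \<inter> space N \<in> sets N" using L_N[OF B] sets.compl_sets[OF support_N] by auto
  qed auto
  have eq: "ext f x = f x" if "x \<in> space M" for x using off[OF that] by (simp add: ext_def)
  then show ae: "AE x in M. ext f x = f x" by (intro AE_I2)
  have "ext f \<in> Lp_space p M"
    by (rule Lp_space_cong_AE[OF f ext_measurable[OF meas]]) (use eq in auto)
  then show "f \<in> Lp_space p N" using ext_in_Lp_iff[OF meas] by simp
  with ae show "descends p f" by (auto simp: descends_def)
qed

end

lemma Lp_rep_diff:
  assumes \<pi>: "Lp_rep p M \<pi>" and \<xi>: "\<xi> \<in> Lp_space p M"
  shows "AE x in M. \<pi> (a - b) \<xi> x = \<pi> a \<xi> x - \<pi> b \<xi> x"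
  using Lp_rep_add[OF \<pi> \<xi>, of "a - b" b] by eventually_elim simp

locale reducing_set_system = countable_set_system M \<S>
  for M :: "'x measure" and \<S> +
  fixes p :: real and \<pi> :: "'a::complex_banach_algebra \<Rightarrow> ('x \<Rightarrow> complex) \<Rightarrow> 'x \<Rightarrow> complex"
    and Q :: "'a set" and \<B> :: "complex set set"
  assumes p: "1 \<le> p" and contractive: "contractive_Lp_rep p M \<pi>"
    and dense_Q: "closure Q = UNIV"
    and basis: "countable \<B>" "topological_basis \<B>"
    and invariant: "\<And>A q. A \<in> \<S> \<Longrightarrow> q \<in> Q \<Longrightarrow> level_sets M \<B> (\<pi> q (indicator A)) \<subseteq> \<S>"
begin

lemma rep: "Lp_rep p M \<pi>"
  using contractive by (simp add: contractive_Lp_rep_def)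

lemmas operator = Lp_rep_operator[OF rep]
lemmas rep_closed = Lp_operator_closed[OF operator]
lemmas rep_norm = contractive_Lp_rep_norm[OF p contractive]

text \<open>
  For \<open>a\<close> in the dense set \<open>Q\<close> this is how \<open>\<S>\<close> was closed up; the general case follows because the
  functions that descend are closed in norm.
\<close>
lemma rep_indicator_descends:
  assumes S: "S \<in> \<S>"
  shows "descends p (\<pi> a (indicator S))"
proof -
  have ind: "indicator S \<in> Lp_space p M"
    using S \<S>_fmeasurable p by (intro indicator_in_Lp_space) (auto simp: fmeasurable_def)
  obtain q where q: "\<And>n. q n \<in> Q" "q \<longlonglongrightarrow> a"
    using dense_Q closure_sequential[of a Q] by auto
  have le: "Lp_norm p M (\<lambda>x. \<pi> (q n) (indicator S) x - \<pi> a (indicator S) x) \<le>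
      norm (q n - a) * Lp_norm p M (indicator S)" for n
  proof -
    have "AE x in M. \<pi> (q n) (indicator S) x - \<pi> a (indicator S) x = \<pi> (q n - a) (indicator S) x"
      using Lp_rep_diff[OF rep ind, of "q n" a] by eventually_elim simp
    then have "Lp_norm p M (\<lambda>x. \<pi> (q n) (indicator S) x - \<pi> a (indicator S) x) =
        Lp_norm p M (\<pi> (q n - a) (indicator S))"
      by (rule Lp_norm_cong_AE[rotated 2])
        (intro Lp_space_measurable[of _ p] Lp_diff[OF p] rep_closed ind)+
    then show ?thesis using rep_norm[OF ind] by simp
  qed
  have "(\<lambda>n. q n - a) \<longlonglongrightarrow> 0" using LIM_zero[OF q(2)] .
  then have "(\<lambda>n. norm (q n - a) * Lp_norm p M (indicator S)) \<longlonglongrightarrow> 0"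
    by (intro tendsto_mult_left_zero tendsto_norm_zero)
  then have lim: "(\<lambda>n. Lp_norm p M (\<lambda>x. \<pi> (q n) (indicator S) x - \<pi> a (indicator S) x)) \<longlonglongrightarrow> 0"
    by (rule tendsto_sandwich[OF _ _ tendsto_const, rotated -1]) (use le in auto)
  show ?thesis
  proof (rule descends_limit[OF p rep_closed[OF ind] _ _ lim])
    show "descends p (\<pi> (q n) (indicator S))" for n
      by (rule level_sets_descend(2)[OF basis invariant[OF S q(1)] rep_closed[OF ind]])
  qed (rule rep_closed[OF ind])
qed

lemma rep_ext_descends:
  assumes "\<xi> \<in> Lp_space p N"
  shows "descends p (\<pi> a (ext \<xi>))"
  using p assms
proof (induction \<xi> rule: Lp_dense_induct)
  case (indicator S)
  then show ?case using rep_indicator_descends \<S>_Pow by (subst ext_indicator) auto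
next
  case (add \<xi> \<eta>)
  have "AE x in M. \<pi> a (ext \<xi>) x + \<pi> a (ext \<eta>) x = \<pi> a (ext (\<lambda>x. \<xi> x + \<eta> x)) x"
    unfolding ext_add
    using Lp_operator_add[OF operator[of a] ext_in_Lp[OF add(1)] ext_in_Lp[OF add(2)]]
    by eventually_elim simp
  with descends_add[OF p add(3,4)] show ?case by (rule descends_cong)
next
  case (scale c \<xi>)
  have "AE x in M. c * \<pi> a (ext \<xi>) x = \<pi> a (ext (\<lambda>x. c * \<xi> x)) x"
    unfolding ext_scale
    using Lp_operator_scale[OF operator[of a] ext_in_Lp[OF scale(1)], of c]
    by eventually_elim simp
  with descends_scale[OF scale(2)] show ?case by (rule descends_cong)
next
  case (limit u \<xi>)
  note E = ext_in_Lp[OF limit(1)] ext_in_Lp[OF limit(2)]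
  have le: "Lp_norm p M (\<lambda>x. \<pi> a (ext (u n)) x - \<pi> a (ext \<xi>) x) \<le>
      norm a * Lp_norm p N (\<lambda>x. u n x - \<xi> x)" for n
  proof -
    have D: "(\<lambda>x. ext (u n) x - ext \<xi> x) \<in> Lp_space p M" by (intro Lp_diff p E)
    have "AE x in M. \<pi> a (ext (u n)) x - \<pi> a (ext \<xi>) x = \<pi> a (\<lambda>x. ext (u n) x - ext \<xi> x) x"
      using Lp_operator_diff[OF operator[of a] E(1)[of n] E(2)] by eventually_elim simp
    then have "Lp_norm p M (\<lambda>x. \<pi> a (ext (u n)) x - \<pi> a (ext \<xi>) x) =
        Lp_norm p M (\<pi> a (\<lambda>x. ext (u n) x - ext \<xi> x))"
      by (rule Lp_norm_cong_AE[rotated 2])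
        (intro Lp_space_measurable[of _ p] Lp_diff[OF p] rep_closed E)+
    also have "\<dots> \<le> norm a * Lp_norm p M (\<lambda>x. ext (u n) x - ext \<xi> x)" by (rule rep_norm[OF D])
    also have "Lp_norm p M (\<lambda>x. ext (u n) x - ext \<xi> x) = Lp_norm p N (\<lambda>x. u n x - \<xi> x)"
      unfolding ext_diff[symmetric]
      by (intro Lp_norm_ext Lp_space_measurable[OF Lp_diff[OF p limit(1,2)]])
    finally show ?thesis .
  qed
  have "(\<lambda>n. norm a * Lp_norm p N (\<lambda>x. u n x - \<xi> x)) \<longlonglongrightarrow> 0"
    using limit(3) by (intro tendsto_mult_right_zero)
  then have lim: "(\<lambda>n. Lp_norm p M (\<lambda>x. \<pi> a (ext (u n)) x - \<pi> a (ext \<xi>) x)) \<longlonglongrightarrow> 0"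
    by (rule tendsto_sandwich[OF _ _ tendsto_const, rotated -1]) (use le in auto)
  show ?case by (rule descends_limit[OF p rep_closed[OF E(2)] rep_closed[OF E(1)] limit(4) lim])
qed

text \<open>
  Operators are maps on functions, while only the class of \<open>\<pi> a (ext \<xi>)\<close> comes from $L^p(N)$; so a
  representative that is measurable on \<open>N\<close> has to be chosen.
\<close>
definition reduced_rep :: "'a \<Rightarrow> ('x \<Rightarrow> complex) \<Rightarrow> 'x \<Rightarrow> complex"
  where "reduced_rep a \<xi> =
    (SOME \<eta>. \<eta> \<in> Lp_space p N \<and> (AE x in M. ext \<eta> x = \<pi> a (ext \<xi>) x))"

lemma
  assumes "\<xi> \<in> Lp_space p N"
  shows reduced_rep_closed: "reduced_rep a \<xi> \<in> Lp_space p N"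
    and ext_reduced_rep: "AE x in M. ext (reduced_rep a \<xi>) x = \<pi> a (ext \<xi>) x"
proof -
  have "\<exists>\<eta>. \<eta> \<in> Lp_space p N \<and> (AE x in M. ext \<eta> x = \<pi> a (ext \<xi>) x)"
    using rep_ext_descends[OF assms, of a] by (auto simp: descends_def)
  from someI_ex[OF this]
  show "reduced_rep a \<xi> \<in> Lp_space p N" "AE x in M. ext (reduced_rep a \<xi>) x = \<pi> a (ext \<xi>) x"
    by (auto simp: reduced_rep_def)
qed

lemma AE_N_if_ext:
  assumes "\<xi> \<in> Lp_space p N" "\<eta> \<in> Lp_space p N" "AE x in M. ext \<xi> x = ext \<eta> x"
  shows "AE x in N. \<xi> x = \<eta> x"
  using AE_ext_iff[OF Lp_space_measurable[OF assms(1)] Lp_space_measurable[OF assms(2)]] assms(3)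
  by simp

lemma Lp_norm_reduced_rep:
  assumes \<xi>: "\<xi> \<in> Lp_space p N"
  shows "Lp_norm p N (reduced_rep a \<xi>) = Lp_norm p M (\<pi> a (ext \<xi>))"
proof -
  note meas = Lp_space_measurable[OF reduced_rep_closed[OF \<xi>]]
  have "Lp_norm p N (reduced_rep a \<xi>) = Lp_norm p M (ext (reduced_rep a \<xi>))"
    by (rule Lp_norm_ext[OF meas, symmetric])
  also have "\<dots> = Lp_norm p M (\<pi> a (ext \<xi>))"
    by (intro Lp_norm_cong_AE ext_measurable meas ext_reduced_rep \<xi>
        Lp_space_measurable[OF rep_closed[OF ext_in_Lp[OF \<xi>]]])
  finally show ?thesis .
qed

lemma reduced_rep_norm_le:
  assumes \<xi>: "\<xi> \<in> Lp_space p N"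
  shows "Lp_norm p N (reduced_rep a \<xi>) \<le> norm a * Lp_norm p N \<xi>"
  using rep_norm[OF ext_in_Lp[OF \<xi>], of a] Lp_norm_ext[OF Lp_space_measurable[OF \<xi>]]
  by (simp add: Lp_norm_reduced_rep[OF \<xi>])

lemma reduced_rep_operator: "Lp_operator p N (reduced_rep a)"
  unfolding Lp_operator_def
proof (intro conjI ballI allI impI)
  fix \<xi> \<eta> assume \<xi>: "\<xi> \<in> Lp_space p N" and \<eta>: "\<eta> \<in> Lp_space p N"
  show "AE x in N. reduced_rep a \<xi> x = reduced_rep a \<eta> x" if "AE x in N. \<xi> x = \<eta> x"
  proof (intro AE_N_if_ext reduced_rep_closed \<xi> \<eta>)
    have "AE x in M. ext \<xi> x = ext \<eta> x"
      using that AE_ext_iff[OF Lp_space_measurable[OF \<xi>] Lp_space_measurable[OF \<eta>]] by simp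
    from Lp_operator_cong[OF operator ext_in_Lp[OF \<xi>] ext_in_Lp[OF \<eta>] this, of a]
      ext_reduced_rep[OF \<xi>, of a] ext_reduced_rep[OF \<eta>, of a]
    show "AE x in M. ext (reduced_rep a \<xi>) x = ext (reduced_rep a \<eta>) x"
      by eventually_elim simp
  qed
  show "AE x in N. reduced_rep a (\<lambda>y. \<xi> y + \<eta> y) x = reduced_rep a \<xi> x + reduced_rep a \<eta> x"
  proof (intro AE_N_if_ext Lp_add[OF p] reduced_rep_closed \<xi> \<eta>)
    from Lp_operator_add[OF operator[of a] ext_in_Lp[OF \<xi>] ext_in_Lp[OF \<eta>]]
      ext_reduced_rep[OF \<xi>, of a] ext_reduced_rep[OF \<eta>, of a]
      ext_reduced_rep[OF Lp_add[OF p \<xi> \<eta>], of a]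
    show "AE x in M. ext (reduced_rep a (\<lambda>y. \<xi> y + \<eta> y)) x =
        ext (\<lambda>x. reduced_rep a \<xi> x + reduced_rep a \<eta> x) x"
      by eventually_elim (simp add: ext_add)
  qed
next
  fix c \<xi> assume \<xi>: "\<xi> \<in> Lp_space p N"
  show "AE x in N. reduced_rep a (\<lambda>y. c * \<xi> y) x = c * reduced_rep a \<xi> x"
  proof (intro AE_N_if_ext Lp_scale reduced_rep_closed \<xi>)
    from Lp_operator_scale[OF operator[of a] ext_in_Lp[OF \<xi>], of c]
      ext_reduced_rep[OF \<xi>, of a] ext_reduced_rep[OF Lp_scale[OF \<xi>, of c], of a]
    show "AE x in M. ext (reduced_rep a (\<lambda>y. c * \<xi> y)) x = ext (\<lambda>x. c * reduced_rep a \<xi> x) x"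
      by eventually_elim (simp add: ext_scale)
  qed
next
  show "\<exists>K. \<forall>\<xi>\<in>Lp_space p N. Lp_norm p N (reduced_rep a \<xi>) \<le> K * Lp_norm p N \<xi>"
    using reduced_rep_norm_le by blast
qed (rule reduced_rep_closed)

lemma contractive_reduced_rep: "contractive_Lp_rep p N reduced_rep"
proof -
  have opnorm: "Lp_opnorm p N (reduced_rep a) \<le> norm a" for a
  proof (rule Lp_opnorm_leI)
    fix \<xi> assume \<xi>: "\<xi> \<in> Lp_space p N" "Lp_norm p N \<xi> \<le> 1"
    have "norm a * Lp_norm p N \<xi> \<le> norm a" using \<xi>(2) by (simp add: mult_left_le)
    then show "Lp_norm p N (reduced_rep a \<xi>) \<le> norm a"
      using reduced_rep_norm_le[OF \<xi>(1), of a] by linarith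
  qed
  have "AE x in N. reduced_rep (a + b) \<xi> x = reduced_rep a \<xi> x + reduced_rep b \<xi> x"
    if \<xi>: "\<xi> \<in> Lp_space p N" for a b \<xi>
  proof (intro AE_N_if_ext Lp_add[OF p] reduced_rep_closed \<xi>)
    from Lp_rep_add[OF rep ext_in_Lp[OF \<xi>], of a b] ext_reduced_rep[OF \<xi>, of a]
      ext_reduced_rep[OF \<xi>, of b] ext_reduced_rep[OF \<xi>, of "a + b"]
    show "AE x in M. ext (reduced_rep (a + b) \<xi>) x =
        ext (\<lambda>x. reduced_rep a \<xi> x + reduced_rep b \<xi> x) x"
      by eventually_elim (simp add: ext_add)
  qed
  moreover have "AE x in N. reduced_rep (c *\<^sub>C a) \<xi> x = c * reduced_rep a \<xi> x"
    if \<xi>: "\<xi> \<in> Lp_space p N" for c a \<xi>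
  proof (intro AE_N_if_ext Lp_scale reduced_rep_closed \<xi>)
    from Lp_rep_scale[OF rep ext_in_Lp[OF \<xi>], of c a] ext_reduced_rep[OF \<xi>, of a]
      ext_reduced_rep[OF \<xi>, of "c *\<^sub>C a"]
    show "AE x in M. ext (reduced_rep (c *\<^sub>C a) \<xi>) x = ext (\<lambda>x. c * reduced_rep a \<xi> x) x"
      by eventually_elim (simp add: ext_scale)
  qed
  moreover have "AE x in N. reduced_rep (a * b) \<xi> x = reduced_rep a (reduced_rep b \<xi>) x"
    if \<xi>: "\<xi> \<in> Lp_space p N" for a b \<xi>
  proof (intro AE_N_if_ext reduced_rep_closed \<xi>)
    note b = reduced_rep_closed[OF \<xi>, of b]
    from Lp_operator_cong[OF operator ext_in_Lp[OF b] rep_closed[OF ext_in_Lp[OF \<xi>]]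
        ext_reduced_rep[OF \<xi>], of a]
      Lp_rep_mult[OF rep ext_in_Lp[OF \<xi>], of a b] ext_reduced_rep[OF b, of a]
      ext_reduced_rep[OF \<xi>, of "a * b"]
    show "AE x in M. ext (reduced_rep (a * b) \<xi>) x = ext (reduced_rep a (reduced_rep b \<xi>)) x"
      by eventually_elim simp
  qed
  moreover have "\<exists>K. \<forall>a. Lp_opnorm p N (reduced_rep a) \<le> K * norm a"
    using opnorm by (intro exI[of _ 1]) simp
  ultimately have "Lp_rep p N reduced_rep"
    unfolding Lp_rep_def using reduced_rep_operator by blast
  then show ?thesis using opnorm by (simp add: contractive_Lp_rep_def)
qed

end

subsection \<open>Nondegenerate representations of unital algebras\<close>

lemma Lp_operator_sum:
  assumes p: "1 \<le> p" and T: "Lp_operator p M T" and I: "finite I"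
    and \<xi>: "\<And>i. i \<in> I \<Longrightarrow> \<xi> i \<in> Lp_space p M"
  shows "AE x in M. T (\<lambda>y. \<Sum>i\<in>I. \<xi> i y) x = (\<Sum>i\<in>I. T (\<xi> i) x)"
  using I \<xi>
proof (induction I)
  case empty
  then show ?case using Lp_operator_zero[OF T] by simp
next
  case (insert i I)
  have "AE x in M. T (\<lambda>y. \<xi> i y + (\<Sum>i\<in>I. \<xi> i y)) x = T (\<xi> i) x + T (\<lambda>y. \<Sum>i\<in>I. \<xi> i y) x"
    using insert by (intro Lp_operator_add[OF T] Lp_sum[OF p]) auto
  moreover have "AE x in M. T (\<lambda>y. \<Sum>i\<in>I. \<xi> i y) x = (\<Sum>i\<in>I. T (\<xi> i) x)"
    using insert by auto
  ultimately show ?case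
    by eventually_elim (use insert(1,2) in simp)
qed

text \<open>
  \<open>\<pi> 1\<close> fixes every vector \<open>\<pi> a \<xi>\<close>, and these span a dense subspace. Conversely a representation in
  which \<open>1\<close> acts as the identity is nondegenerate for trivial reasons, and this form of the condition
  is the one that passes to the smaller measure space.
\<close>
lemma nondegenerate_rep_one:
  fixes \<pi> :: "'a::unital_complex_banach_algebra \<Rightarrow> ('x \<Rightarrow> complex) \<Rightarrow> 'x \<Rightarrow> complex"
  assumes p: "1 \<le> p" and \<pi>: "contractive_Lp_rep p M \<pi>" and nd: "nondegenerate_Lp_rep p M \<pi>"
    and \<eta>: "\<eta> \<in> Lp_space p M"
  shows "AE x in M. \<pi> 1 \<eta> x = \<eta> x"
proof -
  have rep: "Lp_rep p M \<pi>" using \<pi> by (simp add: contractive_Lp_rep_def)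
  note op = Lp_rep_operator[OF rep]
  let ?d = "\<lambda>x. \<pi> 1 \<eta> x - \<eta> x"
  have d: "?d \<in> Lp_space p M" by (intro Lp_diff p Lp_operator_closed[OF op] \<eta>)
  have bound: "Lp_norm p M ?d \<le> (norm (1 :: 'a) + 1) * e" if e: "0 < e" for e
  proof -
    obtain I c where "finite I \<and> I \<subseteq> UNIV \<times> Lp_space p M \<and>
        Lp_norm p M (\<lambda>x. \<eta> x - (\<Sum>(a, \<xi>)\<in>I. c a \<xi> * \<pi> a \<xi> x)) < e"
      using nd[unfolded nondegenerate_Lp_rep_def, rule_format, OF \<eta> e] by (elim exE)
    then have I: "finite I" "I \<subseteq> UNIV \<times> Lp_space p M"
      and near: "Lp_norm p M (\<lambda>x. \<eta> x - (\<Sum>(a, \<xi>)\<in>I. c a \<xi> * \<pi> a \<xi> x)) < e"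
      by blast+
    define v where "v i = (\<lambda>x. c (fst i) (snd i) * \<pi> (fst i) (snd i) x)" for i
    define \<zeta> where "\<zeta> = (\<lambda>x. \<Sum>i\<in>I. v i x)"
    have near': "Lp_norm p M (\<lambda>x. \<eta> x - \<zeta> x) < e"
      using near by (simp add: \<zeta>_def v_def case_prod_beta)
    have v: "v i \<in> Lp_space p M" if "i \<in> I" for i
      unfolding v_def using that I by (intro Lp_scale Lp_operator_closed[OF op]) auto
    have \<zeta>: "\<zeta> \<in> Lp_space p M" unfolding \<zeta>_def by (intro Lp_sum p I v)
    have fix_v: "AE x in M. \<forall>i\<in>I. \<pi> 1 (v i) x = v i x"
    proof (rule AE_finite_allI[OF I(1)])
      fix i assume "i \<in> I"
      then have i: "snd i \<in> Lp_space p M" using I by auto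
      from Lp_operator_scale[OF op[of 1] Lp_operator_closed[OF op[of "fst i"] i], of "c (fst i) (snd i)"]
        Lp_rep_mult[OF rep i, of 1 "fst i"]
      show "AE x in M. \<pi> 1 (v i) x = v i x"
        unfolding v_def by eventually_elim simp
    qed
    have sum_v: "AE x in M. \<pi> 1 (\<lambda>y. \<Sum>i\<in>I. v i y) x = (\<Sum>i\<in>I. \<pi> 1 (v i) x)"
      by (rule Lp_operator_sum[OF p op I(1) v])
    from fix_v sum_v Lp_operator_diff[OF op[of 1] \<eta> \<zeta>]
    have "AE x in M. ?d x = \<pi> 1 (\<lambda>x. \<eta> x - \<zeta> x) x + (\<zeta> x - \<eta> x)"
      by eventually_elim (simp add: \<zeta>_def)
    then have "Lp_norm p M ?d = Lp_norm p M (\<lambda>x. \<pi> 1 (\<lambda>x. \<eta> x - \<zeta> x) x + (\<zeta> x - \<eta> x))"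
      by (rule Lp_norm_cong_AE[rotated 2])
        (intro Lp_space_measurable[of _ p] Lp_diff[OF p] Lp_add[OF p] Lp_operator_closed[OF op] \<eta> \<zeta>)+
    also have "\<dots> \<le> Lp_norm p M (\<pi> 1 (\<lambda>x. \<eta> x - \<zeta> x)) + Lp_norm p M (\<lambda>x. \<zeta> x - \<eta> x)"
      by (intro Lp_norm_triangle p Lp_diff Lp_operator_closed[OF op] \<eta> \<zeta>)
    also have "\<dots> \<le> norm (1 :: 'a) * Lp_norm p M (\<lambda>x. \<eta> x - \<zeta> x) + Lp_norm p M (\<lambda>x. \<eta> x - \<zeta> x)"
      using contractive_Lp_rep_norm[OF p \<pi> Lp_diff[OF p \<eta> \<zeta>], of 1]
      by (simp add: Lp_norm_minus_commute[of p M \<zeta> \<eta>])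
    also have "\<dots> = (norm (1 :: 'a) + 1) * Lp_norm p M (\<lambda>x. \<eta> x - \<zeta> x)"
      by (simp add: distrib_right)
    also have "\<dots> \<le> (norm (1 :: 'a) + 1) * e"
      using near' by (intro mult_left_mono) (auto simp: add_nonneg_nonneg)
    finally show ?thesis .
  qed
  have "Lp_norm p M ?d \<le> 0"
  proof (rule field_le_epsilon)
    fix e :: real assume "0 < e"
    then have "Lp_norm p M ?d \<le> (norm (1 :: 'a) + 1) * (e / (norm (1 :: 'a) + 1))"
      by (intro bound divide_pos_pos) (auto simp: add_nonneg_pos)
    then show "Lp_norm p M ?d \<le> 0 + e"
      by (simp add: add_nonneg_pos[THEN less_imp_neq, symmetric])
  qed
  then have "Lp_norm p M ?d = 0" using Lp_norm_nonneg[of p M ?d] by linarith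
  from AE_zero_if_Lp_norm_zero[OF _ d this] p show ?thesis by simp
qed

lemma nondegenerate_if_rep_one:
  fixes \<pi> :: "'a::unital_complex_banach_algebra \<Rightarrow> ('x \<Rightarrow> complex) \<Rightarrow> 'x \<Rightarrow> complex"
  assumes p: "1 \<le> p" and rep: "Lp_rep p M \<pi>"
    and one: "\<And>\<eta>. \<eta> \<in> Lp_space p M \<Longrightarrow> AE x in M. \<pi> 1 \<eta> x = \<eta> x"
  shows "nondegenerate_Lp_rep p M \<pi>"
  unfolding nondegenerate_Lp_rep_def
proof (intro ballI allI impI)
  fix \<eta> and e :: real assume \<eta>: "\<eta> \<in> Lp_space p M" and e: "0 < e"
  have "AE x in M. \<eta> x - \<pi> 1 \<eta> x = 0" using one[OF \<eta>] by eventually_elim simp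
  then have "Lp_norm p M (\<lambda>x. \<eta> x - \<pi> 1 \<eta> x) = Lp_norm p M (\<lambda>x. 0)"
    by (rule Lp_norm_cong_AE[rotated 2])
      (intro Lp_space_measurable[of _ p] Lp_diff[OF p] Lp_operator_closed[OF Lp_rep_operator[OF rep]]
        \<eta> zero_in_Lp_space)+
  then show "\<exists>I c. finite I \<and> I \<subseteq> UNIV \<times> Lp_space p M \<and>
       Lp_norm p M (\<lambda>x. \<eta> x - (\<Sum>(a, \<xi>)\<in>I. c a \<xi> * \<pi> a \<xi> x)) < e"
    using \<eta> e by (intro exI[of _ "{(1, \<eta>)}"] exI[of _ "\<lambda>_ _. 1"]) simp
qed

text \<open>
  An isometric representation of a separable algebra may live on a measure space that is far from
  \<open>\<sigma>\<close>-finite. Given one vector, a countable family of sets of finite measure is closed up under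
  intersections and under taking level sets of \<open>\<pi> q\<close> applied to indicators, with \<open>q\<close> in a countable
  dense set. The representation restricts to the $L^p$ space of the generated \<open>\<sigma>\<close>-algebra, which is
  \<open>\<sigma>\<close>-finite and contains the given vector. Restricting only to a \<open>\<sigma>\<close>-finite part of the space
  would not be enough, because $L^p$ of a finite measure space can be nonseparable.
\<close>
lemma admissible_rep_approximates:
  fixes \<pi> :: "'a::unital_complex_banach_algebra \<Rightarrow> ('x \<Rightarrow> complex) \<Rightarrow> 'x \<Rightarrow> complex"
  assumes p: "1 \<le> p" and sep: "separable_space (euclidean :: 'a topology)"
    and iso: "isometric_Lp_rep p M \<pi>" and nd: "nondegenerate_Lp_rep p M \<pi>" and e: "0 < e"
  obtains N :: "'x measure" and \<pi>' :: "'a \<Rightarrow> ('x \<Rightarrow> complex) \<Rightarrow> 'x \<Rightarrow> complex"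
  where "admissible_rep p N \<pi>'" "norm a - e < Lp_opnorm p N (\<pi>' a)"
proof -
  have p0: "0 < p" using p by simp
  have con: "contractive_Lp_rep p M \<pi>" and rep: "Lp_rep p M \<pi>"
    using iso by (auto simp: contractive_Lp_rep_def isometric_Lp_rep_def)
  have "\<exists>\<xi>. \<xi> \<in> Lp_space p M \<and> Lp_norm p M \<xi> \<le> 1 \<and> norm a - e / 2 < Lp_norm p M (\<pi> a \<xi>)"
  proof (rule ccontr)
    assume "\<not> ?thesis"
    then have "Lp_opnorm p M (\<pi> a) \<le> norm a - e / 2"
      by (intro Lp_opnorm_leI) (simp add: not_less)
    then show False using iso e by (simp add: isometric_Lp_rep_def)
  qed
  then obtain \<xi> where \<xi>: "\<xi> \<in> Lp_space p M" "Lp_norm p M \<xi> \<le> 1"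
    "norm a - e / 2 < Lp_norm p M (\<pi> a \<xi>)"
    by (elim exE conjE)
  obtain Q :: "'a set" where Q: "countable Q" "closure Q = UNIV"
    using sep by (auto simp: separable_space_def)
  obtain \<B> :: "complex set set" where \<B>: "countable \<B>" "topological_basis \<B>"
    using ex_countable_basis by blast
  have count_level: "countable (level_sets M \<B> f)" for f
    using \<B>(1) by (simp add: level_sets_def)
  \<comment> \<open>The empty set only makes sure that the family is nonempty.\<close>
  obtain T where T: "countable T" "insert {} (level_sets M \<B> \<xi>) \<subseteq> T"
    "\<And>A. A \<in> T \<Longrightarrow> (\<Union>q\<in>Q. level_sets M \<B> (\<pi> q (indicator A))) \<subseteq> T"
    "\<And>A B. A \<in> T \<Longrightarrow> B \<in> T \<Longrightarrow> A \<inter> B \<in> T"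
  proof (rule countable_closed_superset[of "insert {} (level_sets M \<B> \<xi>)"
        "\<lambda>A. \<Union>q\<in>Q. level_sets M \<B> (\<pi> q (indicator A))" "(\<inter>)"])
    show "countable (insert {} (level_sets M \<B> \<xi>))" using count_level by simp
    show "countable (\<Union>q\<in>Q. level_sets M \<B> (\<pi> q (indicator A)))" for A
      using count_level Q(1) by (intro countable_UN)
  qed (rule that)
  \<comment> \<open>Intersecting with the sets of finite measure keeps the closure properties of \<open>T\<close>.\<close>
  define \<S> where "\<S> = T \<inter> fmeasurable M"
  interpret reducing_set_system M \<S> p \<pi> Q \<B>
  proof
    show "countable \<S>" using T(1) by (auto simp: \<S>_def)
    show "Int_stable \<S>" using T(4) by (auto simp: Int_stable_def \<S>_def)
    show "\<S> \<noteq> {}" using T(2) by (auto simp: \<S>_def)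
    show "level_sets M \<B> (\<pi> q (indicator A)) \<subseteq> \<S>" if "A \<in> \<S>" "q \<in> Q" for A q
    proof -
      have "indicator A \<in> Lp_space p M"
        using that(1) p0 by (intro indicator_in_Lp_space) (auto simp: \<S>_def fmeasurable_def)
      then have "\<pi> q (indicator A) \<in> Lp_space p M"
        by (rule Lp_operator_closed[OF Lp_rep_operator[OF rep]])
      from level_sets_fmeasurable[OF this \<B>(2) p0] T(3)[of A] that show ?thesis
        by (auto simp: \<S>_def)
    qed
  qed (use p con Q \<B> in \<open>auto simp: \<S>_def\<close>)
  have "level_sets M \<B> \<xi> \<subseteq> \<S>"
    using T(2) level_sets_fmeasurable[OF \<xi>(1) \<B>(2) p0] by (auto simp: \<S>_def)
  note \<xi>_N = level_sets_descend(1,3)[OF \<B> this \<xi>(1)]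
  have norm_\<xi>: "Lp_norm p N \<xi> \<le> 1"
    using \<xi>(2) Lp_norm_cong_AE[OF ext_measurable Lp_space_measurable[OF \<xi>(1)] \<xi>_N(2), of p]
      Lp_space_measurable[OF \<xi>_N(1)] Lp_norm_ext[of \<xi> p] by simp
  have "Lp_norm p N (reduced_rep a \<xi>) = Lp_norm p M (\<pi> a (ext \<xi>))"
    by (rule Lp_norm_reduced_rep[OF \<xi>_N(1)])
  also have "\<dots> = Lp_norm p M (\<pi> a \<xi>)"
    by (intro Lp_norm_cong_AE Lp_operator_cong[OF operator] ext_in_Lp \<xi> \<xi>_N
        Lp_space_measurable[OF rep_closed])
  finally have "norm a - e / 2 < Lp_norm p N (reduced_rep a \<xi>)" using \<xi>(3) by simp
  moreover have "Lp_norm p N (reduced_rep a \<xi>) \<le> Lp_opnorm p N (reduced_rep a)"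
    by (rule Lp_opnorm_upper[OF reduced_rep_norm_le \<xi>_N(1) norm_\<xi>])
  ultimately have close: "norm a - e < Lp_opnorm p N (reduced_rep a)" using e by linarith
  have "nondegenerate_Lp_rep p N reduced_rep"
  proof (rule nondegenerate_if_rep_one[OF p])
    show "Lp_rep p N reduced_rep"
      using contractive_reduced_rep by (simp add: contractive_Lp_rep_def)
    fix \<eta> assume \<eta>: "\<eta> \<in> Lp_space p N"
    from nondegenerate_rep_one[OF p con nd ext_in_Lp[OF \<eta>]] ext_reduced_rep[OF \<eta>, of 1]
    have "AE x in M. ext (reduced_rep 1 \<eta>) x = ext \<eta> x" by eventually_elim simp
    then show "AE x in N. reduced_rep 1 \<eta> x = \<eta> x"
      by (intro AE_N_if_ext reduced_rep_closed \<eta>)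
  qed
  then have "admissible_rep p N reduced_rep"
    using sigma_finite_N contractive_reduced_rep by (simp add: admissible_rep_def)
  with close that show thesis by blast
qed

lemma norm_one_le:
  fixes \<pi> :: "'a::unital_complex_banach_algebra \<Rightarrow> ('x \<Rightarrow> complex) \<Rightarrow> 'x \<Rightarrow> complex"
  assumes p: "1 \<le> p" and iso: "isometric_Lp_rep p M \<pi>" and nd: "nondegenerate_Lp_rep p M \<pi>"
  shows "norm (1 :: 'a) \<le> 1"
proof -
  have con: "contractive_Lp_rep p M \<pi>" and rep: "Lp_rep p M \<pi>"
    using iso by (auto simp: contractive_Lp_rep_def isometric_Lp_rep_def)
  have "Lp_opnorm p M (\<pi> 1) \<le> 1"
  proof (rule Lp_opnorm_leI)
    fix \<xi> assume \<xi>: "\<xi> \<in> Lp_space p M" "Lp_norm p M \<xi> \<le> 1"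
    have "Lp_norm p M (\<pi> 1 \<xi>) = Lp_norm p M \<xi>"
      using \<xi>(1) by (intro Lp_norm_cong_AE nondegenerate_rep_one[OF p con nd] Lp_space_measurable[of _ p]
          Lp_operator_closed[OF Lp_rep_operator[OF rep]])
    then show "Lp_norm p M (\<pi> 1 \<xi>) \<le> 1" using \<xi>(2) by simp
  qed
  then show ?thesis using iso by (simp add: isometric_Lp_rep_def)
qed


section \<open>Traces on the reduced crossed product\<close>

text \<open>
  The element written $a u_g$ in $C_c(G,A,\alpha)$. Finite sums of such elements exhaust
  $C_c(G,A,\alpha)$, so every identity that is additive and continuous needs to be checked on them
  only, and products need to be computed for them only.
\<close>
definition single :: "'g \<Rightarrow> 'a::zero \<Rightarrow> 'g \<Rightarrow> 'a"
  where "single g a = (\<lambda>h. if h = g then a else 0)"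

lemma single_same [simp]: "single g a g = a"
  by (simp add: single_def)

lemma single_zero [simp]: "single g 0 = (\<lambda>h. 0)"
  by (simp add: single_def fun_eq_iff)

lemma single_in_Cc: "g \<in> carrier G \<Longrightarrow> single g a \<in> Cc G"
  by (auto simp: single_def Cc_def)

lemma zero_in_Cc [simp]: "(\<lambda>g. 0) \<in> Cc G"
  by (simp add: Cc_def)

lemma Cc_add:
  fixes a b :: "'g \<Rightarrow> 'a::monoid_add"
  assumes "a \<in> Cc G" "b \<in> Cc G"
  shows "(\<lambda>g. a g + b g) \<in> Cc G"
proof -
  have "{g. a g + b g \<noteq> 0} \<subseteq> {g. a g \<noteq> 0} \<union> {g. b g \<noteq> 0}" by auto
  then show ?thesis using assms by (auto simp: Cc_def intro: finite_subset)
qed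

lemma Cc_sum:
  fixes F :: "'i \<Rightarrow> 'g \<Rightarrow> 'a::comm_monoid_add"
  assumes "finite I" "\<And>i. i \<in> I \<Longrightarrow> F i \<in> Cc G"
  shows "(\<lambda>g. \<Sum>i\<in>I. F i g) \<in> Cc G"
  using assms by (induction I) (auto intro!: Cc_add)

lemma scaleC_zero_right [simp]: "c *\<^sub>C (0 :: 'a::complex_banach_algebra) = 0"
  using norm_scaleC[of c "0 :: 'a"] by simp

lemma Cc_scaleC:
  fixes a :: "'g \<Rightarrow> 'a::complex_banach_algebra"
  assumes "a \<in> Cc G"
  shows "(\<lambda>g. c *\<^sub>C a g) \<in> Cc G"
proof -
  have "{g. c *\<^sub>C a g \<noteq> 0} \<subseteq> {g. a g \<noteq> 0}" by auto
  then show ?thesis using assms by (auto simp: Cc_def intro: finite_subset)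
qed

lemma bounded_linear_scaleC: "bounded_linear (\<lambda>x :: 'a::complex_banach_algebra. c *\<^sub>C x)"
  by (rule bounded_linear_intro[of _ "cmod c"])
    (simp_all add: scaleC_add_right scaleR_scaleC scaleC_scaleC norm_scaleC mult.commute)

lemma bounded_clinearI:
  fixes T :: "'a::complex_banach_algebra \<Rightarrow> 'b::complex_banach_algebra"
  assumes "\<And>x y. T (x + y) = T x + T y" "\<And>c x. T (c *\<^sub>C x) = c *\<^sub>C T x"
    and "\<And>x. norm (T x) \<le> norm x * K"
  shows "bounded_clinear T"
  unfolding bounded_clinear_def
  by (intro conjI allI bounded_linear_intro[of _ K] assms) (simp_all add: scaleR_scaleC assms)

lemma
  assumes "bounded_clinear T"
  shows bounded_clinear_linear: "bounded_linear T"
    and bounded_clinear_scale: "T (c *\<^sub>C x) = c *\<^sub>C T x"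
    and bounded_clinear_add: "T (x + y) = T x + T y"
  using assms linear_simps(1)[of T] unfolding bounded_clinear_def by blast+

lemma bounded_clinear_compose:
  assumes "bounded_clinear S" "bounded_clinear T"
  shows "bounded_clinear (\<lambda>x. S (T x))"
  using assms bounded_linear_compose[of S T] unfolding bounded_clinear_def by auto

lemma
  assumes "is_trace \<tau>"
  shows trace_clinear: "bounded_clinear \<tau>" and trace_commute: "\<tau> (a * b) = \<tau> (b * a)"
  using assms unfolding is_trace_def by blast+

text \<open>
  The unit witnesses that the norm is not smaller than one, which needs the unit to have norm at
  most one.
\<close>
lemma normalized_traceI:
  fixes \<tau> :: "'a::unital_complex_banach_algebra \<Rightarrow> complex"
  assumes tr: "is_trace \<tau>" and le: "\<And>a. cmod (\<tau> a) \<le> norm a" and one: "\<tau> 1 = 1"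
    and norm_one: "norm (1 :: 'a) \<le> 1"
  shows "is_normalized_trace \<tau>"
proof -
  have lin: "bounded_linear \<tau>" by (rule bounded_clinear_linear[OF trace_clinear[OF tr]])
  have upper: "onorm \<tau> \<le> 1" using le by (intro onorm_bound) auto
  have "1 \<le> onorm \<tau> * norm (1 :: 'a)" using onorm[OF lin, of 1] one by simp
  also have "\<dots> \<le> onorm \<tau>" using norm_one onorm_pos_le[OF lin] by (simp add: mult_left_le)
  finally show ?thesis using upper tr one by (simp add: is_normalized_trace_def)
qed

lemma normalized_trace_norm_le:
  assumes "is_normalized_trace \<tau>"
  shows "cmod (\<tau> a) \<le> norm a"
  using onorm[OF bounded_clinear_linear[OF trace_clinear], of \<tau> a] assms
  by (simp add: is_normalized_trace_def)

text \<open>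
  All that the trace theorem uses about the completion: \<open>\<iota>\<close> is a homomorphism with dense range, the
  coefficient at \<open>\<one>\<close> is contractive, and convolution estimates bound the norm.
\<close>
locale crossed_product_completion = isometric_group_action G \<alpha> p
  for G :: "('g, 'm) monoid_scheme" (structure)
    and \<alpha> :: "'g \<Rightarrow> 'a::unital_complex_banach_algebra \<Rightarrow> 'a" and p :: real +
  fixes \<iota> :: "('g \<Rightarrow> 'a) \<Rightarrow> 'b::unital_complex_banach_algebra"
  assumes \<iota>_add: "a \<in> Cc G \<Longrightarrow> b \<in> Cc G \<Longrightarrow> \<iota> (\<lambda>g. a g + b g) = \<iota> a + \<iota> b"
    and \<iota>_scale: "a \<in> Cc G \<Longrightarrow> \<iota> (\<lambda>g. c *\<^sub>C a g) = c *\<^sub>C \<iota> a"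
    and \<iota>_mult: "a \<in> Cc G \<Longrightarrow> b \<in> Cc G \<Longrightarrow> \<iota> (Cc_mult G \<alpha> a b) = \<iota> a * \<iota> b"
    and \<iota>_dense: "closure (\<iota> ` Cc G) = UNIV"
    and coeff_le: "f \<in> Cc G \<Longrightarrow> norm (f \<one>) \<le> norm (\<iota> f)"
    and norm_\<iota>_le: "f \<in> Cc G \<Longrightarrow> convolution_bound f K \<Longrightarrow> norm (\<iota> f) \<le> K"
    and norm_one_le: "norm (1 :: 'a) \<le> 1"
begin

lemma action_unit [simp]:
  assumes "g \<in> carrier G"
  shows "\<alpha> g 1 = 1"
  using action_hom[OF assms, of 1 "\<alpha> (inv g) 1"] by (simp add: action_inv'[OF assms])

lemma Cc_mult_single:
  assumes g: "g \<in> carrier G" and h: "h \<in> carrier G"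
  shows "Cc_mult G \<alpha> (single g a) (single h b) = single (g \<otimes> h) (a * \<alpha> g b)"
proof
  fix k
  show "Cc_mult G \<alpha> (single g a) (single h b) k = single (g \<otimes> h) (a * \<alpha> g b) k"
  proof (cases "k \<in> carrier G")
    case True
    have "Cc_mult G \<alpha> (single g a) (single h b) k =
        (\<Sum>l\<in>{l. single g a l \<noteq> 0}. single g a l * \<alpha> l (single h b (inv l \<otimes> k)))"
      using True by (simp add: Cc_mult_def)
    also have "\<dots> = (\<Sum>l\<in>{g}. single g a l * \<alpha> l (single h b (inv l \<otimes> k)))"
      by (rule sum.mono_neutral_left) (auto simp: single_def)
    also have "\<dots> = a * \<alpha> g (single h b (inv g \<otimes> k))" by simp
    also have "\<dots> = single (g \<otimes> h) (a * \<alpha> g b) k"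
      using g h True inv_solve_left[of "inv g \<otimes> k" g k] by (auto simp: single_def m_assoc[symmetric])
    finally show ?thesis .
  next
    case False
    then show ?thesis using g h by (auto simp: Cc_mult_def single_def)
  qed
qed

lemma \<iota>_single_mult:
  assumes "g \<in> carrier G" "h \<in> carrier G"
  shows "\<iota> (single g a) * \<iota> (single h b) = \<iota> (single (g \<otimes> h) (a * \<alpha> g b))"
  using \<iota>_mult[OF single_in_Cc[OF assms(1)] single_in_Cc[OF assms(2)], of a b]
  by (simp add: Cc_mult_single assms)

lemma \<iota>_zero [simp]: "\<iota> (\<lambda>g. 0) = 0"
  using \<iota>_scale[OF zero_in_Cc, of 0] norm_scaleC[of 0 "\<iota> (\<lambda>g. 0)"] by simp

lemma \<iota>_sum:
  assumes "finite I" "\<And>i. i \<in> I \<Longrightarrow> F i \<in> Cc G"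
  shows "\<iota> (\<lambda>g. \<Sum>i\<in>I. F i g) = (\<Sum>i\<in>I. \<iota> (F i))"
  using assms by (induction I) (auto simp: \<iota>_add Cc_sum)

lemma \<iota>_diff:
  assumes "a \<in> Cc G" "b \<in> Cc G"
  shows "(\<lambda>g. a g - b g) \<in> Cc G" "\<iota> (\<lambda>g. a g - b g) = \<iota> a - \<iota> b"
proof -
  have minus: "(- 1) *\<^sub>C x = - x" for x :: "'c::complex_banach_algebra"
    using scaleR_scaleC[of "- 1" x] by simp
  show "(\<lambda>g. a g - b g) \<in> Cc G" "\<iota> (\<lambda>g. a g - b g) = \<iota> a - \<iota> b"
    using Cc_add[OF assms(1) Cc_scaleC[OF assms(2), of "- 1"]]
      \<iota>_add[OF assms(1) Cc_scaleC[OF assms(2), of "- 1"]] \<iota>_scale[OF assms(2), of "- 1"]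
    by (simp_all add: minus)
qed

lemma Cc_carrier: "f \<in> Cc G \<Longrightarrow> f g \<noteq> 0 \<Longrightarrow> g \<in> carrier G"
  and Cc_finite: "f \<in> Cc G \<Longrightarrow> finite {g. f g \<noteq> 0}"
  by (auto simp: Cc_def)

lemma \<iota>_decompose:
  assumes f: "f \<in> Cc G"
  shows "\<iota> f = (\<Sum>g\<in>{g. f g \<noteq> 0}. \<iota> (single g (f g)))"
proof -
  have "f = (\<lambda>h. \<Sum>g\<in>{g. f g \<noteq> 0}. single g (f g) h)"
    using Cc_finite[OF f] by (auto simp: single_def fun_eq_iff)
  then have "\<iota> f = \<iota> (\<lambda>h. \<Sum>g\<in>{g. f g \<noteq> 0}. single g (f g) h)" by simp
  also have "\<dots> = (\<Sum>g\<in>{g. f g \<noteq> 0}. \<iota> (single g (f g)))"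
    using Cc_finite[OF f] Cc_carrier[OF f] by (intro \<iota>_sum single_in_Cc) auto
  finally show ?thesis .
qed

lemma dense_induct [case_names closed range]:
  assumes "closed {b. P b}" "\<And>f. f \<in> Cc G \<Longrightarrow> P (\<iota> f)"
  shows "P b"
proof -
  have "closure (\<iota> ` Cc G) \<subseteq> {b. P b}"
    using assms by (intro closure_minimal) auto
  then show ?thesis using \<iota>_dense by auto
qed

text \<open>
  The form of density that is used throughout: a closed additive property that holds for the
  elements $a u_g$ holds everywhere.
\<close>
lemma additive_induct:
  assumes "closed {b. P b}" "\<And>g a. g \<in> carrier G \<Longrightarrow> P (\<iota> (single g a))"
    and "P 0" "\<And>x y. P x \<Longrightarrow> P y \<Longrightarrow> P (x + y)"
  shows "P b"
proof (rule dense_induct[OF assms(1)])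
  fix f :: "'g \<Rightarrow> 'a" assume f: "f \<in> Cc G"
  have "P (\<Sum>g\<in>I. \<iota> (single g (f g)))" if "finite I" "I \<subseteq> {g. f g \<noteq> 0}" for I
    using that
  proof (induction I)
    case (insert g I)
    then show ?case using Cc_carrier[OF f] by (auto intro!: assms)
  qed (simp add: assms(3))
  then show "P (\<iota> f)" unfolding \<iota>_decompose[OF f] using Cc_finite[OF f] by blast
qed

text \<open>
  The image of $1 u_e$ is a left unit on the dense image of \<open>\<iota>\<close>, hence everywhere.
\<close>
lemma \<iota>_one: "\<iota> (single \<one> 1) = 1"
proof -
  have "\<iota> (single \<one> 1) * b = b" for b
  proof (induction b rule: additive_induct)
    show "closed {b. \<iota> (single \<one> 1) * b = b}" by (intro closed_Collect_eq continuous_intros)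
  qed (simp_all add: \<iota>_single_mult distrib_left)
  from this[of 1] show ?thesis by simp
qed

lemma norm_\<iota>_single_le:
  assumes "g \<in> carrier G"
  shows "norm (\<iota> (single g a)) \<le> norm a"
  using norm_\<iota>_le[OF single_in_Cc[OF assms] convolution_bound_single[OF assms], of a]
  by (simp add: single_def)

lemma norm_one_crossed_product_le: "norm (1 :: 'b) \<le> 1"
  using norm_\<iota>_single_le[OF one_closed, of 1] norm_one_le by (simp add: \<iota>_one)

lemma single_add: "single g (a + b) = (\<lambda>h. single g a h + single g b h)"
  and single_scaleC: "single g (c *\<^sub>C a) = (\<lambda>h. c *\<^sub>C single g a h)" for a b :: 'a
  by (auto simp: single_def)

lemma bounded_clinear_\<iota>_single: "g \<in> carrier G \<Longrightarrow> bounded_clinear (\<lambda>a. \<iota> (single g a))"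
  by (rule bounded_clinearI[of _ 1])
    (simp_all add: single_add single_scaleC \<iota>_add \<iota>_scale single_in_Cc norm_\<iota>_single_le)

subsection \<open>The conditional expectation\<close>

lemma coeff_dist_le:
  assumes "f \<in> Cc G" "f' \<in> Cc G"
  shows "dist (f \<one>) (f' \<one>) \<le> dist (\<iota> f) (\<iota> f')"
  using coeff_le[OF \<iota>_diff(1)[OF assms]] by (simp add: dist_norm \<iota>_diff(2)[OF assms])

text \<open>
  Taking the coefficient at \<open>\<one>\<close> is well defined and 1-Lipschitz on the range of \<open>\<iota>\<close>, by the estimate
  for coefficients. So it extends to the closure, and the algebraic identities extend with it.
\<close>
lemma cond_exp_exists:
  obtains E where "bounded_clinear E" "\<And>f. f \<in> Cc G \<Longrightarrow> E (\<iota> f) = f \<one>" "\<And>b. norm (E b) \<le> norm b"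
proof -
  define E\<^sub>0 where "E\<^sub>0 b = (SOME f. f \<in> Cc G \<and> \<iota> f = b) \<one>" for b
  have E\<^sub>0: "E\<^sub>0 (\<iota> f) = f \<one>" if f: "f \<in> Cc G" for f
  proof -
    have "\<exists>f'. f' \<in> Cc G \<and> \<iota> f' = \<iota> f" using f by blast
    from someI_ex[OF this] show ?thesis
      using coeff_dist_le[OF _ f] by (fastforce simp: E\<^sub>0_def)
  qed
  have "uniformly_continuous_on (\<iota> ` Cc G) E\<^sub>0"
    unfolding uniformly_continuous_on_def
  proof (intro allI impI)
    fix e :: real assume "0 < e"
    then show "\<exists>d>0. \<forall>x\<in>\<iota> ` Cc G. \<forall>x'\<in>\<iota> ` Cc G. dist x' x < d \<longrightarrow> dist (E\<^sub>0 x') (E\<^sub>0 x) < e"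
      by (intro exI[of _ e]) (auto simp: E\<^sub>0 intro: le_less_trans[OF coeff_dist_le])
  qed
  then obtain E where "uniformly_continuous_on UNIV E" and E_eq: "\<And>x. x \<in> \<iota> ` Cc G \<Longrightarrow> E\<^sub>0 x = E x"
    using uniformly_continuous_on_extension_on_closure[of "\<iota> ` Cc G" E\<^sub>0] unfolding \<iota>_dense by metis
  then have cont: "continuous_on UNIV E" by (simp add: uniformly_continuous_imp_continuous)
  have cont': "continuous_on UNIV (\<lambda>x. E (t x))" if "continuous_on UNIV t" for t :: "'b \<Rightarrow> 'b"
    using continuous_on_compose2[OF cont that] by simp
  have E: "E (\<iota> f) = f \<one>" if "f \<in> Cc G" for f using E_eq[of "\<iota> f"] E\<^sub>0 that by simp
  note bl = bounded_linear_scaleC[THEN bounded_linear.continuous_on]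
  have norm_E: "norm (E b) \<le> norm b" for b
  proof (induction b rule: dense_induct)
    show "closed {b. norm (E b) \<le> norm b}"
      by (intro closed_Collect_le continuous_intros cont)
  qed (simp add: E coeff_le)
  have E_scale: "E (c *\<^sub>C b) = c *\<^sub>C E b" for c b
  proof (induction b rule: dense_induct)
    show "closed {b. E (c *\<^sub>C b) = c *\<^sub>C E b}"
      by (intro closed_Collect_eq cont' bl cont continuous_on_id)
  next
    case (range f)
    then show ?case using E[OF Cc_scaleC[OF range, of c]] by (simp add: \<iota>_scale E)
  qed
  have E_add_range: "E (\<iota> f + b) = E (\<iota> f) + E b" if f: "f \<in> Cc G" for f b
  proof (induction b rule: dense_induct)
    show "closed {b. E (\<iota> f + b) = E (\<iota> f) + E b}"
      by (intro closed_Collect_eq cont' cont continuous_intros)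
  next
    case (range f')
    then show ?case using E[OF Cc_add[OF f range]] by (simp add: \<iota>_add E f)
  qed
  have E_add: "E (a + b) = E a + E b" for a b
  proof (induction a rule: dense_induct)
    show "closed {a. E (a + b) = E a + E b}"
      by (intro closed_Collect_eq cont' cont continuous_intros)
  qed (rule E_add_range)
  have "bounded_clinear E"
    by (rule bounded_clinearI[of _ 1]) (simp_all add: E_add E_scale norm_E)
  with E norm_E that show thesis by blast
qed

lemma
  shows clinear_cond_exp: "bounded_clinear (standard_cond_exp G \<iota>)"
    and cond_exp_\<iota>: "f \<in> Cc G \<Longrightarrow> standard_cond_exp G \<iota> (\<iota> f) = f \<one>"
    and norm_cond_exp_le: "norm (standard_cond_exp G \<iota> b) \<le> norm b"
proof -
  obtain E where E: "bounded_clinear E" "\<And>f. f \<in> Cc G \<Longrightarrow> E (\<iota> f) = f \<one>"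
    "\<And>b. norm (E b) \<le> norm b"
    by (rule cond_exp_exists, rule that)
  have "standard_cond_exp G \<iota> = E"
    unfolding standard_cond_exp_def
  proof (rule the_equality)
    fix E' assume E': "bounded_clinear E' \<and> (\<forall>a\<in>Cc G. E' (\<iota> a) = a \<one>)"
    show "E' = E"
    proof
      fix b show "E' b = E b"
      proof (induction b rule: dense_induct)
        show "closed {b. E' b = E b}"
          using E(1) E' by (intro closed_Collect_eq linear_continuous_on bounded_clinear_linear) auto
      qed (use E(2) E' in simp)
    qed
  qed (use E in simp)
  with E show "bounded_clinear (standard_cond_exp G \<iota>)"
    "f \<in> Cc G \<Longrightarrow> standard_cond_exp G \<iota> (\<iota> f) = f \<one>"
    "norm (standard_cond_exp G \<iota> b) \<le> norm b" by auto
qed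

lemma cond_exp_single:
  assumes "g \<in> carrier G"
  shows "standard_cond_exp G \<iota> (\<iota> (single g a)) = (if g = \<one> then a else 0)"
  using cond_exp_\<iota>[OF single_in_Cc[OF assms], of a] by (simp add: single_def eq_commute)

subsection \<open>From traces on the crossed product to invariant traces on the coefficients\<close>

lemma conjugate_single:
  assumes g: "g \<in> carrier G" and h: "h \<in> carrier G"
  shows "\<iota> (single h 1) * \<iota> (single g a) * \<iota> (single (inv h) 1) =
    \<iota> (single (h \<otimes> g \<otimes> inv h) (\<alpha> h a))"
  using g h by (simp add: \<iota>_single_mult)

lemma trace_conjugate_single:
  assumes \<tau>: "is_trace \<tau>" and g: "g \<in> carrier G" and h: "h \<in> carrier G"
  shows "\<tau> (\<iota> (single (h \<otimes> g \<otimes> inv h) (\<alpha> h a))) = \<tau> (\<iota> (single g a))"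
proof -
  have "\<tau> (\<iota> (single h 1) * \<iota> (single g a) * \<iota> (single (inv h) 1)) =
      \<tau> (\<iota> (single (inv h) 1) * (\<iota> (single h 1) * \<iota> (single g a)))"
    by (rule trace_commute[OF \<tau>])
  also have "\<iota> (single (inv h) 1) * (\<iota> (single h 1) * \<iota> (single g a)) = \<iota> (single g a)"
    using g h by (simp add: \<iota>_single_mult action_inv m_assoc[symmetric])
  finally show ?thesis by (simp add: conjugate_single[OF g h])
qed

text \<open>
  The group elements \<open>s j\<close> may coincide, so the terms at equal places have to be collected first.
\<close>
lemma sum_single_support_le:
  fixes x :: "'g \<Rightarrow> real" and b :: "'j \<Rightarrow> 'a" and s :: "'j \<Rightarrow> 'g"
  assumes J: "finite J" and x: "\<And>t. 0 \<le> x t"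
  defines "F \<equiv> \<lambda>g. \<Sum>j\<in>J. single (s j) (b j) g"
  shows "(\<Sum>g\<in>{g. F g \<noteq> 0}. norm (F g) * x (inv g \<otimes> t)) \<le> (\<Sum>j\<in>J. norm (b j) * x (inv (s j) \<otimes> t))"
proof -
  have zero: "F g = 0" if "g \<notin> s ` J" for g
    unfolding F_def using that by (intro sum.neutral) (auto simp: single_def)
  have "(\<Sum>g\<in>{g. F g \<noteq> 0}. norm (F g) * x (inv g \<otimes> t)) = (\<Sum>g\<in>s ` J. norm (F g) * x (inv g \<otimes> t))"
    using zero J by (intro sum.mono_neutral_left) auto
  also have "\<dots> \<le> (\<Sum>g\<in>s ` J. \<Sum>j\<in>J. if g = s j then norm (b j) * x (inv (s j) \<otimes> t) else 0)"
  proof (rule sum_mono)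
    fix g
    have "norm (F g) * x (inv g \<otimes> t) \<le> (\<Sum>j\<in>J. norm (single (s j) (b j) g)) * x (inv g \<otimes> t)"
      unfolding F_def using x by (intro mult_right_mono norm_sum) auto
    also have "\<dots> = (\<Sum>j\<in>J. if g = s j then norm (b j) * x (inv (s j) \<otimes> t) else 0)"
      unfolding sum_distrib_right by (intro sum.cong) (auto simp: single_def)
    finally show "norm (F g) * x (inv g \<otimes> t) \<le> \<dots>" .
  qed
  also have "\<dots> = (\<Sum>j\<in>J. \<Sum>g\<in>s ` J. if g = s j then norm (b j) * x (inv (s j) \<otimes> t) else 0)"
    by (rule sum.swap)
  also have "\<dots> = (\<Sum>j\<in>J. norm (b j) * x (inv (s j) \<otimes> t))"
    using J by (intro sum.cong) auto
  finally show ?thesis .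
qed

text \<open>
  Averaging the conjugates of \<open>a u\<^sub>g\<close> by the elements \<open>h\<^sub>j\<close> from the Powers property gives elements
  of norm tending to zero on which the trace takes the same value as on \<open>a u\<^sub>g\<close>.
\<close>
lemma trace_vanishes_off_one:
  assumes Powers: "Powers_group G" and \<tau>: "is_trace \<tau>"
    and g: "g \<in> carrier G" "g \<noteq> \<one>"
  shows "\<tau> (\<iota> (single g a)) = 0"
proof -
  have lin: "bounded_linear \<tau>" by (rule bounded_clinear_linear[OF trace_clinear[OF \<tau>]])
  define B where "B k = 2 powr (p - 1) * (real k powr (1 - p) + 1 / real k)" for k :: nat
  define K where "K k = norm a * B k powr (1 / p)" for k
  have B0: "0 \<le> B k" for k by (simp add: B_def)
  have bound: "cmod (\<tau> (\<iota> (single g a))) \<le> onorm \<tau> * K k" if k: "1 \<le> k" for k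
  proof -
    have "finite {g} \<and> {g} \<noteq> {} \<and> {g} \<subseteq> carrier G - {\<one>} \<and> 1 \<le> k" using g k by simp
    from Powers[unfolded Powers_group_def, THEN conjunct2, THEN spec, THEN spec, THEN mp, OF this]
    obtain C D h where Powers_sets: "C \<union> D = carrier G \<and> C \<inter> D = {} \<and> h ` {1..k} \<subseteq> carrier G \<and>
        (\<forall>g\<in>{g}. (g <# C) \<inter> C = {}) \<and>
        (\<forall>j\<in>{1..k}. \<forall>l\<in>{1..k}. j \<noteq> l \<longrightarrow> (h j <# D) \<inter> (h l <# D) = {})"
      by (elim exE)
    then have CDh: "C \<union> D = carrier G" "h ` {1..k} \<subseteq> carrier G" "(g <# C) \<inter> C = {}"
      by simp_all
    have disj: "\<forall>j\<in>{1..k}. \<forall>l\<in>{1..k}. j \<noteq> l \<longrightarrow> (h j <# D) \<inter> (h l <# D) = {}"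
      using Powers_sets by (elim conjE)
    have hj: "h j \<in> carrier G" if "j \<in> {1..k}" for j using CDh(2) that by blast
    define s where "s j = h j \<otimes> g \<otimes> inv (h j)" for j
    define b where "b j = complex_of_real (1 / real k) *\<^sub>C \<alpha> (h j) a" for j
    define F where "F = (\<lambda>t. \<Sum>j=1..k. single (s j) (b j) t)"
    have s: "s j \<in> carrier G" if "j \<in> {1..k}" for j using hj[OF that] g by (simp add: s_def)
    have F: "F \<in> Cc G" unfolding F_def using s by (intro Cc_sum single_in_Cc) auto
    have norm_b: "norm (b j) = norm a / real k" if "j \<in> {1..k}" for j
      using hj[OF that] by (simp add: b_def norm_scaleC norm_divide)
    have same_value: "\<tau> (\<iota> F) = \<tau> (\<iota> (single g a))"
    proof -
      have "\<tau> (\<iota> (single (s j) (b j))) = \<tau> (\<iota> (single g a)) / of_nat k" if "j \<in> {1..k}" for j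
        using trace_conjugate_single[OF \<tau> g(1) hj[OF that]] s[OF that]
        by (simp add: b_def s_def single_scaleC \<iota>_scale single_in_Cc scaleC_complex_def
            bounded_clinear_scale[OF trace_clinear[OF \<tau>]])
      moreover have "\<iota> F = (\<Sum>j=1..k. \<iota> (single (s j) (b j)))"
        unfolding F_def using s by (intro \<iota>_sum single_in_Cc) auto
      ultimately have "\<tau> (\<iota> F) = (\<Sum>j=1..k. \<tau> (\<iota> (single g a)) / of_nat k)"
        using bounded_linear.linear[OF lin] by (simp add: linear_sum)
      then show ?thesis using k by simp
    qed
    \<comment> \<open>The norms of the \<open>k\<close> summands only add up to \<open>norm a\<close>; the gain over this trivial bound is the
      estimate for translates.\<close>
    have "convolution_bound F (K k)"
      unfolding convolution_bound_def
    proof (intro conjI allI impI)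
      show "0 \<le> K k" by (simp add: K_def)
      fix x :: "'g \<Rightarrow> real" assume x: "\<forall>t. 0 \<le> x t"
      let ?I = "\<integral>\<^sup>+t. ennreal (x t powr p) \<partial>count_space (carrier G)"
      have pw: "(\<Sum>t'\<in>{t'. F t' \<noteq> 0}. norm (F t') * x (inv t' \<otimes> t)) powr p \<le>
          (norm a / real k) powr p * (\<Sum>j=1..k. x (inv (s j) \<otimes> t)) powr p" for t
      proof -
        have "(\<Sum>t'\<in>{t'. F t' \<noteq> 0}. norm (F t') * x (inv t' \<otimes> t)) \<le>
            (\<Sum>j=1..k. norm (b j) * x (inv (s j) \<otimes> t))"
          unfolding F_def using x by (intro sum_single_support_le) auto
        also have "\<dots> = (norm a / real k) * (\<Sum>j=1..k. x (inv (s j) \<otimes> t))"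
          by (simp add: norm_b sum_distrib_left)
        finally have "(\<Sum>t'\<in>{t'. F t' \<noteq> 0}. norm (F t') * x (inv t' \<otimes> t)) powr p \<le> \<dots> powr p"
          using x p_pos by (intro powr_mono2 sum_nonneg) auto
        then show ?thesis by (simp only: powr_mult)
      qed
      have "(\<integral>\<^sup>+t. ennreal ((\<Sum>t'\<in>{t'. F t' \<noteq> 0}. norm (F t') * x (inv t' \<otimes> t)) powr p)
            \<partial>count_space (carrier G)) \<le>
          (\<integral>\<^sup>+t. ennreal ((norm a / real k) powr p) *
            ennreal ((\<Sum>j=1..k. x (inv (s j) \<otimes> t)) powr p) \<partial>count_space (carrier G))"
        using pw by (intro nn_integral_mono) (simp add: ennreal_mult[symmetric] ennreal_leI)
      also have "\<dots> = ennreal ((norm a / real k) powr p) *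
          (\<integral>\<^sup>+t. ennreal ((\<Sum>j=1..k. x (inv (s j) \<otimes> t)) powr p) \<partial>count_space (carrier G))"
        by (simp add: nn_integral_cmult)
      also have "\<dots> \<le> ennreal ((norm a / real k) powr p) *
          (ennreal (2 powr (p - 1) * (real k + real k powr (p - 1))) * ?I)"
        unfolding s_def using disj x
        by (intro mult_left_mono Powers_translates_bound[OF p_ge_1 g(1) CDh]) auto
      also have "\<dots> = ennreal ((norm a / real k) powr p *
          (2 powr (p - 1) * (real k + real k powr (p - 1)))) * ?I"
        by (simp add: ennreal_mult mult.assoc)
      also have "(norm a / real k) powr p * (2 powr (p - 1) * (real k + real k powr (p - 1))) =
          norm a powr p * B k"
        using k by (simp add: B_def powr_divide powr_diff field_simps)
      also have "norm a powr p * B k = K k powr p"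
        using B0[of k] p_pos by (simp add: K_def powr_mult powr_powr)
      finally show "(\<integral>\<^sup>+t. ennreal ((\<Sum>t'\<in>{t'. F t' \<noteq> 0}. norm (F t') * x (inv t' \<otimes> t)) powr p)
            \<partial>count_space (carrier G)) \<le> ennreal (K k powr p) * ?I" .
    qed
    then have "norm (\<iota> F) \<le> K k" by (rule norm_\<iota>_le[OF F])
    then have "onorm \<tau> * norm (\<iota> F) \<le> onorm \<tau> * K k"
      using onorm_pos_le[OF lin] by (intro mult_left_mono)
    then show ?thesis using onorm[OF lin, of "\<iota> F"] same_value by simp
  qed
  have "(\<lambda>k. B k) \<longlonglongrightarrow> 2 powr (p - 1) * (0 + 0)"
    unfolding B_def
    using p by (intro tendsto_intros tendsto_neg_powr filterlim_real_sequentially lim_1_over_n) auto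
  then have "(\<lambda>k. B k powr (1 / p)) \<longlonglongrightarrow> 0"
    using B0 p_pos by (intro tendsto_zero_powrI[of _ _ _ "1 / p"]) auto
  then have "(\<lambda>k. onorm \<tau> * K k) \<longlonglongrightarrow> 0"
    unfolding K_def by (intro tendsto_mult_right_zero)
  then have "cmod (\<tau> (\<iota> (single g a))) \<le> 0"
    using bound by (intro tendsto_lowerbound[of _ _ sequentially]) (auto intro: eventually_sequentiallyI[of 1])
  then show ?thesis by simp
qed

text \<open>
  By density, a trace is determined by its values on the elements $a u_g$, and these vanish for
  \<open>g \<noteq> \<one>\<close>. Invariance comes from conjugation with $u_g$, which implements the action.
\<close>
lemma trace_factors:
  assumes Powers: "Powers_group G" and \<tau>: "is_trace \<tau>"
  defines "\<sigma> \<equiv> \<lambda>a. \<tau> (\<iota> (single \<one> a))"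
  shows "is_trace \<sigma>" "G_invariant G \<alpha> \<sigma>" "\<tau> = \<sigma> \<circ> standard_cond_exp G \<iota>"
proof -
  have lin: "bounded_linear \<tau>" by (rule bounded_clinear_linear[OF trace_clinear[OF \<tau>]])
  have \<sigma>: "bounded_clinear \<sigma>"
    unfolding \<sigma>_def by (rule bounded_clinear_compose[OF trace_clinear[OF \<tau>] bounded_clinear_\<iota>_single[OF one_closed]])
  have "\<sigma> (a * b) = \<sigma> (b * a)" for a b
    using trace_commute[OF \<tau>, of "\<iota> (single \<one> a)" "\<iota> (single \<one> b)"]
    by (simp add: \<sigma>_def \<iota>_single_mult)
  then show "is_trace \<sigma>" using \<sigma> by (simp add: is_trace_def)
  show "G_invariant G \<alpha> \<sigma>"
    unfolding G_invariant_def \<sigma>_def using trace_conjugate_single[OF \<tau> one_closed] by simp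
  show "\<tau> = \<sigma> \<circ> standard_cond_exp G \<iota>"
  proof
    fix b
    have "\<tau> b = \<sigma> (standard_cond_exp G \<iota> b)"
    proof (induction b rule: additive_induct)
      show "closed {b. \<tau> b = \<sigma> (standard_cond_exp G \<iota> b)}"
        by (intro closed_Collect_eq linear_continuous_on lin
            bounded_clinear_linear[OF bounded_clinear_compose[OF \<sigma> clinear_cond_exp]])
    next
      fix g a assume g: "g \<in> carrier G"
      show "\<tau> (\<iota> (single g a)) = \<sigma> (standard_cond_exp G \<iota> (\<iota> (single g a)))"
        using trace_vanishes_off_one[OF Powers \<tau> g] linear_simps(3)[OF lin]
        by (simp add: cond_exp_single[OF g] \<sigma>_def)
    next
      show "\<tau> 0 = \<sigma> (standard_cond_exp G \<iota> 0)"
        using linear_simps(3)[OF lin] linear_simps(3)[OF bounded_clinear_linear[OF \<sigma>]]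
          linear_simps(3)[OF bounded_clinear_linear[OF clinear_cond_exp]] by simp
    next
      fix x y
      assume "\<tau> x = \<sigma> (standard_cond_exp G \<iota> x)" "\<tau> y = \<sigma> (standard_cond_exp G \<iota> y)"
      then show "\<tau> (x + y) = \<sigma> (standard_cond_exp G \<iota> (x + y))"
        by (simp add: bounded_clinear_add[OF clinear_cond_exp] bounded_clinear_add[OF \<sigma>]
            bounded_clinear_add[OF trace_clinear[OF \<tau>]])
    qed
    then show "\<tau> b = (\<sigma> \<circ> standard_cond_exp G \<iota>) b" by simp
  qed
qed

lemma normalized_trace_factors:
  assumes "Powers_group G" and \<tau>: "is_normalized_trace \<tau>"
  shows "\<exists>\<sigma>. is_normalized_trace \<sigma> \<and> G_invariant G \<alpha> \<sigma> \<and> \<tau> = \<sigma> \<circ> standard_cond_exp G \<iota>"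
proof -
  define \<sigma> where "\<sigma> a = \<tau> (\<iota> (single \<one> a))" for a
  have tr: "is_trace \<tau>" using \<tau> by (simp add: is_normalized_trace_def)
  note \<sigma> = trace_factors[OF assms(1) tr, folded \<sigma>_def]
  have "is_normalized_trace \<sigma>"
  proof (rule normalized_traceI[OF \<sigma>(1) _ _ norm_one_le])
    show "cmod (\<sigma> a) \<le> norm a" for a
      using normalized_trace_norm_le[OF \<tau>, of "\<iota> (single \<one> a)"] norm_\<iota>_single_le[OF one_closed, of a]
      by (simp add: \<sigma>_def)
    show "\<sigma> 1 = 1" using \<tau> by (simp add: \<sigma>_def \<iota>_one is_normalized_trace_def)
  qed
  with \<sigma> show ?thesis by blast
qed

subsection \<open>From invariant traces on the coefficients to traces on the crossed product\<close>

text \<open>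
  It suffices to compare the products of $a u_g$ and $b u_h$ in both orders. The conditional
  expectation kills both unless \<open>h\<close> is the inverse of \<open>g\<close>, and in that case invariance under
  \<open>\<alpha> h\<close> and the trace property of \<open>\<sigma>\<close> turn one value into the other.
\<close>
lemma trace_compose_cond_exp:
  assumes \<sigma>: "is_trace \<sigma>" and inv: "G_invariant G \<alpha> \<sigma>"
  shows "is_trace (\<sigma> \<circ> standard_cond_exp G \<iota>)"
proof -
  let ?E = "standard_cond_exp G \<iota>"
  let ?\<tau> = "\<lambda>b. \<sigma> (?E b)"
  have cl: "bounded_clinear ?\<tau>"
    by (rule bounded_clinear_compose[OF trace_clinear[OF \<sigma>] clinear_cond_exp])
  note add = bounded_clinear_add[OF cl]
  have zero: "?\<tau> 0 = 0" by (rule linear_simps(3)[OF bounded_clinear_linear[OF cl]])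
  have cont: "continuous_on UNIV (\<lambda>x. ?\<tau> (t x))" if "continuous_on UNIV t" for t :: "'b \<Rightarrow> 'b"
    using continuous_on_compose2[OF linear_continuous_on[OF bounded_clinear_linear[OF cl], of UNIV] that] by simp
  have singles: "?\<tau> (\<iota> (single g a) * \<iota> (single h b)) = ?\<tau> (\<iota> (single h b) * \<iota> (single g a))"
    if g: "g \<in> carrier G" and h: "h \<in> carrier G" for g h a b
  proof -
    have *: "?\<tau> (\<iota> (single g a) * \<iota> (single h b)) = (if g \<otimes> h = \<one> then \<sigma> (a * \<alpha> g b) else \<sigma> 0)"
      if "g \<in> carrier G" "h \<in> carrier G" for g h a b
      using that by (simp add: \<iota>_single_mult cond_exp_single)
    have comm: "g \<otimes> h = \<one> \<longleftrightarrow> h \<otimes> g = \<one>" using g h inv_comm by blast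
    have "\<sigma> (a * \<alpha> g b) = \<sigma> (b * \<alpha> h a)" if "g \<otimes> h = \<one>"
    proof -
      have hg: "h = inv g" using that g h comm inv_equality by metis
      have "\<sigma> (a * \<alpha> g b) = \<sigma> (\<alpha> h (a * \<alpha> g b))" using inv h by (simp add: G_invariant_def)
      also have "\<dots> = \<sigma> (\<alpha> h a * b)" using g h by (simp add: action_hom hg action_inv)
      also have "\<dots> = \<sigma> (b * \<alpha> h a)" by (rule trace_commute[OF \<sigma>])
      finally show ?thesis .
    qed
    then show ?thesis using *[OF g h] *[OF h g] comm by simp
  qed
  have half: "?\<tau> (x * \<iota> (single h b)) = ?\<tau> (\<iota> (single h b) * x)" if h: "h \<in> carrier G" for h b x
  proof (induction x rule: additive_induct)
    show "closed {x. ?\<tau> (x * \<iota> (single h b)) = ?\<tau> (\<iota> (single h b) * x)}"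
      by (intro closed_Collect_eq cont continuous_intros)
  qed (simp_all add: singles h distrib_left distrib_right add)
  have "?\<tau> (x * y) = ?\<tau> (y * x)" for x y
  proof (induction y rule: additive_induct)
    show "closed {y. ?\<tau> (x * y) = ?\<tau> (y * x)}"
      by (intro closed_Collect_eq cont continuous_intros)
  qed (simp_all add: half distrib_left distrib_right add)
  then show ?thesis using cl by (simp add: is_trace_def comp_def)
qed

lemma normalized_trace_compose_cond_exp:
  assumes \<sigma>: "is_normalized_trace \<sigma>" and inv: "G_invariant G \<alpha> \<sigma>"
  shows "is_normalized_trace (\<sigma> \<circ> standard_cond_exp G \<iota>)"
proof (rule normalized_traceI[OF _ _ _ norm_one_crossed_product_le])
  show "is_trace (\<sigma> \<circ> standard_cond_exp G \<iota>)"
    using \<sigma> inv by (intro trace_compose_cond_exp) (auto simp: is_normalized_trace_def)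
  show "cmod ((\<sigma> \<circ> standard_cond_exp G \<iota>) b) \<le> norm b" for b
    using normalized_trace_norm_le[OF \<sigma>, of "standard_cond_exp G \<iota> b"] norm_cond_exp_le[of b] by simp
  show "(\<sigma> \<circ> standard_cond_exp G \<iota>) 1 = 1"
    using cond_exp_\<iota>[OF single_in_Cc[OF one_closed], of 1] \<sigma> by (simp add: \<iota>_one is_normalized_trace_def)
qed

text \<open>
  Composition with an automorphism of the action produces another normalized trace.
\<close>
lemma unique_normalized_trace_invariant:
  assumes \<sigma>: "is_normalized_trace \<sigma>"
    and unique: "\<And>\<sigma>'. is_normalized_trace \<sigma>' \<Longrightarrow> \<sigma>' = \<sigma>"
  shows "G_invariant G \<alpha> \<sigma>"
  unfolding G_invariant_def
proof (intro ballI allI)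
  fix g a assume g: "g \<in> carrier G"
  have tr: "is_trace \<sigma>" using \<sigma> by (simp add: is_normalized_trace_def)
  have "is_normalized_trace (\<lambda>a. \<sigma> (\<alpha> g a))"
  proof (rule normalized_traceI[OF _ _ _ norm_one_le])
    show "is_trace (\<lambda>a. \<sigma> (\<alpha> g a))"
      using bounded_clinear_compose[OF trace_clinear[OF tr] bounded_clinear_action[OF g]]
        trace_commute[OF tr] by (simp add: is_trace_def action_hom[OF g])
    show "cmod (\<sigma> (\<alpha> g a)) \<le> norm a" for a
      using normalized_trace_norm_le[OF \<sigma>, of "\<alpha> g a"] g by simp
    show "\<sigma> (\<alpha> g 1) = 1" using \<sigma> g by (simp add: is_normalized_trace_def)
  qed
  from unique[OF this] show "\<sigma> (\<alpha> g a) = \<sigma> a" by metis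
qed

lemma unique_normalized_trace:
  assumes Powers: "Powers_group G" and unique: "\<exists>!\<sigma> :: 'a \<Rightarrow> complex. is_normalized_trace \<sigma>"
  shows "\<exists>!\<tau> :: 'b \<Rightarrow> complex. is_normalized_trace \<tau>"
proof -
  obtain \<sigma> :: "'a \<Rightarrow> complex" where \<sigma>: "is_normalized_trace \<sigma>"
    and eq: "\<And>\<sigma>'. is_normalized_trace \<sigma>' \<Longrightarrow> \<sigma>' = \<sigma>"
    using unique by blast
  show ?thesis
  proof (rule ex1I)
    show "is_normalized_trace (\<sigma> \<circ> standard_cond_exp G \<iota>)"
      by (rule normalized_trace_compose_cond_exp[OF \<sigma> unique_normalized_trace_invariant[OF \<sigma> eq]])
    show "\<tau> = \<sigma> \<circ> standard_cond_exp G \<iota>" if "is_normalized_trace \<tau>" for \<tau>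
      using normalized_trace_factors[OF Powers that] eq by metis
  qed
qed

end

theorem theorem3p5:
  fixes p :: real
    and G :: "('g, 'm) monoid_scheme"
    and \<alpha> :: "'g \<Rightarrow> 'a::unital_complex_banach_algebra \<Rightarrow> 'a"
    and \<iota> :: "('g \<Rightarrow> 'a) \<Rightarrow> 'b::unital_complex_banach_algebra"
  assumes "1 < p"
    and "countable (carrier G)"
    and "Powers_group G"
    and "isometric_G_Lp_operator_algebra TYPE('x) p G \<alpha>"
    and "separable_space (euclidean :: 'a topology)"
    and "nondegenerately_representable TYPE('x) p TYPE('a)"
    and "is_reduced_crossed_product TYPE('x) p G \<alpha> \<iota>"
  shows "(\<forall>\<tau>. is_trace \<tau> \<longrightarrow>
            (\<exists>\<sigma>. is_trace \<sigma> \<and> G_invariant G \<alpha> \<sigma> \<and>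
                 \<tau> = \<sigma> \<circ> standard_cond_exp G \<iota>)) \<and>
         (\<forall>\<tau>. is_normalized_trace \<tau> \<longrightarrow>
            (\<exists>\<sigma>. is_normalized_trace \<sigma> \<and> G_invariant G \<alpha> \<sigma> \<and>
                 \<tau> = \<sigma> \<circ> standard_cond_exp G \<iota>)) \<and>
         ((\<exists>!\<sigma> :: 'a \<Rightarrow> complex. is_normalized_trace \<sigma>) \<longrightarrow>
          (\<exists>!\<tau> :: 'b \<Rightarrow> complex. is_normalized_trace \<tau>))"
proof -
  have p1: "1 \<le> p" using assms(1) by simp
  interpret group G using assms(3) by (simp add: Powers_group_def)
  interpret isometric_group_action G \<alpha> p
    using assms(1,2,4) by unfold_locales (simp_all add: isometric_G_Lp_operator_algebra_def)
  obtain M :: "'x measure" and \<pi> :: "'a \<Rightarrow> ('x \<Rightarrow> complex) \<Rightarrow> 'x \<Rightarrow> complex"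
    where \<pi>: "isometric_Lp_rep p M \<pi>" "nondegenerate_Lp_rep p M \<pi>"
    using assms(6) unfolding nondegenerately_representable_def by blast
  note approx = admissible_rep_approximates[OF p1 assms(5) \<pi>]
  have \<iota>: "a \<in> Cc G \<Longrightarrow> b \<in> Cc G \<Longrightarrow> \<iota> (\<lambda>g. a g + b g) = \<iota> a + \<iota> b"
    "a \<in> Cc G \<Longrightarrow> \<iota> (\<lambda>g. c *\<^sub>C a g) = c *\<^sub>C \<iota> a"
    "a \<in> Cc G \<Longrightarrow> b \<in> Cc G \<Longrightarrow> \<iota> (Cc_mult G \<alpha> a b) = \<iota> a * \<iota> b"
    "closure (\<iota> ` Cc G) = UNIV"
    and norm_\<iota>: "a \<in> Cc G \<Longrightarrow> norm (\<iota> a) = reduced_norm TYPE('x) p G \<alpha> a" for a b c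
    using assms(7) unfolding is_reduced_crossed_product_def by blast+
  interpret crossed_product_completion G \<alpha> p \<iota>
  proof (unfold_locales; (fact \<iota>)?)
    show "norm (f \<one>\<^bsub>G\<^esub>) \<le> norm (\<iota> f)" if f: "f \<in> Cc G" for f
    proof (rule field_le_epsilon)
      fix e :: real assume "0 < e"
      then obtain N :: "'x measure" and \<pi>' :: "'a \<Rightarrow> _" where
        "admissible_rep p N \<pi>'" "norm (f \<one>\<^bsub>G\<^esub>) - e < Lp_opnorm p N (\<pi>' (f \<one>\<^bsub>G\<^esub>))"
        by (rule approx)
      then show "norm (f \<one>\<^bsub>G\<^esub>) \<le> norm (\<iota> f) + e"
        using norm_rep_coeff_le_reduced_norm[OF f, of N \<pi>'] norm_\<iota>[OF f] by linarith
    qed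
    show "norm (\<iota> f) \<le> K" if f: "f \<in> Cc G" and K: "convolution_bound f K" for f K
    proof -
      obtain N :: "'x measure" and \<pi>' :: "'a \<Rightarrow> _" where "admissible_rep p N \<pi>'"
        using approx[OF zero_less_one] by blast
      then show ?thesis using reduced_norm_le[OF f K, of N \<pi>'] norm_\<iota>[OF f] by simp
    qed
    show "norm (1 :: 'a) \<le> 1" by (rule norm_one_le[OF p1 \<pi>])
  qed
  show ?thesis
    using trace_factors[OF assms(3)] normalized_trace_factors[OF assms(3)]
      unique_normalized_trace[OF assms(3)] by blast
qed

end
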